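(* Let $d\ge 1$, let $Q\in\mathcal{M}^+(d)$ and $x_0\in\mathbb{R}^d\setminus\{0\}$, and let $\gamma,\ell,m,\theta_1,\dots,\theta_m,v_1,\dots,v_m$ be asymptotic data of $(Q,x_0)$. Let $\xi$ be a Lévy process in $\mathbb{R}^d$ with triplet $(a,\Sigma,\nu)$ such that $\mathbb{E}[\log(1\vee|\xi_1|)]<\infty$, and assume that the laws $\mu^\natural_t$ of $I^\natural_t$ satisfy condition (H). Assume moreover the invariance property $$d_{\mathrm{TV}}(u_1+I^\natural_\infty,\,I^\natural_\infty)=d_{\mathrm{TV}}(u_2+I^\natural_\infty,\,I^\natural_\infty)\qquad\text{for all }u_1,u_2\in\mathbb{R}^d\text{ with }|u_1|=|u_2| .$$ For $\epsilon>0$ small enough that the following quantities are defined and positive, set $$t_\epsilon:=\frac{1}{2\gamma}\ln\left(\frac1\epsilon\right)+\frac{\ell-1}{\gamma}\ln\left(\ln\left(\frac1\epsilon\right)\right),\qquad w_\epsilon:=\gamma^{-1}+o_\epsilon(1),$$ where $o_\epsilon(1)$ is any function of $\epsilon$ with $\lim_{\epsilon\to0}o_\epsilon(1)=0$. If $t\mapsto\left|\sum_{k=1}^me^{i\theta_kt}v_k\right|$ is constant, then the family $(X^{(\epsilon)},\epsilon>0)$ has profile cut-off at $(t_\epsilon,w_\epsilon)$.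
   Context: $\mathcal{M}^+(d)$ is the set of real $d\times d$ matrices all of whose eigenvalues have positive real part. $d_{\mathrm{TV}}(X,Y)=\sup_{A\in\mathcal{B}(\mathbb{R}^d)}|\mathbb{P}(X\in A)-\mathbb{P}(Y\in A)|$ is the total variation distance between the laws of the random vectors $X$ and $Y$. Lévy process. $\xi=(\xi_t,t\ge0)$ is a càdlàg process in $\mathbb{R}^d$ with $\xi_0=0$ and stationary independent increments, and $\mathbb{E}[e^{i\langle z,\xi_t\rangle}]=e^{t\psi(z)}$ with $$\psi(z)=-\tfrac12\langle z,\Sigma z\rangle+i\langle a,z\rangle+\int_{\mathbb{R}^d}\left(e^{i\langle z,x\rangle}-1-i\langle z,x\rangle\mathbf{1}_{\{|x|\le1\}}\right)\nu(\mathrm{d}x),$$ where $a\in\mathbb{R}^d$, $\Sigma$ is symmetric non-negative definite and $\nu$ is a measure on $\mathbb{R}^d\setminus\{0\}$ with $\int(1\wedge|x|^2)\nu(\mathrm{d}x)<\infty$. Ornstein-Uhlenbeck process. For $\epsilon>0$, $X^{(\epsilon)}$ is the unique strong solution of $\mathrm{d}X^{(\epsilon)}_t=-QX^{(\epsilon)}_t\,\mathrm{d}t+\sqrt{\epsilon}\,\mathrm{d}\xi_t$, $X^{(\epsilon)}_0=x_0$, i.e. $X^{(\epsilon)}_t=e^{-tQ}x_0+\sqrt\epsilon\int_0^te^{-(t-s)Q}\mathrm{d}\xi_s$. Under the log-moment condition $\mathbb{E}[\log(1\vee|\xi_1|)]<\infty$, $X^{(\epsilon)}_t$ converges in law as $t\to\infty$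 to a random vector $X^{(\epsilon)}_\infty$ whose law has characteristic function $\lambda\mapsto\exp\{\int_0^\infty\psi(\sqrt\epsilon e^{-sQ^T}\lambda)\mathrm{d}s\}$. Put $d^{(\epsilon)}(t):=d_{\mathrm{TV}}(X^{(\epsilon)}_t,X^{(\epsilon)}_\infty)$. Driftless functional. $\xi^\natural_t:=\xi_t-at$, $I^\natural_t:=\int_0^te^{-(t-s)Q}\mathrm{d}\xi^\natural_s$, $\mu^\natural_t$ is the law of $I^\natural_t$, $\widehat{\mu^\natural}_t$ its characteristic function, and $I^\natural_\infty$ denotes a random vector distributed as the limit in law of $I^\natural_t$ as $t\to\infty$ (which exists under the log-moment condition). Condition (H): for every $t>0$ the function $\widehat{\mu^\natural}_t$ is Lebesgue integrable on $\mathbb{R}^d$, and $$\lim_{R\to\infty}\ \sup_{s>t_0(R)}\int_{\{|\lambda|>R\}}|\widehat{\mu^\natural}_s(\lambda)|\,\mathrm{d}\lambda=0$$ for some positive function $R\mapsto t_0(R)$ with $t_0(R)\to\infty$ as $R\to\infty$. Asymptotic data of $(Q,x_0)$: numbers $\gamma>0$, $\ell,m\in\{1,\dots,d\}$, $\theta_1,\dots,\theta_m\in\mathbb{R}$ and linearly independent vectors $v_1,\dots,v_m\in\mathbb{C}^d$ such that $$\lim_{t\to\infty}\left|\frac{e^{\gamma t}}{t^{\ell-1}}e^{-tQ}x_0-\sum_{k=1}^me^{it\theta_k}v_k\right|=0 .$$ It is a known fact that such data exist for every $Q\in\mathcal{M}^+(d)$ and $x_0\ne0$, and that $0<\liminf_{t\to\infty}|\sum_ke^{it\theta_k}v_k|\le\limsup_{t\to\infty}|\sum_ke^{it\theta_k}v_k|\le\sum_k|v_k|$.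 Cut-off. The family has profile cut-off at $(t_\epsilon,w_\epsilon)$ if $t_\epsilon\to\infty$ as $\epsilon\to0$, $w_\epsilon=o(t_\epsilon)$, the limit $G(c):=\lim_{\epsilon\to0}d^{(\epsilon)}(t_\epsilon+cw_\epsilon)$ exists for all $c\in\mathbb{R}$, and $\lim_{c\to-\infty}G(c)=1$, $\lim_{c\to\infty}G(c)=0$. *)

theory Defs
  imports "HOL-Probability.Probability"
begin

section \<open>Matrices\<close>

definition complex_vec :: "real^'d \<Rightarrow> complex^'d" where
  "complex_vec x = (\<chi> i. complex_of_real (x $ i))"

definition complex_mat :: "real^'d^'d \<Rightarrow> complex^'d^'d" where
  "complex_mat A = (\<chi> i j. complex_of_real (A $ i $ j))"

definition complex_eigenvalue :: "real^'d^'d \<Rightarrow> complex \<Rightarrow> bool" where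
  "complex_eigenvalue A z \<longleftrightarrow> (\<exists>w. w \<noteq> 0 \<and> complex_mat A *v w = z *s w)"

definition Mplus :: "(real^'d^'d) set" where
  "Mplus = {Q. \<forall>z. complex_eigenvalue Q z \<longrightarrow> Re z > 0}"

text \<open>The type class product on \<open>real^'d^'d\<close> is the componentwise one, so the powers in the
  exponential series are iterates of \<open>(**)\<close>.\<close>

definition mat_exp :: "real^'d^'d \<Rightarrow> real^'d^'d" where
  "mat_exp A = (\<Sum>n. (1 / fact n) *\<^sub>R (((**) A ^^ n) (mat 1)))"

text \<open>The sums over \<open>k\<close> below range over indices \<open>1, \<dots>, m\<close>; linear independence is over the
  complex numbers and, by \<open>inj_on\<close>, is that of the family rather than only of its set of values.\<close>

definition asymptotic_data ::
    "real^'d^'d \<Rightarrow> real^'d \<Rightarrow> real \<Rightarrow> nat \<Rightarrow> nat \<Rightarrow> (nat \<Rightarrow> real) \<Rightarrow> (nat \<Rightarrow> complex^'d) \<Rightarrow> bool" where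
  "asymptotic_data Q x0 \<gamma> l m \<theta> v \<longleftrightarrow>
     \<gamma> > 0 \<and> l \<in> {1..CARD('d)} \<and> m \<in> {1..CARD('d)} \<and>
     inj_on v {1..m} \<and> vec.independent (v ` {1..m}) \<and>
     ((\<lambda>t. norm (complex_vec ((exp (\<gamma> * t) / t ^ (l - 1)) *\<^sub>R (mat_exp (- t *\<^sub>R Q) *v x0))
              - (\<Sum>k = 1..m. iexp (t * \<theta> k) *s v k))) \<longlongrightarrow> 0) at_top"

section \<open>Laws on \<open>real^'d\<close>\<close>

definition d_TV :: "(real^'d) measure \<Rightarrow> (real^'d) measure \<Rightarrow> real" where
  "d_TV \<mu> \<nu> = (SUP A\<in>sets borel. \<bar>measure \<mu> A - measure \<nu> A\<bar>)"

definition char_fun :: "(real^'d) measure \<Rightarrow> real^'d \<Rightarrow> complex" where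
  "char_fun \<mu> z = (LINT x|\<mu>. iexp (z \<bullet> x))"

text \<open>\<open>\<mu>\<close> is the law of the limit in distribution of \<open>Y t\<close> as \<open>t\<close> tends to infinity.\<close>

definition limit_law :: "'w measure \<Rightarrow> (real \<Rightarrow> 'w \<Rightarrow> real^'d) \<Rightarrow> (real^'d) measure \<Rightarrow> bool" where
  "limit_law M Y \<mu> \<longleftrightarrow>
     prob_space \<mu> \<and> sets \<mu> = sets borel \<and>
     (\<forall>f :: real^'d \<Rightarrow> real. continuous_on UNIV f \<longrightarrow> bounded (range f) \<longrightarrow>
        ((\<lambda>t. LINT \<omega>|M. f (Y t \<omega>)) \<longlongrightarrow> (LINT x|\<mu>. f x)) at_top)"

section \<open>Levy processes\<close>

text \<open>Processes are indexed by all reals; only their values at times \<open>t \<ge> 0\<close> are meaningful.\<close>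

definition cadlag :: "(real \<Rightarrow> real^'d) \<Rightarrow> bool" where
  "cadlag f \<longleftrightarrow> (\<forall>t\<ge>0. (f \<longlongrightarrow> f t) (at_right t)) \<and> (\<forall>t>0. \<exists>y. (f \<longlongrightarrow> y) (at_left t))"

text \<open>A measure on the punctured space is encoded as a Borel measure not charging the origin.\<close>

definition levy_triplet :: "real^'d \<Rightarrow> real^'d^'d \<Rightarrow> (real^'d) measure \<Rightarrow> bool" where
  "levy_triplet a S \<nu> \<longleftrightarrow>
     transpose S = S \<and> (\<forall>z. 0 \<le> z \<bullet> (S *v z)) \<and>
     sets \<nu> = sets borel \<and> emeasure \<nu> {0} = 0 \<and>
     (\<integral>\<^sup>+ x. ennreal (min 1 ((norm x)\<^sup>2)) \<partial>\<nu>) < \<infinity>"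

definition levy_exponent ::
    "real^'d \<Rightarrow> real^'d^'d \<Rightarrow> (real^'d) measure \<Rightarrow> real^'d \<Rightarrow> complex" where
  "levy_exponent a S \<nu> z =
     - complex_of_real (z \<bullet> (S *v z)) / 2 + \<i> * complex_of_real (a \<bullet> z)
     + (LINT x|\<nu>. iexp (z \<bullet> x) - 1 - \<i> * complex_of_real ((z \<bullet> x) * indicator {x. norm x \<le> 1} x))"

definition levy_process ::
    "'w measure \<Rightarrow> real^'d \<Rightarrow> real^'d^'d \<Rightarrow> (real^'d) measure \<Rightarrow> (real \<Rightarrow> 'w \<Rightarrow> real^'d) \<Rightarrow> bool" where
  "levy_process M a S \<nu> \<xi> \<longleftrightarrow>
     prob_space M \<and> levy_triplet a S \<nu> \<and>
     (\<forall>t\<ge>0. \<xi> t \<in> borel_measurable M) \<and>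
     (AE \<omega> in M. \<xi> 0 \<omega> = 0) \<and>
     (AE \<omega> in M. cadlag (\<lambda>t. \<xi> t \<omega>)) \<and>
     (\<forall>s\<ge>0. \<forall>h\<ge>0. distr M borel (\<lambda>\<omega>. \<xi> (s + h) \<omega> - \<xi> s \<omega>) = distr M borel (\<xi> h)) \<and>
     (\<forall>\<tau> :: nat \<Rightarrow> real. \<forall>n. 0 \<le> \<tau> 0 \<longrightarrow> mono \<tau> \<longrightarrow>
        prob_space.indep_vars M (\<lambda>_. borel) (\<lambda>i \<omega>. \<xi> (\<tau> (Suc i)) \<omega> - \<xi> (\<tau> i) \<omega>) {..<n}) \<and>
     (\<forall>t\<ge>0. \<forall>z. char_fun (distr M borel (\<xi> t)) z = exp (complex_of_real t * levy_exponent a S \<nu> z))"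

section \<open>Stochastic integrals and the Ornstein-Uhlenbeck process\<close>

text \<open>The integral over \<open>[0, t]\<close> of a deterministic matrix-valued integrand against a process is the
  limit of its left-endpoint Riemann-Stieltjes sums. For continuously differentiable \<open>F\<close> (the only
  case used) these converge along every cadlag path, by partial summation.\<close>

definition stoch_integral ::
    "(real \<Rightarrow> real^'d^'d) \<Rightarrow> (real \<Rightarrow> 'w \<Rightarrow> real^'d) \<Rightarrow> real \<Rightarrow> 'w \<Rightarrow> real^'d" where
  "stoch_integral F Z t \<omega> =
     lim (\<lambda>n. \<Sum>k<n. F (t * real k / real n) *v
                (Z (t * real (Suc k) / real n) \<omega> - Z (t * real k / real n) \<omega>))"

text \<open>Solution of \<open>dX = - Q X dt + sqrt \<epsilon> d\<xi>\<close>, \<open>X 0 = x0\<close>. The noise is additive, so the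
  equation makes sense path by path and determines \<open>X\<close> up to indistinguishability by \<open>\<xi>\<close>;
  in particular \<open>X\<close> is adapted to the completed filtration of \<open>\<xi>\<close>.\<close>

definition OU_solution ::
    "'w measure \<Rightarrow> real^'d^'d \<Rightarrow> real^'d \<Rightarrow> (real \<Rightarrow> 'w \<Rightarrow> real^'d) \<Rightarrow> real \<Rightarrow>
     (real \<Rightarrow> 'w \<Rightarrow> real^'d) \<Rightarrow> bool" where
  "OU_solution M Q x0 \<xi> \<epsilon> X \<longleftrightarrow>
     (\<forall>t\<ge>0. X t \<in> borel_measurable M) \<and>
     (AE \<omega> in M. cadlag (\<lambda>t. X t \<omega>)) \<and>
     (AE \<omega> in M. \<forall>t\<ge>0.
        X t \<omega> = x0 - integral {0..t} (\<lambda>s. Q *v X s \<omega>) + sqrt \<epsilon> *\<^sub>R \<xi> t \<omega>)"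

definition driftless :: "real^'d \<Rightarrow> (real \<Rightarrow> 'w \<Rightarrow> real^'d) \<Rightarrow> real \<Rightarrow> 'w \<Rightarrow> real^'d" where
  "driftless a \<xi> t \<omega> = \<xi> t \<omega> - t *\<^sub>R a"

definition I_nat ::
    "real^'d^'d \<Rightarrow> real^'d \<Rightarrow> (real \<Rightarrow> 'w \<Rightarrow> real^'d) \<Rightarrow> real \<Rightarrow> 'w \<Rightarrow> real^'d" where
  "I_nat Q a \<xi> t = stoch_integral (\<lambda>s. mat_exp (- (t - s) *\<^sub>R Q)) (driftless a \<xi>) t"

text \<open>Condition (H) for a family of laws \<open>\<mu> t\<close>. The supremum is taken in \<open>ennreal\<close> because
  it may be infinite for some \<open>R\<close>.\<close>

definition condition_H :: "(real \<Rightarrow> (real^'d) measure) \<Rightarrow> bool" where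
  "condition_H \<mu> \<longleftrightarrow>
     (\<forall>t>0. integrable lborel (char_fun (\<mu> t))) \<and>
     (\<exists>t0 :: real \<Rightarrow> real. (\<forall>R>0. t0 R > 0) \<and> filterlim t0 at_top at_top \<and>
        ((\<lambda>R. SUP s\<in>{t0 R<..}.
            \<integral>\<^sup>+ z. ennreal (norm (char_fun (\<mu> s) z)) * indicator {z. norm z > R} z \<partial>lborel) \<longlongrightarrow> 0) at_top)"

section \<open>Cut-off\<close>

definition profile_cutoff :: "(real \<Rightarrow> real \<Rightarrow> real) \<Rightarrow> (real \<Rightarrow> real) \<Rightarrow> (real \<Rightarrow> real) \<Rightarrow> bool" where
  "profile_cutoff dist\<^sub>\<epsilon> t w \<longleftrightarrow>
     filterlim t at_top (at_right 0) \<and> w \<in> o[at_right 0](t) \<and>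
     (\<exists>G :: real \<Rightarrow> real.
        (\<forall>c. ((\<lambda>\<epsilon>. dist\<^sub>\<epsilon> \<epsilon> (t \<epsilon> + c * w \<epsilon>)) \<longlongrightarrow> G c) (at_right 0)) \<and>
        (G \<longlongrightarrow> 1) at_bot \<and> (G \<longlongrightarrow> 0) at_top)"

end

theory Submission
  imports Defs "HOL-Real_Asymp.Real_Asymp"
begin

text \<open>
  Pathwise partial summation gives \<open>X t = exp (- t Q) x0 + sqrt \<epsilon> (I t + b t)\<close> with \<open>I\<close> the driftless
  functional and \<open>b t\<close> deterministic. Since both \<open>I t\<close> and \<open>I t + b t\<close> converge in law,
  \<open>b t\<close> converges, and the affine invariance of the total variation distance turns the distance to
  equilibrium into that between \<open>u + I t\<close> and \<open>I \<infinity>\<close>, where \<open>u\<close> is \<open>exp (- t Q) x0 / sqrt \<epsilon>\<close>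
  up to a vanishing error. Condition (H) makes the characteristic functions of \<open>I t\<close> converge in
  \<open>L\<^sup>1\<close>; by Gaussian smoothing this bounds the difference of the laws on bounded sets, and with
  tightness of the limit alone it gives convergence in total variation. The same bound shows that
  \<open>u \<mapsto> d_TV (u + I \<infinity>, I \<infinity>)\<close> is continuous. By invariance it depends only on \<open>norm u\<close>, which
  along \<open>t = t \<epsilon> + c w \<epsilon>\<close> tends to \<open>r exp (- c) / (2 \<gamma>) ^ (l - 1)\<close>, \<open>r\<close> being the constant
  norm of the oscillating sum.
\<close>

section \<open>Gaussian kernels\<close>

text \<open>No densities are constructed. The familiar bound of a difference of densities by the L1
  distance of the characteristic functions is obtained for measures directly: both laws are smoothed
  by the same Gaussian, whose inversion formula is an explicit computation, and the resulting
  estimate does not depend on its width. What it yields is a multiple of Lebesgue volume, hence the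
  restriction to bounded sets. Condition (H) speaks of high frequencies at late times only; Fatou's
  lemma carries it over to the limit law.

  The vector \<open>u\<close> itself need not converge: a constant norm of the oscillating sum
  leaves its direction free to rotate, and invariance is what makes convergence of the norm
  sufficient. The power of 2 \<gamma> in the limiting norm comes from the logarithmic correction of
  the cut-off time, which is built from ln (1 / \<epsilon>), while the time itself is asymptotic to
  ln (1 / \<epsilon>) / (2 \<gamma>).\<close>

lemma lborel_integral_prod:
  fixes f :: "'a::euclidean_space \<Rightarrow> real \<Rightarrow> 'b::{real_normed_field,banach,second_countable_topology}"
  assumes f: "\<And>b. b \<in> Basis \<Longrightarrow> integrable lborel (f b)"
  shows "integrable lborel (\<lambda>x. \<Prod>b\<in>Basis. f b (x \<bullet> b))"
    and "(LINT x|lborel. (\<Prod>b\<in>Basis. f b (x \<bullet> b))) = (\<Prod>b\<in>Basis. (LINT x|lborel. f b x))"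
proof -
  interpret product_sigma_finite "\<lambda>_::'a. lborel :: real measure" ..
  have [measurable]: "f b \<in> borel_measurable borel" if "b \<in> Basis" for b
    using borel_measurable_integrable[OF f[OF that]] by simp
  have eq: "(\<Prod>b\<in>Basis. f b ((\<Sum>b\<in>Basis. g b *\<^sub>R b) \<bullet> b)) = (\<Prod>b\<in>Basis. f b (g b))" for g
    by (intro prod.cong) auto
  have int: "integrable (\<Pi>\<^sub>M b\<in>(Basis::'a set). lborel) (\<lambda>g. \<Prod>b\<in>Basis. f b (g b))"
    using f by (intro product_integrable_prod) auto
  show "integrable lborel (\<lambda>x. \<Prod>b\<in>Basis. f b (x \<bullet> b))"
    using int by (subst lborel_eq, subst integrable_distr_eq) (simp_all add: eq)
  show "(LINT x|lborel. (\<Prod>b\<in>Basis. f b (x \<bullet> b))) = (\<Prod>b\<in>Basis. (LINT x|lborel. f b x))"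
    using f by (subst lborel_eq, subst integral_distr) (simp_all add: eq product_integral_prod)
qed

text \<open>The centred Gaussian density with standard deviation \<open>s\<close> in each
  coordinate. The product form lets integrals split by coordinates; \<open>gauss_eq\<close> supplies
  the radial form.\<close>

definition gauss :: "real \<Rightarrow> 'a::euclidean_space \<Rightarrow> real" where
  "gauss s y = (\<Prod>b\<in>Basis. normal_density 0 s (y \<bullet> b))"

lemma gauss_nonneg: "0 \<le> gauss s y"
  unfolding gauss_def by (intro prod_nonneg) auto

lemma gauss_measurable [measurable]: "gauss s \<in> borel_measurable borel"
  unfolding gauss_def[abs_def] by measurable

lemma integrable_gauss: "s > 0 \<Longrightarrow> integrable lborel (gauss s)"
  and integral_gauss: "s > 0 \<Longrightarrow> (LINT y|lborel. gauss s y) = 1"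
  unfolding gauss_def[abs_def] using lborel_integral_prod[of "\<lambda>_. normal_density 0 s"] by auto

lemma gauss_eq:
  fixes y :: "'a::euclidean_space"
  assumes "s > 0"
  shows "gauss s y = exp (- (norm y)\<^sup>2 / (2 * s\<^sup>2)) / (sqrt (2 * pi) * s) ^ DIM('a)"
proof -
  have "gauss s y = (\<Prod>b\<in>(Basis::'a set). exp (- (y \<bullet> b)\<^sup>2 / (2 * s\<^sup>2))) / (\<Prod>b\<in>(Basis::'a set). sqrt (2 * pi) * s)"
    unfolding gauss_def normal_density_def using assms
    by (simp add: prod_dividef real_sqrt_mult power_mult_distrib)
  also have "(\<Prod>b\<in>(Basis::'a set). exp (- (y \<bullet> b)\<^sup>2 / (2 * s\<^sup>2))) = exp (- (norm y)\<^sup>2 / (2 * s\<^sup>2))"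
    unfolding exp_sum[symmetric, OF finite_Basis]
    by (simp add: sum_divide_distrib[symmetric] sum_negf norm_eq_sqrt_inner euclidean_inner[of y y] power2_eq_square sum_nonneg)
  finally show ?thesis by simp
qed

lemma gauss_le:
  fixes y :: "'a::euclidean_space"
  assumes "s > 0"
  shows "gauss s y \<le> 1 / (sqrt (2 * pi) * s) ^ DIM('a)"
  unfolding gauss_eq[OF assms] using assms by (intro divide_right_mono) auto

text \<open>The substitution of \<open>s * x\<close> for \<open>x\<close> reduces the transform to
  that of the standard normal law.\<close>

lemma char_normal_density:
  assumes "s > 0"
  shows "(LINT x|lborel. iexp (t * x) * complex_of_real (normal_density 0 s x)) = complex_of_real (exp (- (s * t)\<^sup>2 / 2))"
    and "integrable lborel (\<lambda>x. iexp (t * x) * complex_of_real (normal_density 0 s x))"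
proof -
  have eq: "s * normal_density 0 s (s * x) = std_normal_density x" for x
    using assms unfolding normal_density_def by (simp add: power_mult_distrib real_sqrt_mult)
  have "(LINT x|lborel. iexp (t * x) * complex_of_real (normal_density 0 s x)) =
      s *\<^sub>R (LINT x|lborel. iexp (t * (s * x)) * complex_of_real (normal_density 0 s (s * x)))"
    using lborel_integral_real_affine[of s "\<lambda>x. iexp (t * x) * complex_of_real (normal_density 0 s x)" 0] assms by simp
  also have "\<dots> = (LINT x|lborel. s *\<^sub>R (iexp (t * (s * x)) * complex_of_real (normal_density 0 s (s * x))))"
    by (simp only: integral_scaleR_right)
  also have "\<dots> = (LINT x|lborel. std_normal_density x *\<^sub>R iexp (s * t * x))"
    by (intro Bochner_Integration.integral_cong refl) (simp add: eq[symmetric] scaleR_conv_of_real mult_ac)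
  also have "\<dots> = char std_normal_distribution (s * t)"
    unfolding char_def by (subst integral_density) auto
  finally show "(LINT x|lborel. iexp (t * x) * complex_of_real (normal_density 0 s x)) = complex_of_real (exp (- (s * t)\<^sup>2 / 2))"
    by (simp add: char_std_normal_distribution)
  show "integrable lborel (\<lambda>x. iexp (t * x) * complex_of_real (normal_density 0 s x))"
    by (rule Bochner_Integration.integrable_bound[OF integrable_normal_density[OF assms, of 0]])
      (auto simp: norm_mult)
qed

lemma char_gauss:
  fixes y :: "'a::euclidean_space"
  assumes "s > 0"
  shows "(LINT z|lborel. iexp (y \<bullet> z) * complex_of_real (gauss s z)) = complex_of_real (exp (- (s * norm y)\<^sup>2 / 2))"
proof -
  have "iexp (y \<bullet> z) * complex_of_real (gauss s z) =
      (\<Prod>b\<in>Basis. iexp ((y \<bullet> b) * (z \<bullet> b)) * complex_of_real (normal_density 0 s (z \<bullet> b)))" for z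
    by (simp add: gauss_def prod.distrib exp_sum[symmetric] euclidean_inner[of y z] sum_distrib_left)
  then have "(LINT z|lborel. iexp (y \<bullet> z) * complex_of_real (gauss s z)) =
     (\<Prod>b\<in>Basis. complex_of_real (exp (- (s * (y \<bullet> b))\<^sup>2 / 2)))"
    by (simp only: lborel_integral_prod(2)[of "\<lambda>b x. iexp ((y \<bullet> b) * x) * complex_of_real (normal_density 0 s x)",
      OF char_normal_density(2)[OF assms]] char_normal_density(1)[OF assms])
  also have "\<dots> = complex_of_real (exp (- (s * norm y)\<^sup>2 / 2))"
    unfolding of_real_prod[symmetric] exp_sum[symmetric, OF finite_Basis]
    by (simp add: sum_divide_distrib[symmetric] sum_negf norm_eq_sqrt_inner euclidean_inner[of y y]
      power_mult_distrib sum_distrib_left[symmetric] power2_eq_square[symmetric] sum_nonneg)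
  finally show ?thesis .
qed

text \<open>Self-duality of the Gaussian: width \<open>s\<close> is recovered from width
  \<open>1 / s\<close>. This explicit case is all of Fourier inversion that the argument
  uses.\<close>

lemma gauss_fourier:
  fixes y :: "'a::euclidean_space"
  assumes "s > 0"
  shows "complex_of_real (gauss s y) = (LINT z|lborel. iexp (y \<bullet> z) * complex_of_real (gauss (1 / s) z)) / (sqrt (2 * pi) * s) ^ DIM('a)"
  using assms by (subst char_gauss) (auto simp: gauss_eq field_simps)

lemma gauss_minus: "gauss s (- y) = gauss s y"
  by (simp add: gauss_def normal_density_def)

lemma gauss_scaled:
  fixes y :: "'a::euclidean_space"
  assumes "s > 0"
  shows "s ^ DIM('a) * gauss s (s *\<^sub>R y) = gauss 1 y"
  using assms by (simp add: gauss_eq power_mult_distrib)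

section \<open>Smoothing of probability laws by Gaussian kernels\<close>

text \<open>Since \<open>\<mu>\<close> has mass 1, a bound depending on the second variable alone is
  already integrable on the product. It justifies the exchanges of integrals below.\<close>

lemma integrable_pair_bound:
  fixes F :: "'a \<Rightarrow> 'b::euclidean_space \<Rightarrow> 'c::{banach,second_countable_topology}"
    and h :: "'b \<Rightarrow> 'd::{banach,second_countable_topology}"
  assumes "prob_space \<mu>" and h: "integrable lborel h"
    and [measurable]: "case_prod F \<in> borel_measurable (\<mu> \<Otimes>\<^sub>M lborel)"
    and le: "\<And>x y. norm (F x y) \<le> norm (h y)"
  shows "integrable (\<mu> \<Otimes>\<^sub>M lborel) (case_prod F)"
proof -
  interpret prob_space \<mu> by fact
  interpret pair_sigma_finite \<mu> lborel ..
  have [measurable]: "h \<in> borel_measurable lborel" using h by auto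
  have "integrable (\<mu> \<Otimes>\<^sub>M lborel) (\<lambda>(x, y). h y)"
    by (rule Fubini_integrable) (use h in auto)
  then show ?thesis
    by (rule Bochner_Integration.integrable_bound) (auto intro!: AE_I2 le)
qed

lemma lborel_integral_translate:
  fixes g :: "'a::euclidean_space \<Rightarrow> 'b::{banach, second_countable_topology}"
  assumes [measurable]: "g \<in> borel_measurable borel"
  shows "(LINT y|lborel. g (c + y)) = (LINT y|lborel. g y)"
  by (subst (2) lborel_distr_plus[symmetric, of c], subst integral_distr) auto

lemma lborel_integral_scale:
  fixes g :: "'a::euclidean_space \<Rightarrow> 'b::{banach, second_countable_topology}"
  assumes [measurable]: "g \<in> borel_measurable borel" and "s > 0"
  shows "(LINT y|lborel. g y) = (LINT y|lborel. s ^ DIM('a) *\<^sub>R g (s *\<^sub>R y))"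
  by (subst lborel_affine[of s 0], use assms in simp, subst integral_density)
    (use assms in \<open>auto simp: integral_distr\<close>)

lemma char_fun_measurable [measurable]:
  assumes "prob_space \<mu>" "sets \<mu> = sets borel"
  shows "char_fun \<mu> \<in> borel_measurable borel"
proof -
  interpret prob_space \<mu> by fact
  note [measurable_cong] = assms(2)
  show ?thesis unfolding char_fun_def[abs_def] by measurable
qed

lemma norm_char_fun_le_1:
  assumes "prob_space \<mu>"
  shows "norm (char_fun \<mu> z) \<le> 1"
proof -
  interpret prob_space \<mu> by fact
  have "norm (char_fun \<mu> z) \<le> (LINT x|\<mu>. norm (iexp (z \<bullet> x)))"
    unfolding char_fun_def by (rule integral_norm_bound)
  then show ?thesis by (simp add: prob_space)
qed

text \<open>Inversion for a smoothed law: the kernel is written as a Fourier integral, and Fubini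
  lets the integral over \<open>x\<close> produce the characteristic function. The factor
  \<open>gauss (1 / s)\<close> makes everything integrable whatever \<open>\<mu>\<close> is.\<close>

lemma gauss_conv_fourier:
  fixes \<mu> :: "(real^'d) measure"
  assumes \<mu>: "prob_space \<mu>" "sets \<mu> = sets borel" and s: "s > 0"
  shows "complex_of_real (LINT x|\<mu>. gauss s (u - x)) =
    (LINT z|lborel. char_fun \<mu> z * (iexp (- (u \<bullet> z)) * complex_of_real (gauss (1 / s) z))) / (sqrt (2 * pi) * s) ^ CARD('d)"
    and "integrable lborel (\<lambda>z. char_fun \<mu> z * (iexp (- (u \<bullet> z)) * complex_of_real (gauss (1 / s) z)))"
proof -
  interpret prob_space \<mu> by fact
  interpret P: pair_sigma_finite \<mu> "lborel :: (real^'d) measure" ..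
  note [measurable_cong] = \<mu>(2)
  have s': "1 / s > 0" using s by simp
  define F where "F x z = iexp ((x - u) \<bullet> z) * complex_of_real (gauss (1 / s) z)" for x z :: "real^'d"
  have F: "integrable (\<mu> \<Otimes>\<^sub>M lborel) (case_prod F)"
    unfolding F_def
    by (rule integrable_pair_bound[OF \<mu>(1) integrable_gauss[OF s']]) (simp_all add: norm_mult)
  have eq: "(LINT x|\<mu>. F x z) = char_fun \<mu> z * (iexp (- (u \<bullet> z)) * complex_of_real (gauss (1 / s) z))" for z
  proof -
    have "F x z = iexp (z \<bullet> x) * (iexp (- (u \<bullet> z)) * complex_of_real (gauss (1 / s) z))" for x
      unfolding F_def by (simp add: inner_diff_left exp_add[symmetric] inner_commute algebra_simps)
    then show ?thesis by (simp add: char_fun_def)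
  qed
  have "complex_of_real (gauss s (u - x)) = (LINT z|lborel. F x z) / (sqrt (2 * pi) * s) ^ CARD('d)" for x
    using gauss_fourier[OF s, of "x - u"] gauss_minus[of s "x - u"] by (simp add: F_def)
  then have "complex_of_real (LINT x|\<mu>. gauss s (u - x)) = (LINT x|\<mu>. (LINT z|lborel. F x z)) / (sqrt (2 * pi) * s) ^ CARD('d)"
    by (simp flip: integral_complex_of_real)
  also have "(LINT x|\<mu>. (LINT z|lborel. F x z)) = (LINT z|lborel. (LINT x|\<mu>. F x z))"
    using P.Fubini_integral[OF F] by simp
  finally show "complex_of_real (LINT x|\<mu>. gauss s (u - x)) =
    (LINT z|lborel. char_fun \<mu> z * (iexp (- (u \<bullet> z)) * complex_of_real (gauss (1 / s) z))) / (sqrt (2 * pi) * s) ^ CARD('d)"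
    by (simp add: eq)
  show "integrable lborel (\<lambda>z. char_fun \<mu> z * (iexp (- (u \<bullet> z)) * complex_of_real (gauss (1 / s) z)))"
    using P.integrable_snd[OF F] by (simp add: eq)
qed

text \<open>The bound is uniform in \<open>s\<close>: the peak of \<open>gauss (1 / s)\<close>
  contributes s / sqrt (2 pi) per dimension, the prefactor of the inversion formula 1 / (sqrt (2 pi)
  s), and their product is 1 / (2 pi).\<close>

lemma gauss_conv_diff_bound:
  fixes \<mu> \<nu> :: "(real^'d) measure"
  assumes \<mu>: "prob_space \<mu>" "sets \<mu> = sets borel" and \<nu>: "prob_space \<nu>" "sets \<nu> = sets borel" and s: "s > 0"
    and int: "integrable lborel (\<lambda>z. char_fun \<mu> z - char_fun \<nu> z)"
  shows "\<bar>(LINT x|\<mu>. gauss s (u - x)) - (LINT x|\<nu>. gauss s (u - x))\<bar>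
    \<le> (LINT z|lborel. norm (char_fun \<mu> z - char_fun \<nu> z)) / (2 * pi) ^ CARD('d)"
proof -
  define e where "e z = iexp (- (u \<bullet> z)) * complex_of_real (gauss (1 / s) z)" for z
  define C where "C = 1 / (sqrt (2 * pi) * (1 / s)) ^ CARD('d)"
  have C: "norm (e z) \<le> C" "C \<ge> 0" for z
    using gauss_le[of "1 / s" z] s gauss_nonneg[of "1 / s" z] by (auto simp: e_def C_def norm_mult)
  have CC: "C / (sqrt (2 * pi) * s) ^ CARD('d) = 1 / (2 * pi) ^ CARD('d)"
  proof -
    have "sqrt (2 * pi) * (1 / s) * (sqrt (2 * pi) * s) = sqrt (2 * pi) * sqrt (2 * pi)"
      using s by (simp add: field_simps)
    also have "\<dots> = 2 * pi" by (rule real_sqrt_mult_self[THEN trans]) simp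
    finally show ?thesis
      by (simp only: C_def divide_divide_eq_left power_mult_distrib[symmetric])
  qed
  have "complex_of_real ((LINT x|\<mu>. gauss s (u - x)) - (LINT x|\<nu>. gauss s (u - x)))
    = (LINT z|lborel. (char_fun \<mu> z - char_fun \<nu> z) * e z) / (sqrt (2 * pi) * s) ^ CARD('d)"
    unfolding of_real_diff gauss_conv_fourier(1)[OF \<mu> s] gauss_conv_fourier(1)[OF \<nu> s] e_def diff_divide_distrib[symmetric] left_diff_distrib
    by (rule arg_cong[where f="\<lambda>x. x / _"], rule Bochner_Integration.integral_diff[symmetric];
      rule gauss_conv_fourier(2)) (fact \<mu> \<nu> s)+
  then have "\<bar>(LINT x|\<mu>. gauss s (u - x)) - (LINT x|\<nu>. gauss s (u - x))\<bar>
     = norm (LINT z|lborel. (char_fun \<mu> z - char_fun \<nu> z) * e z) / (sqrt (2 * pi) * s) ^ CARD('d)"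
    using s by (subst norm_of_real[where 'a=complex, symmetric]) (simp only: norm_divide norm_of_real abs_of_pos zero_less_power mult_pos_pos real_sqrt_gt_zero pi_gt_zero zero_less_numeral)
  also have "norm (LINT z|lborel. (char_fun \<mu> z - char_fun \<nu> z) * e z) \<le> (LINT z|lborel. norm ((char_fun \<mu> z - char_fun \<nu> z) * e z))"
    by (rule integral_norm_bound)
  also have "\<dots> \<le> (LINT z|lborel. norm (char_fun \<mu> z - char_fun \<nu> z) * C)"
    using int C by (intro Bochner_Integration.integral_mono') (auto simp: norm_mult simp del: of_real_power intro!: mult_left_mono mult_nonneg_nonneg)
  also have "\<dots> = (LINT z|lborel. norm (char_fun \<mu> z - char_fun \<nu> z)) * C" by simp
  finally have "\<bar>(LINT x|\<mu>. gauss s (u - x)) - (LINT x|\<nu>. gauss s (u - x))\<bar>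
     \<le> (LINT z|lborel. norm (char_fun \<mu> z - char_fun \<nu> z)) * C / (sqrt (2 * pi) * s) ^ CARD('d)"
    using s by (simp add: divide_right_mono)
  also have "\<dots> = (LINT z|lborel. norm (char_fun \<mu> z - char_fun \<nu> z)) * (C / (sqrt (2 * pi) * s) ^ CARD('d))" by simp
  finally show ?thesis unfolding CC by simp
qed

text \<open>Smoothing is moved from the test function to the law by the substitution of
  \<open>u\<close> for \<open>x + y\<close>. The kernel is bounded, so integrability of
  \<open>g\<close> alone gives a dominating function.\<close>

lemma gauss_smooth_swap:
  fixes \<mu> :: "(real^'d) measure" and g :: "real^'d \<Rightarrow> real"
  assumes \<mu>: "prob_space \<mu>" "sets \<mu> = sets borel" and s: "s > 0"
    and g: "integrable lborel g"
  shows "(LINT x|\<mu>. (LINT y|lborel. g (x + y) * gauss s y)) = (LINT u|lborel. g u * (LINT x|\<mu>. gauss s (u - x)))"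
    and "integrable lborel (\<lambda>u. g u * (LINT x|\<mu>. gauss s (u - x)))"
proof -
  interpret prob_space \<mu> by fact
  interpret P: pair_sigma_finite \<mu> "lborel :: (real^'d) measure" ..
  note [measurable_cong] = \<mu>(2)
  have [measurable]: "g \<in> borel_measurable borel" using g by auto
  define C where "C = 1 / (sqrt (2 * pi) * s) ^ CARD('d)"
  have "norm (g u * gauss s (u - x)) \<le> norm (C * g u)" for x u
    using mult_left_mono[OF gauss_le[OF s, of "u - x"], of "\<bar>g u\<bar>"] gauss_nonneg[of s "u - x"] s
    by (simp add: abs_mult C_def mult.commute)
  then have int: "integrable (\<mu> \<Otimes>\<^sub>M lborel) (\<lambda>(x, u). g u * gauss s (u - x))"
    by (intro integrable_pair_bound[OF \<mu>(1), of "\<lambda>u. C * g u"]) (use g in auto)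
  have "(LINT y|lborel. g (x + y) * gauss s y) = (LINT u|lborel. g u * gauss s (u - x))" for x
    by (subst lborel_integral_translate[symmetric, of _ x]) simp_all
  then show "(LINT x|\<mu>. (LINT y|lborel. g (x + y) * gauss s y)) = (LINT u|lborel. g u * (LINT x|\<mu>. gauss s (u - x)))"
    using P.Fubini_integral[OF int] by simp
  show "integrable lborel (\<lambda>u. g u * (LINT x|\<mu>. gauss s (u - x)))"
    using P.integrable_snd[OF int] by simp
qed

text \<open>Rescaling \<open>y\<close> moves the shrinking width from the kernel into the argument
  of \<open>g\<close>. The weight is then a fixed Gaussian, and dominated convergence applies once
  in \<open>y\<close> and once in \<open>x\<close>.\<close>

lemma gauss_smooth_tendsto:
  fixes \<mu> :: "(real^'d) measure" and g :: "real^'d \<Rightarrow> real"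
  assumes \<mu>: "prob_space \<mu>" "sets \<mu> = sets borel"
    and g: "continuous_on UNIV g" "\<And>x. \<bar>g x\<bar> \<le> B"
  shows "(\<lambda>n. LINT x|\<mu>. (LINT y|lborel. g (x + y) * gauss (1 / real (Suc n)) y)) \<longlonglongrightarrow> (LINT x|\<mu>. g x)"
proof -
  interpret prob_space \<mu> by fact
  note [measurable_cong] = \<mu>(2)
  have [measurable]: "g \<in> borel_measurable borel" using g(1) by (rule borel_measurable_continuous_onI)
  define A where "A n x = (LINT y|lborel. g (x + y) * gauss (1 / real (Suc n)) y)" for n x
  have A_eq: "A n x = (LINT y|lborel. g (x + (1 / real (Suc n)) *\<^sub>R y) * gauss 1 y)" for n x
    unfolding A_def
    by (subst lborel_integral_scale[where s="1 / real (Suc n)"])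
      (simp_all add: gauss_scaled[where s="1 / real (Suc n)", simplified, symmetric] algebra_simps)
  have int1: "integrable lborel (\<lambda>y. B * gauss 1 (y::real^'d))"
    using integrable_gauss[of 1, where 'a="real^'d"] by simp
  have bnd: "\<bar>g z * gauss 1 y\<bar> \<le> B * gauss 1 y" for z y :: "real^'d"
    using g(2)[of z] gauss_nonneg[of 1 y] by (auto simp: abs_mult intro!: mult_right_mono)
  have lim: "(\<lambda>n. A n x) \<longlonglongrightarrow> g x" for x
  proof -
    have "(\<lambda>n. A n x) \<longlonglongrightarrow> (LINT y|lborel. g (x + 0 *\<^sub>R y) * gauss 1 y)"
      unfolding A_eq
    proof (rule integral_dominated_convergence[OF _ _ int1])
      show "AE y in lborel. (\<lambda>n. g (x + (1 / real (Suc n)) *\<^sub>R y) * gauss 1 y) \<longlonglongrightarrow> g (x + 0 *\<^sub>R y) * gauss 1 y"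
        by (intro AE_I2 tendsto_mult tendsto_const continuous_on_tendsto_compose[OF g(1)] tendsto_add tendsto_scaleR
          lim_1_over_n[THEN LIMSEQ_Suc]) auto
    qed (use bnd in auto)
    also have "(LINT y|lborel. g (x + 0 *\<^sub>R y) * gauss 1 y) = g x" by (simp add: integral_gauss)
    finally show ?thesis .
  qed
  have "\<bar>A n x\<bar> \<le> B" for n x
  proof -
    have "\<bar>A n x\<bar> \<le> (LINT y|lborel. B * gauss 1 (y::real^'d))"
      unfolding A_eq by (rule order_trans[OF integral_abs_bound], rule Bochner_Integration.integral_mono'[OF int1])
        (use bnd in \<open>auto intro: order_trans[OF abs_ge_zero]\<close>)
    then show ?thesis by (simp add: integral_gauss)
  qed
  then show ?thesis unfolding A_def[symmetric]
    by (intro integral_dominated_convergence[where w="\<lambda>_. B"] AE_I2 lim) (auto simp: A_def)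
qed

text \<open>Smoothing with width 1 / (n + 1) gives the estimate with a constant free of
  \<open>n\<close>, so it survives the limit. In effect the signed measure \<open>\<mu>\<close> -
  \<open>\<nu>\<close> has a density bounded by the L1 distance over (2 pi) ^ d.\<close>

lemma char_fun_integral_bound:
  fixes \<mu> \<nu> :: "(real^'d) measure" and g :: "real^'d \<Rightarrow> real"
  assumes \<mu>: "prob_space \<mu>" "sets \<mu> = sets borel" and \<nu>: "prob_space \<nu>" "sets \<nu> = sets borel"
    and int: "integrable lborel (\<lambda>z. char_fun \<mu> z - char_fun \<nu> z)"
    and g: "continuous_on UNIV g" "\<And>x. \<bar>g x\<bar> \<le> B" "integrable lborel g"
  shows "\<bar>(LINT x|\<mu>. g x) - (LINT x|\<nu>. g x)\<bar>
    \<le> (LINT u|lborel. \<bar>g u\<bar>) * (LINT z|lborel. norm (char_fun \<mu> z - char_fun \<nu> z)) / (2 * pi) ^ CARD('d)"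
proof (rule LIMSEQ_le_const2)
  let ?A = "\<lambda>\<mu> n. LINT x|\<mu>. (LINT y|lborel. g (x + y) * gauss (1 / real (Suc n)) y)"
  let ?D = "(LINT z|lborel. norm (char_fun \<mu> z - char_fun \<nu> z)) / (2 * pi) ^ CARD('d)"
  show "(\<lambda>n. \<bar>?A \<mu> n - ?A \<nu> n\<bar>) \<longlonglongrightarrow> \<bar>(LINT x|\<mu>. g x) - (LINT x|\<nu>. g x)\<bar>"
    by (intro tendsto_intros gauss_smooth_tendsto[where B=B] \<mu> \<nu> g)
  show "\<exists>N. \<forall>n\<ge>N. \<bar>?A \<mu> n - ?A \<nu> n\<bar> \<le>
    (LINT u|lborel. \<bar>g u\<bar>) * (LINT z|lborel. norm (char_fun \<mu> z - char_fun \<nu> z)) / (2 * pi) ^ CARD('d)"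
  proof (intro exI allI impI)
    fix n :: nat
    define s where "s = 1 / real (Suc n)"
    have s: "s > 0" by (simp add: s_def)
    have "?A \<mu> n - ?A \<nu> n = (LINT u|lborel. g u * ((LINT x|\<mu>. gauss s (u - x)) - (LINT x|\<nu>. gauss s (u - x))))"
      unfolding s_def[symmetric] gauss_smooth_swap(1)[OF \<mu> s g(3)] gauss_smooth_swap(1)[OF \<nu> s g(3)]
      by (subst Bochner_Integration.integral_diff[symmetric])
        (auto intro!: gauss_smooth_swap(2) \<mu> \<nu> s g(3) simp: right_diff_distrib)
    also have "\<bar>\<dots>\<bar> \<le> (LINT u|lborel. \<bar>g u\<bar> * ?D)"
    proof (rule order_trans[OF integral_abs_bound], rule Bochner_Integration.integral_mono')
      show "integrable lborel (\<lambda>u. \<bar>g u\<bar> * ?D)" using g(3) by (intro integrable_mult_left integrable_abs)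
      show "\<bar>g u * ((LINT x|\<mu>. gauss s (u - x)) - (LINT x|\<nu>. gauss s (u - x)))\<bar> \<le> \<bar>g u\<bar> * ?D" for u
        unfolding abs_mult by (intro mult_left_mono gauss_conv_diff_bound \<mu> \<nu> s int abs_ge_zero)
      show "0 \<le> \<bar>g u\<bar> * ?D" for u
        by (intro mult_nonneg_nonneg divide_nonneg_nonneg integral_nonneg_AE) auto
    qed
    finally show "\<bar>?A \<mu> n - ?A \<nu> n\<bar> \<le>
       (LINT u|lborel. \<bar>g u\<bar>) * (LINT z|lborel. norm (char_fun \<mu> z - char_fun \<nu> z)) / (2 * pi) ^ CARD('d)" by simp
  qed
qed

section \<open>Total variation distance and characteristic functions\<close>

lemma d_TV_bdd_above:
  assumes "prob_space \<mu>" "prob_space \<nu>"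
  shows "bdd_above ((\<lambda>A. \<bar>measure \<mu> A - measure \<nu> A\<bar>) ` sets borel)"
proof (rule bdd_aboveI2)
  fix A
  have "measure \<mu> A \<le> 1" "measure \<nu> A \<le> 1" using assms by (auto simp: prob_space.prob_le_1)
  then show "\<bar>measure \<mu> A - measure \<nu> A\<bar> \<le> 1"
    using measure_nonneg[of \<mu> A] measure_nonneg[of \<nu> A] by linarith
qed

lemma abs_diff_le_d_TV:
  assumes "prob_space \<mu>" "prob_space \<nu>" "A \<in> sets borel"
  shows "\<bar>measure \<mu> A - measure \<nu> A\<bar> \<le> d_TV \<mu> \<nu>"
  unfolding d_TV_def by (rule cSUP_upper[OF assms(3) d_TV_bdd_above[OF assms(1,2)]])

lemma d_TV_leI:
  assumes "\<And>A. A \<in> sets borel \<Longrightarrow> \<bar>measure \<mu> A - measure \<nu> A\<bar> \<le> B"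
  shows "d_TV \<mu> \<nu> \<le> B"
  unfolding d_TV_def using assms by (intro cSUP_least) auto

lemma d_TV_nonneg:
  assumes "prob_space \<mu>" "prob_space \<nu>"
  shows "0 \<le> d_TV \<mu> \<nu>"
  using abs_diff_le_d_TV[OF assms, of "{}"] by simp

lemma d_TV_le_1:
  assumes "prob_space \<mu>" "prob_space \<nu>"
  shows "d_TV \<mu> \<nu> \<le> 1"
proof (rule d_TV_leI)
  fix A
  have "measure \<mu> A \<le> 1" "measure \<nu> A \<le> 1" using assms by (auto simp: prob_space.prob_le_1)
  then show "\<bar>measure \<mu> A - measure \<nu> A\<bar> \<le> 1"
    using measure_nonneg[of \<mu> A] measure_nonneg[of \<nu> A] by linarith
qed

lemma d_TV_commute: "d_TV \<mu> \<nu> = d_TV \<nu> \<mu>"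
  unfolding d_TV_def by (simp add: abs_minus_commute)

lemma d_TV_triangle:
  assumes "prob_space \<mu>" "prob_space \<nu>" "prob_space \<rho>"
  shows "d_TV \<mu> \<rho> \<le> d_TV \<mu> \<nu> + d_TV \<nu> \<rho>"
proof (rule d_TV_leI)
  fix A :: "(real^'a) set" assume A: "A \<in> sets borel"
  show "\<bar>measure \<mu> A - measure \<rho> A\<bar> \<le> d_TV \<mu> \<nu> + d_TV \<nu> \<rho>"
    using abs_diff_le_d_TV[OF assms(1,2) A] abs_diff_le_d_TV[OF assms(2,3) A] by linarith
qed

lemma d_TV_distr_le:
  fixes f :: "real^'d \<Rightarrow> real^'d"
  assumes \<mu>: "prob_space \<mu>" "sets \<mu> = sets borel" and \<nu>: "prob_space \<nu>" "sets \<nu> = sets borel"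
    and f: "f \<in> borel_measurable borel"
  shows "d_TV (distr \<mu> borel f) (distr \<nu> borel f) \<le> d_TV \<mu> \<nu>"
proof (rule d_TV_leI)
  fix A :: "(real^'d) set" assume A: "A \<in> sets borel"
  have sp: "space \<mu> = UNIV" "space \<nu> = UNIV" using \<mu>(2) \<nu>(2) by (auto dest: sets_eq_imp_space_eq)
  have f\<mu>: "f \<in> measurable \<mu> borel" and f\<nu>: "f \<in> measurable \<nu> borel"
    using f measurable_cong_sets[OF \<mu>(2) refl] measurable_cong_sets[OF \<nu>(2) refl] by auto
  have "f -` A \<in> sets borel" using measurable_sets[OF f A] by simp
  then show "\<bar>measure (distr \<mu> borel f) A - measure (distr \<nu> borel f) A\<bar> \<le> d_TV \<mu> \<nu>"
    using abs_diff_le_d_TV[OF \<mu>(1) \<nu>(1), of "f -` A"] by (simp add: measure_distr[OF f\<mu> A] measure_distr[OF f\<nu> A] sp)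
qed

text \<open>A Borel left inverse undoes \<open>f\<close>, so the contraction property can be used in
  both directions. It is applied to translations and to the affine map that removes the noise
  scale.\<close>

lemma d_TV_distr_eq:
  fixes f g :: "real^'d \<Rightarrow> real^'d"
  assumes \<mu>: "prob_space \<mu>" "sets \<mu> = sets borel" and \<nu>: "prob_space \<nu>" "sets \<nu> = sets borel"
    and f: "f \<in> borel_measurable borel" and g: "g \<in> borel_measurable borel" and gf: "\<And>x. g (f x) = x"
  shows "d_TV (distr \<mu> borel f) (distr \<nu> borel f) = d_TV \<mu> \<nu>"
proof (rule antisym[OF d_TV_distr_le[OF \<mu> \<nu> f]])
  have f\<mu>: "f \<in> measurable \<mu> borel" and f\<nu>: "f \<in> measurable \<nu> borel"
    using f measurable_cong_sets[OF \<mu>(2) refl] measurable_cong_sets[OF \<nu>(2) refl] by auto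
  have "d_TV (distr (distr \<mu> borel f) borel g) (distr (distr \<nu> borel f) borel g) \<le> d_TV (distr \<mu> borel f) (distr \<nu> borel f)"
    by (intro d_TV_distr_le prob_space.prob_space_distr \<mu> \<nu> f\<mu> f\<nu> g) auto
  moreover have "distr (distr \<mu> borel f) borel g = \<mu>"
    using gf by (subst distr_distr[OF g f\<mu>]) (simp add: comp_def distr_id2 \<mu>)
  moreover have "distr (distr \<nu> borel f) borel g = \<nu>"
    using gf by (subst distr_distr[OF g f\<nu>]) (simp add: comp_def distr_id2 \<nu>)
  ultimately show "d_TV \<mu> \<nu> \<le> d_TV (distr \<mu> borel f) (distr \<nu> borel f)" by simp
qed

section \<open>From characteristic functions to total variation\<close>

text \<open>The indicator of an open set is the pointwise limit of the continuous truncated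
  distances \<open>g n\<close> to its complement. They lie below the indicator of the ball, so their
  L1 norms are at most its volume.\<close>

lemma measure_open_diff_le_char_fun:
  fixes \<mu> \<nu> :: "(real^'d) measure"
  assumes \<mu>: "prob_space \<mu>" "sets \<mu> = sets borel" and \<nu>: "prob_space \<nu>" "sets \<nu> = sets borel"
    and int: "integrable lborel (\<lambda>z. char_fun \<mu> z - char_fun \<nu> z)"
    and U: "open U" "U \<subseteq> ball 0 R"
  shows "\<bar>measure \<mu> U - measure \<nu> U\<bar>
    \<le> measure lborel (ball 0 R :: (real^'d) set) * (LINT z|lborel. norm (char_fun \<mu> z - char_fun \<nu> z)) / (2 * pi) ^ CARD('d)"
proof -
  \<comment> \<open>The distance to the empty set is 0 by convention, which would make every
    \<open>g n\<close> vanish; boundedness of \<open>U\<close> excludes that case.\<close>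
  have "- U \<noteq> {}"
  proof
    assume "- U = {}"
    then have "(UNIV::(real^'d) set) \<subseteq> ball 0 R" using U by blast
    then have "bounded (UNIV::(real^'d) set)" using bounded_ball bounded_subset by blast
    then show False using not_bounded_UNIV by blast
  qed
  define g where "g n x = min 1 (real n * infdist x (- U))" for n x
  have cont: "continuous_on UNIV (g n)" for n
    unfolding g_def by (intro continuous_intros)
  have [measurable]: "g n \<in> borel_measurable borel" for n by (rule borel_measurable_continuous_onI[OF cont])
  have g01: "0 \<le> g n x" "g n x \<le> 1" for n x by (auto simp: g_def infdist_nonneg)
  have g_le: "g n x \<le> indicator (ball 0 R) x" for n x
  proof (cases "x \<in> U")
    case True
    then show ?thesis using U(2) g01(2)[of n x] by (auto simp: indicator_def)
  next
    case False
    then show ?thesis by (simp add: g_def)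
  qed
  have lim: "(\<lambda>n. g n x) \<longlonglongrightarrow> indicator U x" for x
  proof (cases "x \<in> U")
    case True
    then have pos: "infdist x (- U) > 0"
      using U(1) \<open>- U \<noteq> {}\<close> by (intro infdist_pos_not_in_closed) (simp_all add: closed_def)
    then obtain N :: nat where N: "1 < real N * infdist x (- U)" using reals_Archimedean3[OF pos] by metis
    have "\<forall>\<^sub>F n in sequentially. g n x = 1"
      using eventually_ge_at_top[of N]
    proof eventually_elim
      case (elim n)
      then have "real N * infdist x (- U) \<le> real n * infdist x (- U)" using pos by (intro mult_right_mono) auto
      then show ?case using N by (auto simp: g_def)
    qed
    then show ?thesis using True by (simp add: tendsto_eventually)
  next
    case False
    then have "g n x = 0" for n by (simp add: g_def)
    then show ?thesis using False by simp
  qed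
  have lim_int: "(\<lambda>n. LINT x|\<rho>. g n x) \<longlonglongrightarrow> measure \<rho> U" if \<rho>: "prob_space \<rho>" "sets \<rho> = sets borel" for \<rho>
  proof -
    interpret prob_space \<rho> by fact
    note [measurable_cong] = \<rho>(2)
    have [measurable]: "U \<in> sets borel" using U by simp
    have "(\<lambda>n. LINT x|\<rho>. g n x) \<longlonglongrightarrow> (LINT x|\<rho>. indicator U x)"
      by (rule integral_dominated_convergence[where w="\<lambda>_. 1"]) (use lim g01 in auto)
    then show ?thesis using sets_eq_imp_space_eq[OF \<rho>(2)] by simp
  qed
  have fin: "integrable lborel (indicator (ball 0 R) :: real^'d \<Rightarrow> real)"
    using emeasure_bounded_finite[OF bounded_ball, of "0::real^'d" R] by (intro integrable_real_indicator) auto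
  have int_g: "integrable lborel (g n)" for n
    by (rule Bochner_Integration.integrable_bound[OF fin]) (use g_le g01 in auto)
  show ?thesis
  proof (rule LIMSEQ_le_const2)
    show "(\<lambda>n. \<bar>(LINT x|\<mu>. g n x) - (LINT x|\<nu>. g n x)\<bar>) \<longlonglongrightarrow> \<bar>measure \<mu> U - measure \<nu> U\<bar>"
      by (intro tendsto_intros lim_int \<mu> \<nu>)
    show "\<exists>N. \<forall>n\<ge>N. \<bar>(LINT x|\<mu>. g n x) - (LINT x|\<nu>. g n x)\<bar>
      \<le> measure lborel (ball 0 R :: (real^'d) set) * (LINT z|lborel. norm (char_fun \<mu> z - char_fun \<nu> z)) / (2 * pi) ^ CARD('d)"
    proof (intro exI allI impI)
      fix n
      have "\<bar>(LINT x|\<mu>. g n x) - (LINT x|\<nu>. g n x)\<bar> \<le>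
         (LINT u|lborel. \<bar>g n u\<bar>) * (LINT z|lborel. norm (char_fun \<mu> z - char_fun \<nu> z)) / (2 * pi) ^ CARD('d)"
        by (rule char_fun_integral_bound[OF \<mu> \<nu> int cont, where B=1]) (use g01 int_g in auto)
      also have "(LINT u|lborel. \<bar>g n u\<bar>) \<le> (LINT u|lborel. indicator (ball (0::real^'d) R) u)"
        by (rule Bochner_Integration.integral_mono') (use fin g01 g_le in auto)
      also have "\<dots> = measure lborel (ball 0 R :: (real^'d) set)" by simp
      finally show "\<bar>(LINT x|\<mu>. g n x) - (LINT x|\<nu>. g n x)\<bar>
        \<le> measure lborel (ball 0 R :: (real^'d) set) * (LINT z|lborel. norm (char_fun \<mu> z - char_fun \<nu> z)) / (2 * pi) ^ CARD('d)"
        by (simp add: divide_right_mono mult_right_mono)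
    qed
  qed
qed

lemma measure_outer_open:
  fixes \<mu> :: "(real^'d) measure"
  assumes \<mu>: "prob_space \<mu>" "sets \<mu> = sets borel" and A: "A \<in> sets borel" and e: "e > 0"
  obtains U where "open U" "A \<subseteq> U" "measure \<mu> U < measure \<mu> A + e"
proof -
  interpret prob_space \<mu> by fact
  have "emeasure \<mu> A = (INF U\<in>{U. A \<subseteq> U \<and> open U}. emeasure \<mu> U)"
    using outer_regular[OF \<mu>(2) _ A] by (simp add: emeasure_space_1)
  moreover have "emeasure \<mu> A < ennreal (measure \<mu> A + e)"
    using e by (simp add: emeasure_eq_measure ennreal_less_iff)
  ultimately obtain U where "A \<subseteq> U" "open U" "emeasure \<mu> U < ennreal (measure \<mu> A + e)"
    by (auto simp: INF_less_iff)
  then show thesis by (intro that[of U]) (auto simp: emeasure_eq_measure ennreal_less_iff)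
qed

text \<open>The open superset is chosen tight for \<open>\<nu>\<close> alone, which suffices for a
  one-sided inequality: monotonicity takes care of \<open>\<mu>\<close>. Intersecting with the ball
  keeps the superset within reach of the estimate for open sets. The reverse inequality follows by
  exchanging the laws.\<close>

lemma measure_le_char_fun_ball:
  fixes \<mu> \<nu> :: "(real^'d) measure"
  assumes \<mu>: "prob_space \<mu>" "sets \<mu> = sets borel" and \<nu>: "prob_space \<nu>" "sets \<nu> = sets borel"
    and int: "integrable lborel (\<lambda>z. char_fun \<mu> z - char_fun \<nu> z)"
    and A: "A \<in> sets borel" "A \<subseteq> ball 0 R"
  defines "D \<equiv> measure lborel (ball 0 R :: (real^'d) set) * (LINT z|lborel. norm (char_fun \<mu> z - char_fun \<nu> z)) / (2 * pi) ^ CARD('d)"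
  shows "measure \<mu> A \<le> measure \<nu> A + D"
proof (rule field_le_epsilon)
  fix e :: real assume "e > 0"
  then obtain U where U: "open U" "A \<subseteq> U" "measure \<nu> U < measure \<nu> A + e"
    using measure_outer_open[OF \<nu> A(1)] by metis
  interpret M: prob_space \<mu> by fact
  interpret N: prob_space \<nu> by fact
  have "measure \<mu> A \<le> measure \<mu> (U \<inter> ball 0 R)"
    using A U \<mu>(2) by (intro M.finite_measure_mono) auto
  also have "\<dots> \<le> measure \<nu> (U \<inter> ball 0 R) + D"
    using measure_open_diff_le_char_fun[OF \<mu> \<nu> int open_Int[OF U(1) open_ball] Int_lower2, of R] unfolding D_def[symmetric] by linarith
  also have "measure \<nu> (U \<inter> ball 0 R) \<le> measure \<nu> U"
    using U \<nu>(2) by (intro N.finite_measure_mono) auto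
  finally show "measure \<mu> A \<le> measure \<nu> A + D + e" using U(3) by simp
qed

lemma large_ball_measure:
  fixes \<mu> :: "(real^'d) measure"
  assumes \<mu>: "prob_space \<mu>" "sets \<mu> = sets borel" and e: "e > 0"
  obtains R where "R > 0" "measure \<mu> (ball 0 R) > 1 - e"
proof -
  interpret prob_space \<mu> by fact
  have "range (\<lambda>n. ball (0::real^'d) (real n)) \<subseteq> sets \<mu>" "incseq (\<lambda>n. ball (0::real^'d) (real n))"
    by (auto simp: \<mu>(2) incseq_def)
  then have "(\<lambda>n. measure \<mu> (ball 0 (real n))) \<longlonglongrightarrow> measure \<mu> (\<Union>n. ball 0 (real n))"
    by (rule finite_Lim_measure_incseq)
  moreover have "space \<mu> = UNIV" using sets_eq_imp_space_eq[OF \<mu>(2)] by simp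
  moreover have "(\<Union>n. ball (0::real^'d) (real n)) = UNIV"
    by (auto intro: reals_Archimedean2)
  ultimately have "(\<lambda>n. measure \<mu> (ball 0 (real n))) \<longlonglongrightarrow> 1" using prob_space by simp
  then have "\<forall>\<^sub>F n in sequentially. measure \<mu> (ball 0 (real n)) > 1 - e \<and> n > 0"
    using e by (intro eventually_conj order_tendstoD(1)[of _ 1] eventually_gt_at_top) auto
  then obtain n where "measure \<mu> (ball 0 (real n)) > 1 - e" "n > 0"
    by (auto simp: eventually_sequentially)
  then show thesis by (intro that[of "real n"]) auto
qed

text \<open>Only the tail of \<open>\<nu>\<close> enters: the mass of \<open>\<mu>\<close> outside the ball is controlled through its mass inside.\<close>

lemma d_TV_char_fun_bound:
  fixes \<mu> \<nu> :: "(real^'d) measure"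
  assumes \<mu>: "prob_space \<mu>" "sets \<mu> = sets borel" and \<nu>: "prob_space \<nu>" "sets \<nu> = sets borel"
    and int: "integrable lborel (\<lambda>z. char_fun \<mu> z - char_fun \<nu> z)"
  defines "D R \<equiv> measure lborel (ball 0 R :: (real^'d) set) * (LINT z|lborel. norm (char_fun \<mu> z - char_fun \<nu> z)) / (2 * pi) ^ CARD('d)"
  shows "d_TV \<mu> \<nu> \<le> 2 * D R + 2 * (1 - measure \<nu> (ball 0 R))"
proof (rule d_TV_leI)
  fix A :: "(real^'d) set" assume A: "A \<in> sets borel"
  interpret M: prob_space \<mu> by fact
  interpret N: prob_space \<nu> by fact
  let ?B = "ball (0::real^'d) R"
  have int': "integrable lborel (\<lambda>z. char_fun \<nu> z - char_fun \<mu> z)"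
    using integrable_minus[OF int] by simp
  have D: "\<bar>measure \<mu> C - measure \<nu> C\<bar> \<le> D R" if "C \<in> sets borel" "C \<subseteq> ?B" for C
    using measure_le_char_fun_ball[OF \<mu> \<nu> int that] measure_le_char_fun_ball[OF \<nu> \<mu> int' that]
    unfolding D_def norm_minus_commute[of "char_fun \<nu> _"] by linarith
  have split: "measure \<rho> A \<le> measure \<rho> (A \<inter> ?B) + (1 - measure \<rho> ?B)" "measure \<rho> (A \<inter> ?B) \<le> measure \<rho> A"
    if \<rho>: "prob_space \<rho>" "sets \<rho> = sets borel" for \<rho>
  proof -
    interpret prob_space \<rho> by fact
    have "measure \<rho> (space \<rho> - ?B) = 1 - measure \<rho> ?B" using \<rho>(2) by (intro prob_compl) simp
    moreover have "space \<rho> = UNIV" using sets_eq_imp_space_eq[OF \<rho>(2)] by simp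
    ultimately have compl: "measure \<rho> (- ?B) = 1 - measure \<rho> ?B" by (simp add: Compl_eq_Diff_UNIV)
    have "measure \<rho> A \<le> measure \<rho> ((A \<inter> ?B) \<union> - ?B)"
      by (rule finite_measure_mono) (use A in \<open>simp_all add: \<rho>(2)\<close>, blast)
    also have "\<dots> \<le> measure \<rho> (A \<inter> ?B) + measure \<rho> (- ?B)"
      using A by (intro measure_subadditive) (simp_all add: \<rho>(2) emeasure_eq_measure)
    finally show "measure \<rho> A \<le> measure \<rho> (A \<inter> ?B) + (1 - measure \<rho> ?B)" unfolding compl .
    show "measure \<rho> (A \<inter> ?B) \<le> measure \<rho> A"
      by (rule finite_measure_mono) (use A in \<open>simp_all add: \<rho>(2)\<close>)
  qed
  show "\<bar>measure \<mu> A - measure \<nu> A\<bar> \<le> 2 * D R + 2 * (1 - measure \<nu> ?B)"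
  proof -
    have "\<bar>measure \<mu> (A \<inter> ?B) - measure \<nu> (A \<inter> ?B)\<bar> \<le> D R" "\<bar>measure \<mu> ?B - measure \<nu> ?B\<bar> \<le> D R"
      using A by (simp_all add: D)
    \<comment> \<open>The mass of \<open>\<mu>\<close> outside the ball is at most that of
      \<open>\<nu>\<close> plus \<open>D R\<close>; together with the error \<open>D R\<close> on
      the part of \<open>A\<close> inside this accounts for 2 \<open>D R\<close>.\<close>
    then show ?thesis using split[OF \<mu>] split[OF \<nu>] N.prob_le_1[of ?B] unfolding abs_le_iff by argo
  qed
qed

text \<open>The radius is fixed from the tail of \<open>\<nu>\<close> before the index moves; the
  volume of the ball is then a constant, and the L1 convergence can absorb it.\<close>

lemma d_TV_tendsto_0_char_fun:
  fixes \<mu> :: "'i \<Rightarrow> (real^'d) measure"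
  assumes pr: "\<forall>\<^sub>F i in F. prob_space (\<mu> i)" and \<mu>: "\<And>i. sets (\<mu> i) = sets borel"
    and \<nu>: "prob_space \<nu>" "sets \<nu> = sets borel"
    and int: "\<forall>\<^sub>F i in F. integrable lborel (\<lambda>z. char_fun (\<mu> i) z - char_fun \<nu> z)"
    and lim: "((\<lambda>i. LINT z|lborel. norm (char_fun (\<mu> i) z - char_fun \<nu> z)) \<longlongrightarrow> 0) F"
  shows "((\<lambda>i. d_TV (\<mu> i) \<nu>) \<longlongrightarrow> 0) F"
proof (rule tendstoI)
  fix e :: real assume e: "e > 0"
  obtain R where R: "measure \<nu> (ball 0 R) > 1 - e / 4"
    by (rule large_ball_measure[OF \<nu>, of "e / 4"]) (use e in auto)
  define D where "D i = measure lborel (ball 0 R :: (real^'d) set) * (LINT z|lborel. norm (char_fun (\<mu> i) z - char_fun \<nu> z)) / (2 * pi) ^ CARD('d)" for i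
  have "(D \<longlongrightarrow> measure lborel (ball 0 R :: (real^'d) set) * 0 / (2 * pi) ^ CARD('d)) F"
    unfolding D_def by (intro tendsto_intros lim) auto
  then have "\<forall>\<^sub>F i in F. D i < e / 4" using e by (intro order_tendstoD(2)[where y=0]) auto
  with pr int show "\<forall>\<^sub>F i in F. dist (d_TV (\<mu> i) \<nu>) 0 < e"
  proof eventually_elim
    case (elim i)
    have "d_TV (\<mu> i) \<nu> \<le> 2 * D i + 2 * (1 - measure \<nu> (ball 0 R))"
      unfolding D_def by (rule d_TV_char_fun_bound[OF elim(1) \<mu> \<nu> elim(2)])
    then show ?case
      using elim(3) R d_TV_nonneg[OF elim(1) \<nu>(1)] by (simp add: dist_real_def)
  qed
qed

section \<open>Limit laws and condition (H)\<close>

text \<open>\<open>limit_law\<close> tests with real functions only, so the characteristic function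
  is split into its cosine and sine parts.\<close>

lemma char_fun_eq_Complex:
  assumes "prob_space \<mu>" "sets \<mu> = sets borel"
  shows "char_fun \<mu> z = Complex (LINT x|\<mu>. cos (z \<bullet> x)) (LINT x|\<mu>. sin (z \<bullet> x))"
proof -
  interpret prob_space \<mu> by fact
  note [measurable_cong] = assms(2)
  have [simp]: "integrable \<mu> (\<lambda>x. iexp (z \<bullet> x))"
    by (rule integrable_const_bound[where B=1]) auto
  show ?thesis
    by (rule complex_eqI) (simp_all add: char_fun_def integral_Re[symmetric] integral_Im[symmetric] Re_exp Im_exp del: integral_Re integral_Im)
qed

lemma limit_law_tendsto:
  fixes f :: "real^'d \<Rightarrow> real"
  assumes "limit_law M Y \<mu>" "continuous_on UNIV f" "\<And>x. \<bar>f x\<bar> \<le> B"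
  shows "((\<lambda>t. LINT \<omega>|M. f (Y t \<omega>)) \<longlongrightarrow> (LINT x|\<mu>. f x)) at_top"
proof -
  have "bounded (range f)" using assms(3) by (auto simp: bounded_iff)
  then show ?thesis using assms(1,2) unfolding limit_law_def by auto
qed

lemma limit_law_prob: "limit_law M Y \<mu> \<Longrightarrow> prob_space \<mu>"
  and limit_law_sets: "limit_law M Y \<mu> \<Longrightarrow> sets \<mu> = sets borel"
  by (auto simp: limit_law_def)

lemma limit_law_char_fun:
  fixes Y :: "real \<Rightarrow> 'w \<Rightarrow> real^'d"
  assumes M: "prob_space M" and Y: "\<And>t. t > 0 \<Longrightarrow> Y t \<in> borel_measurable M" and lim: "limit_law M Y \<mu>"
  shows "((\<lambda>t. char_fun (distr M borel (Y t)) z) \<longlongrightarrow> char_fun \<mu> z) at_top"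
proof -
  have "((\<lambda>t. Complex (LINT \<omega>|M. cos (z \<bullet> Y t \<omega>)) (LINT \<omega>|M. sin (z \<bullet> Y t \<omega>)))
      \<longlongrightarrow> Complex (LINT x|\<mu>. cos (z \<bullet> x)) (LINT x|\<mu>. sin (z \<bullet> x))) at_top"
    by (intro tendsto_Complex limit_law_tendsto[OF lim, where B=1] continuous_intros) auto
  then have "((\<lambda>t. Complex (LINT \<omega>|M. cos (z \<bullet> Y t \<omega>)) (LINT \<omega>|M. sin (z \<bullet> Y t \<omega>))) \<longlongrightarrow> char_fun \<mu> z) at_top"
    by (simp add: char_fun_eq_Complex limit_law_prob[OF lim] limit_law_sets[OF lim])
  moreover have "\<forall>\<^sub>F t in at_top. Complex (LINT \<omega>|M. cos (z \<bullet> Y t \<omega>)) (LINT \<omega>|M. sin (z \<bullet> Y t \<omega>)) = char_fun (distr M borel (Y t)) z"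
    using eventually_gt_at_top[of 0]
  proof eventually_elim
    case (elim t)
    note [measurable] = Y[OF elim]
    show ?case
      by (subst char_fun_eq_Complex) (auto simp: integral_distr intro!: prob_space.prob_space_distr[OF M])
  qed
  ultimately show ?thesis by (rule Lim_transform_eventually)
qed

lemma limit_law_continuous_image:
  fixes f :: "real^'d \<Rightarrow> real^'d"
  assumes lim: "limit_law M Y \<mu>" and f: "continuous_on UNIV f"
  shows "limit_law M (\<lambda>t \<omega>. f (Y t \<omega>)) (distr \<mu> borel f)"
  unfolding limit_law_def
proof (intro conjI allI impI)
  note [measurable_cong] = limit_law_sets[OF lim]
  have [measurable]: "f \<in> borel_measurable borel" using f by (rule borel_measurable_continuous_onI)
  show "prob_space (distr \<mu> borel f)" by (intro prob_space.prob_space_distr limit_law_prob[OF lim]) simp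
  fix g :: "real^'d \<Rightarrow> real" assume g: "continuous_on UNIV g" "bounded (range g)"
  have [measurable]: "g \<in> borel_measurable borel" using g(1) by (rule borel_measurable_continuous_onI)
  have "continuous_on UNIV (\<lambda>x. g (f x))" using continuous_on_compose2[OF g(1) f] by auto
  moreover have "bounded (range (\<lambda>x. g (f x)))" using g(2) by (rule bounded_subset) auto
  ultimately show "((\<lambda>t. LINT \<omega>|M. g (f (Y t \<omega>))) \<longlongrightarrow> (LINT x|distr \<mu> borel f. g x)) at_top"
    using lim[unfolded limit_law_def, THEN conjunct2, THEN conjunct2, rule_format, of "\<lambda>x. g (f x)"]
    by (simp add: integral_distr)
qed simp

text \<open>A single radius serves both the laws at late times and their limit: the bound for the
  limit follows from the pointwise convergence of characteristic functions by Fatou's lemma.\<close>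

lemma condition_H_tail:
  fixes \<mu> :: "real \<Rightarrow> (real^'d) measure"
  assumes H: "condition_H \<mu>" and pr: "\<And>t. t > 0 \<Longrightarrow> prob_space (\<mu> t)" "\<And>t. sets (\<mu> t) = sets borel"
    and \<nu>: "prob_space \<nu>" "sets \<nu> = sets borel"
    and conv: "\<And>z. ((\<lambda>t. char_fun (\<mu> t) z) \<longlongrightarrow> char_fun \<nu> z) at_top" and e: "e > (0::real)"
  obtains R t0 where "R > 0" "t0 > 0"
    "\<And>s. s > t0 \<Longrightarrow> (\<integral>\<^sup>+ z. ennreal (norm (char_fun (\<mu> s) z)) * indicator {z. norm z > R} z \<partial>lborel) \<le> ennreal e"
    "(\<integral>\<^sup>+ z. ennreal (norm (char_fun \<nu> z)) * indicator {z. norm z > R} z \<partial>lborel) \<le> ennreal e"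
proof -
  let ?T = "\<lambda>\<rho> R. \<integral>\<^sup>+ z. ennreal (norm (char_fun \<rho> z)) * indicator {z. norm z > R} z \<partial>lborel"
  from H obtain t0 :: "real \<Rightarrow> real" where t0: "\<And>R. R > 0 \<Longrightarrow> t0 R > 0"
    and T: "((\<lambda>R. SUP s\<in>{t0 R<..}. ?T (\<mu> s) R) \<longlongrightarrow> 0) at_top"
    unfolding condition_H_def by auto
  have "\<forall>\<^sub>F R in at_top. R > 0 \<and> (SUP s\<in>{t0 R<..}. ?T (\<mu> s) R) < ennreal e"
    using e by (intro eventually_conj eventually_gt_at_top order_tendstoD(2)[OF T]) auto
  then obtain R where R: "R > 0" "(SUP s\<in>{t0 R<..}. ?T (\<mu> s) R) < ennreal e"
    by (auto simp: eventually_at_top_linorder)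
  have tail: "?T (\<mu> s) R \<le> ennreal e" if "s > t0 R" for s
    using R(2) that by (intro order_trans[OF SUP_upper less_imp_le[OF R(2)]]) auto
  \<comment> \<open>Fatou's lemma is stated for sequences, so a sequence of times beyond
    \<open>t0 R\<close> is selected.\<close>
  define s where "s n = t0 R + 1 + real n" for n
  have s: "s n > t0 R" "s n > 0" for n using t0[OF R(1)] by (auto simp: s_def)
  have s_lim: "filterlim s at_top sequentially"
    unfolding s_def by (intro filterlim_tendsto_add_at_top[OF tendsto_const] filterlim_real_sequentially)
  have [measurable]: "char_fun (\<mu> (s n)) \<in> borel_measurable borel" "char_fun \<nu> \<in> borel_measurable borel" for n
    using s pr \<nu> by (auto intro: char_fun_measurable)
  have "?T \<nu> R = (\<integral>\<^sup>+ z. liminf (\<lambda>n. ennreal (norm (char_fun (\<mu> (s n)) z)) * indicator {z. norm z > R} z) \<partial>lborel)"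
  proof (intro nn_integral_cong)
    fix z :: "real^'d"
    have "(\<lambda>n. char_fun (\<mu> (s n)) z) \<longlonglongrightarrow> char_fun \<nu> z"
      using filterlim_compose[OF conv s_lim] .
    then have "(\<lambda>n. ennreal (norm (char_fun (\<mu> (s n)) z)) * indicator {z. norm z > R} z) \<longlonglongrightarrow> ennreal (norm (char_fun \<nu> z)) * indicator {z. norm z > R} z"
      by (cases "norm z > R") (auto intro!: tendsto_ennrealI tendsto_norm)
    then show "ennreal (norm (char_fun \<nu> z)) * indicator {z. norm z > R} z = liminf (\<lambda>n. ennreal (norm (char_fun (\<mu> (s n)) z)) * indicator {z. norm z > R} z)"
      by (intro lim_imp_Liminf[symmetric]) auto
  qed
  also have "\<dots> \<le> liminf (\<lambda>n. ?T (\<mu> (s n)) R)"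
    by (rule nn_integral_liminf) measurable
  also have "\<dots> \<le> liminf (\<lambda>n. ennreal e)"
    by (rule Liminf_mono) (use tail s in auto)
  also have "\<dots> = ennreal e" by (simp add: Liminf_const)
  finally show thesis using that[OF R(1) t0[OF R(1)] tail] by simp
qed

text \<open>Inside a large ball the modulus is at most 1 and the volume is finite; outside, any
  finite tail bound will do, here 1.\<close>

lemma condition_H_integrable_limit:
  fixes \<mu> :: "real \<Rightarrow> (real^'d) measure"
  assumes H: "condition_H \<mu>" and pr: "\<And>t. t > 0 \<Longrightarrow> prob_space (\<mu> t)" "\<And>t. sets (\<mu> t) = sets borel"
    and \<nu>: "prob_space \<nu>" "sets \<nu> = sets borel"
    and conv: "\<And>z. ((\<lambda>t. char_fun (\<mu> t) z) \<longlongrightarrow> char_fun \<nu> z) at_top"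
  shows "integrable lborel (char_fun \<nu>)"
proof -
  obtain R where R: "R > 0"
    "(\<integral>\<^sup>+ z. ennreal (norm (char_fun \<nu> z)) * indicator {z. norm z > R} z \<partial>lborel) \<le> ennreal 1"
    using condition_H_tail[OF H pr \<nu> conv, of 1] by auto
  have [measurable]: "char_fun \<nu> \<in> borel_measurable borel" using \<nu> by (auto intro: char_fun_measurable)
  have [measurable]: "cball (0::real^'d) R \<in> sets borel" by simp
  have "(\<integral>\<^sup>+ z. ennreal (norm (char_fun \<nu> z)) \<partial>lborel) \<le>
    (\<integral>\<^sup>+ z. indicator (cball 0 R) z + ennreal (norm (char_fun \<nu> z)) * indicator {z. norm z > R} z \<partial>lborel)"
    using norm_char_fun_le_1[OF \<nu>(1)] by (intro nn_integral_mono) (auto simp: indicator_def)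
  also have "\<dots> = emeasure lborel (cball 0 R :: (real^'d) set) +
    (\<integral>\<^sup>+ z. ennreal (norm (char_fun \<nu> z)) * indicator {z. norm z > R} z \<partial>lborel)"
    by (subst nn_integral_add) auto
  also have "\<dots> < \<infinity>"
    using R(2) emeasure_bounded_finite[OF bounded_cball, of "0::real^'d" R] by (auto intro: le_less_trans)
  finally show ?thesis by (intro integrableI_bounded) auto
qed

text \<open>The L1 distance is cut at radius \<open>R\<close>: dominated convergence treats the
  ball, where the integrand is at most 2, and the two tails are small for all late times. Three
  quarters of \<open>e\<close> are spent.\<close>

lemma condition_H_d_TV:
  fixes \<mu> :: "real \<Rightarrow> (real^'d) measure"
  assumes H: "condition_H \<mu>" and pr: "\<And>t. t > 0 \<Longrightarrow> prob_space (\<mu> t)" "\<And>t. sets (\<mu> t) = sets borel"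
    and \<nu>: "prob_space \<nu>" "sets \<nu> = sets borel"
    and conv: "\<And>z. ((\<lambda>t. char_fun (\<mu> t) z) \<longlongrightarrow> char_fun \<nu> z) at_top"
  shows "((\<lambda>t. d_TV (\<mu> t) \<nu>) \<longlongrightarrow> 0) at_top"
proof (rule d_TV_tendsto_0_char_fun[OF _ pr(2) \<nu>])
  show "\<forall>\<^sub>F t in at_top. prob_space (\<mu> t)"
    using eventually_gt_at_top[of 0] by eventually_elim (rule pr)
  have int\<nu>: "integrable lborel (char_fun \<nu>)" by (rule condition_H_integrable_limit[OF H pr \<nu> conv])
  have int: "integrable lborel (\<lambda>z. char_fun (\<mu> t) z - char_fun \<nu> z)" if "t > 0" for t
    using H that int\<nu> by (auto simp: condition_H_def)
  show "\<forall>\<^sub>F t in at_top. integrable lborel (\<lambda>z. char_fun (\<mu> t) z - char_fun \<nu> z)"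
    using eventually_gt_at_top[of 0] by eventually_elim (rule int)
  let ?D = "\<lambda>t. LINT z|lborel. norm (char_fun (\<mu> t) z - char_fun \<nu> z)"
  show "(?D \<longlongrightarrow> 0) at_top"
  proof (rule tendstoI)
    fix e :: real assume e: "e > 0"
    obtain R t0 where R: "R > 0" "t0 > 0"
      and tail: "\<And>s. s > t0 \<Longrightarrow> (\<integral>\<^sup>+ z. ennreal (norm (char_fun (\<mu> s) z)) * indicator {z. norm z > R} z \<partial>lborel) \<le> ennreal (e / 4)"
        "(\<integral>\<^sup>+ z. ennreal (norm (char_fun \<nu> z)) * indicator {z. norm z > R} z \<partial>lborel) \<le> ennreal (e / 4)"
      by (rule condition_H_tail[OF H pr \<nu> conv, of "e / 4"]) (use e in auto)
    \<comment> \<open>\<open>\<mu> t\<close> is assumed to be a probability law for positive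
      \<open>t\<close> only, whereas dominated convergence asks for measurability and a bound at
      every \<open>t\<close>; hence the value 0 elsewhere.\<close>
    define f where "f t z = (if t > 0 then norm (char_fun (\<mu> t) z - char_fun \<nu> z) * indicator (cball 0 R) z else 0)" for t z
    have meas [measurable]: "char_fun (\<mu> t) \<in> borel_measurable borel" if "t > 0" for t
      using that pr by (auto intro: char_fun_measurable)
    have [measurable]: "char_fun \<nu> \<in> borel_measurable borel" using \<nu> by (auto intro: char_fun_measurable)
    have [measurable]: "cball (0::real^'d) R \<in> sets borel" by simp
    have f_meas: "f t \<in> borel_measurable lborel" for t
      unfolding f_def by (cases "t > 0") simp_all
    have fin: "integrable lborel (\<lambda>z. 2 * indicator (cball (0::real^'d) R) z :: real)"
      using emeasure_bounded_finite[OF bounded_cball, of "0::real^'d" R]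
      by (intro integrable_mult_right integrable_real_indicator) auto
    have f_le: "\<bar>f t z\<bar> \<le> 2 * indicator (cball 0 R) z" for t z
      using norm_triangle_ineq4[of "char_fun (\<mu> t) z" "char_fun \<nu> z"] norm_char_fun_le_1[OF \<nu>(1), of z]
        norm_char_fun_le_1[OF pr(1), of t z]
      by (auto simp: f_def indicator_def)
    have f_nonneg: "0 \<le> f t z" for t z by (simp add: f_def)
    have "((\<lambda>t. LINT z|lborel. f t z) \<longlongrightarrow> (LINT z|(lborel :: (real^'d) measure). 0)) at_top"
    proof (rule integral_dominated_convergence_at_top[OF _ f_meas fin])
      show "AE z in lborel. ((\<lambda>t. f t z) \<longlongrightarrow> 0) at_top"
      proof (rule AE_I2)
        fix z
        have "((\<lambda>t. norm (char_fun (\<mu> t) z - char_fun \<nu> z) * indicator (cball 0 R) z) \<longlongrightarrow> norm (char_fun \<nu> z - char_fun \<nu> z) * indicator (cball 0 R) z) at_top"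
          by (intro tendsto_intros conv)
        then have "((\<lambda>t. norm (char_fun (\<mu> t) z - char_fun \<nu> z) * indicator (cball 0 R) z) \<longlongrightarrow> 0) at_top" by simp
        then show "((\<lambda>t. f t z) \<longlongrightarrow> 0) at_top"
          by (rule Lim_transform_eventually)
            (use eventually_gt_at_top[of 0] in \<open>eventually_elim, auto simp: f_def\<close>)
      qed
    qed (use f_le in auto)
    then have "\<forall>\<^sub>F t in at_top. (LINT z|lborel. f t z) < e / 4"
      using e by (intro order_tendstoD(2)) auto
    then show "\<forall>\<^sub>F t in at_top. dist (?D t) 0 < e"
      using eventually_gt_at_top[of t0]
    proof eventually_elim
      case (elim t)
      then have t: "t > 0" using R by simp
      note [measurable] = meas[OF t]
      have int_f: "integrable lborel (f t)"
        by (rule Bochner_Integration.integrable_bound[OF fin f_meas]) (use f_le in auto)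
      have "ennreal (?D t) = (\<integral>\<^sup>+ z. ennreal (norm (char_fun (\<mu> t) z - char_fun \<nu> z)) \<partial>lborel)"
        using int[OF t] by (intro nn_integral_eq_integral[symmetric]) auto
      also have "\<dots> \<le> (\<integral>\<^sup>+ z. ennreal (f t z) + (ennreal (norm (char_fun (\<mu> t) z)) * indicator {z. norm z > R} z
          + ennreal (norm (char_fun \<nu> z)) * indicator {z. norm z > R} z) \<partial>lborel)"
        using t norm_triangle_ineq4[of "char_fun (\<mu> t) _" "char_fun \<nu> _"]
        by (intro nn_integral_mono) (auto simp: f_def indicator_def ennreal_plus[symmetric] simp del: ennreal_plus intro!: ennreal_leI)
      also have "\<dots> = (\<integral>\<^sup>+ z. ennreal (f t z) \<partial>lborel) + ((\<integral>\<^sup>+ z. ennreal (norm (char_fun (\<mu> t) z)) * indicator {z. norm z > R} z \<partial>lborel)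
          + (\<integral>\<^sup>+ z. ennreal (norm (char_fun \<nu> z)) * indicator {z. norm z > R} z \<partial>lborel))"
        using f_meas[of t] by (simp add: nn_integral_add)
      also have "\<dots> \<le> ennreal (LINT z|lborel. f t z) + (ennreal (e / 4) + ennreal (e / 4))"
        using tail(1)[OF elim(2)] tail(2) nn_integral_eq_integral[OF int_f]
        by (intro add_mono) (auto simp: f_nonneg)
      also have "\<dots> = ennreal ((LINT z|lborel. f t z) + (e / 4 + e / 4))"
      proof -
        have "0 \<le> (LINT z|lborel. f t z)" by (intro integral_nonneg_AE) (auto simp: f_def)
        then show ?thesis using e by (simp add: ennreal_plus[symmetric] del: ennreal_plus)
      qed
      finally have "?D t \<le> (LINT z|lborel. f t z) + (e / 4 + e / 4)"
        using e by (subst (asm) ennreal_le_iff) (auto intro!: add_nonneg_nonneg integral_nonneg_AE simp: f_nonneg)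
      moreover have "?D t \<ge> 0" by (intro integral_nonneg_AE) auto
      ultimately show ?case using elim(1) e by (simp add: dist_real_def)
    qed
  qed
qed

section \<open>Deterministic shifts of laws\<close>

lemma distr_add_eq:
  fixes \<mu> :: "(real^'d) measure"
  assumes "sets \<mu> = sets borel"
  shows "distr (distr \<mu> borel ((+) u)) borel ((+) w) = distr \<mu> borel ((+) (w + u))"
proof -
  have "(+) (w + u) = (\<lambda>x. w + (u + x))" by (auto simp: add.assoc)
  then show ?thesis
    by (subst distr_distr) (auto simp: comp_def measurable_cong_sets[OF assms refl])
qed

lemma char_fun_translate:
  fixes \<mu> :: "(real^'d) measure"
  assumes "sets \<mu> = sets borel"
  shows "char_fun (distr \<mu> borel ((+) u)) z = iexp (z \<bullet> u) * char_fun \<mu> z"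
proof -
  note [measurable_cong] = assms
  show ?thesis
    unfolding char_fun_def
    by (subst integral_distr) (simp_all add: inner_add_right exp_add distrib_left)
qed

text \<open>A translation multiplies the characteristic function by a phase that tends to 1
  pointwise. The difference is dominated by twice the modulus, so it vanishes in L1.\<close>

lemma d_TV_translate_tendsto_0:
  fixes \<mu> :: "(real^'d) measure"
  assumes \<mu>: "prob_space \<mu>" "sets \<mu> = sets borel" and int: "integrable lborel (char_fun \<mu>)"
  shows "((\<lambda>u. d_TV (distr \<mu> borel ((+) u)) \<mu>) \<longlongrightarrow> 0) (at 0)"
proof (rule d_TV_tendsto_0_char_fun[OF _ _ \<mu>])
  note [measurable_cong] = \<mu>(2)
  show "\<forall>\<^sub>F u in at 0. prob_space (distr \<mu> borel ((+) u))"
    by (intro always_eventually allI prob_space.prob_space_distr \<mu>) simp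
  have [measurable]: "char_fun \<mu> \<in> borel_measurable borel" using \<mu> by (rule char_fun_measurable)
  have eq: "char_fun (distr \<mu> borel ((+) u)) z - char_fun \<mu> z = (iexp (z \<bullet> u) - 1) * char_fun \<mu> z" for u z
    by (simp add: char_fun_translate[OF \<mu>(2)] algebra_simps)
  have le: "norm ((iexp (z \<bullet> u) - 1) * char_fun \<mu> z) \<le> 2 * norm (char_fun \<mu> z)" for u z
    using norm_triangle_ineq4[of "iexp (z \<bullet> u)" 1] by (auto simp: norm_mult intro!: mult_right_mono)
  have "integrable lborel (\<lambda>z. (iexp (z \<bullet> u) - 1) * char_fun \<mu> z)" for u
    by (rule Bochner_Integration.integrable_bound[OF integrable_mult_right[OF integrable_norm[OF int], of 2]])
      (use le in \<open>auto simp: norm_mult\<close>)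
  then show "\<forall>\<^sub>F u in at 0. integrable lborel (\<lambda>z. char_fun (distr \<mu> borel ((+) u)) z - char_fun \<mu> z)"
    unfolding eq by simp
  show "((\<lambda>u. LINT z|lborel. norm (char_fun (distr \<mu> borel ((+) u)) z - char_fun \<mu> z)) \<longlongrightarrow> 0) (at 0)"
    unfolding eq tendsto_at_iff_sequentially comp_def
  proof (intro allI impI)
    fix u :: "nat \<Rightarrow> real^'d" assume "\<forall>i. u i \<in> UNIV - {0}" and u: "u \<longlonglongrightarrow> 0"
    have "(\<lambda>n. LINT z|lborel. norm ((iexp (z \<bullet> u n) - 1) * char_fun \<mu> z)) \<longlonglongrightarrow> (LINT z|(lborel :: (real^'d) measure). 0)"
    proof (rule integral_dominated_convergence[where w="\<lambda>z. 2 * norm (char_fun \<mu> z)"])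
      show "integrable lborel (\<lambda>z. 2 * norm (char_fun \<mu> z))" using int by simp
      show "AE z in lborel. (\<lambda>n. norm ((iexp (z \<bullet> u n) - 1) * char_fun \<mu> z)) \<longlonglongrightarrow> 0"
      proof (rule AE_I2)
        fix z
        have "(\<lambda>n. norm ((iexp (z \<bullet> u n) - 1) * char_fun \<mu> z)) \<longlonglongrightarrow> norm ((iexp (z \<bullet> 0) - 1) * char_fun \<mu> z)"
          by (intro tendsto_intros u)
        then show "(\<lambda>n. norm ((iexp (z \<bullet> u n) - 1) * char_fun \<mu> z)) \<longlonglongrightarrow> 0" by simp
      qed
    qed (use le in auto)
    then show "(\<lambda>n. LINT z|lborel. norm ((iexp (z \<bullet> u n) - 1) * char_fun \<mu> z)) \<longlonglongrightarrow> 0" by simp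
  qed
qed simp

text \<open>Total variation is invariant under a common translation, so by the triangle inequality
  the increment between \<open>w\<close> and \<open>w + h\<close> is at most the value at
  \<open>h\<close>. Continuity everywhere thus reduces to the behaviour at 0.\<close>

lemma d_TV_translate_continuous:
  fixes \<mu> :: "(real^'d) measure"
  assumes \<mu>: "prob_space \<mu>" "sets \<mu> = sets borel" and int: "integrable lborel (char_fun \<mu>)"
  shows "isCont (\<lambda>u. d_TV (distr \<mu> borel ((+) u)) \<mu>) w"
proof -
  note [measurable_cong] = \<mu>(2)
  have prob: "prob_space (distr \<mu> borel ((+) u))" for u
    by (intro prob_space.prob_space_distr \<mu>) simp
  have shift: "d_TV (distr \<mu> borel ((+) (w + h))) (distr \<mu> borel ((+) w)) = d_TV (distr \<mu> borel ((+) h)) \<mu>" for h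
    using d_TV_distr_eq[OF prob _ \<mu>, of h "(+) w" "\<lambda>x. x - w"] by (simp add: distr_add_eq[OF \<mu>(2)])
  have le: "\<bar>d_TV (distr \<mu> borel ((+) (w + h))) \<mu> - d_TV (distr \<mu> borel ((+) w)) \<mu>\<bar> \<le> d_TV (distr \<mu> borel ((+) h)) \<mu>" for h
    using d_TV_triangle[OF prob prob \<mu>(1), of "w + h" w] d_TV_triangle[OF prob prob \<mu>(1), of w "w + h"]
    by (simp add: shift d_TV_commute[of "distr \<mu> borel ((+) w)" "distr \<mu> borel ((+) (w + h))"])
  show ?thesis
    unfolding isCont_iff
    by (rule Lim_transform2[OF tendsto_const], rule Lim_null_comparison[OF always_eventually d_TV_translate_tendsto_0[OF \<mu> int]])
      (use le in \<open>simp add: abs_minus_commute\<close>)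
qed

text \<open>Once \<open>norm u\<close> is at least 2 R, the balls of radius R around 0 and
  \<open>- u\<close> are disjoint. The ball around 0 then carries nearly all of \<open>\<mu>\<close>
  and almost nothing of the translate.\<close>

lemma d_TV_translate_at_infinity:
  fixes \<mu> :: "(real^'d) measure"
  assumes \<mu>: "prob_space \<mu>" "sets \<mu> = sets borel"
  shows "((\<lambda>u. d_TV (distr \<mu> borel ((+) u)) \<mu>) \<longlongrightarrow> 1) at_infinity"
proof (rule tendstoI)
  fix e :: real assume e: "e > 0"
  interpret prob_space \<mu> by fact
  note [measurable_cong] = \<mu>(2)
  have sp: "space \<mu> = UNIV" using sets_eq_imp_space_eq[OF \<mu>(2)] by simp
  obtain R where R: "R > 0" "measure \<mu> (ball 0 R) > 1 - e / 2"
    by (rule large_ball_measure[OF \<mu>, of "e / 2"]) (use e in auto)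
  have "dist (d_TV (distr \<mu> borel ((+) u)) \<mu>) 1 < e" if u: "2 * R \<le> norm u" for u
  proof -
    have prob: "prob_space (distr \<mu> borel ((+) u))"
      by (intro prob_space.prob_space_distr \<mu>) simp
    have "(+) u -` ball 0 R \<inter> ball 0 R = {}"
    proof (rule ccontr)
      assume "(+) u -` ball 0 R \<inter> ball 0 R \<noteq> {}"
      then obtain x where "norm (u + x) < R" "norm x < R" by auto
      then show False using u norm_triangle_ineq4[of "u + x" x] by simp
    qed
    moreover have "(+) u -` ball 0 R = ball (- u) R"
      by (auto simp: dist_norm norm_minus_commute add.commute)
    ultimately have disj: "ball (- u) R \<inter> ball 0 R = {}" by simp
    have "measure \<mu> (ball (- u) R) + measure \<mu> (ball 0 R) = measure \<mu> (ball (- u) R \<union> ball 0 R)"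
      using disj by (intro finite_measure_Union[symmetric]) (auto simp: \<mu>(2))
    also have "\<dots> \<le> 1" by (rule prob_le_1)
    finally have "measure (distr \<mu> borel ((+) u)) (ball 0 R) \<le> e / 2"
      using R \<open>(+) u -` ball 0 R = ball (- u) R\<close> by (simp add: measure_distr sp)
    then have "d_TV (distr \<mu> borel ((+) u)) \<mu> > 1 - e"
      using abs_diff_le_d_TV[OF prob \<mu>(1), of "ball 0 R"] R by simp
    then show ?thesis using d_TV_le_1[OF prob \<mu>(1)] by (simp add: dist_real_def)
  qed
  then show "\<forall>\<^sub>F u in at_infinity. dist (d_TV (distr \<mu> borel ((+) u)) \<mu>) 1 < e"
    unfolding eventually_at_infinity by blast
qed

section \<open>Identification of deterministic shifts from limit laws\<close>

text \<open>At late times both \<open>Y t\<close> and \<open>Y t + b t\<close> lie in fixed balls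
  with substantial probability, so some sample point realises both and bounds \<open>b t\<close>.
  The tent-like \<open>f R\<close> replaces the indicator of the ball, since limit laws are tested
  on continuous functions; its support explains the summand 2.\<close>

lemma limit_law_shift_bounded:
  fixes Y :: "real \<Rightarrow> 'w \<Rightarrow> real^'d"
  assumes M: "prob_space M" and Y: "\<And>t. t > 0 \<Longrightarrow> Y t \<in> borel_measurable M"
    and lim: "limit_law M Y \<mu>" and lim': "limit_law M (\<lambda>t \<omega>. Y t \<omega> + b t) \<mu>'"
  obtains B where "B > 0" "\<forall>\<^sub>F t in at_top. norm (b t) \<le> B"
proof -
  interpret M: prob_space M by fact
  define f where "f R x = max 0 (min 1 (R + 1 - norm x))" for R and x :: "real^'d"
  have cont: "continuous_on UNIV (f R)" for R unfolding f_def by (intro continuous_intros)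
  have f01: "0 \<le> f R x" "f R x \<le> 1" for R x by (auto simp: f_def)
  have [measurable]: "f R \<in> borel_measurable borel" for R by (rule borel_measurable_continuous_onI[OF cont])
  have big: "\<exists>R>0. \<forall>\<^sub>F t in at_top. (LINT \<omega>|M. f R (Z t \<omega>)) > 1 / 2" if Z: "limit_law M Z \<rho>" for Z \<rho>
  proof -
    interpret R: prob_space \<rho> using limit_law_prob[OF Z] .
    note [measurable_cong] = limit_law_sets[OF Z]
    obtain R where R: "R > 0" "measure \<rho> (ball 0 R) > 1 - 1 / 2"
      by (rule large_ball_measure[OF limit_law_prob[OF Z] limit_law_sets[OF Z], of "1 / 2"]) auto
    have B[measurable]: "ball 0 R \<in> sets \<rho>" by (simp add: limit_law_sets[OF Z])
    have "measure \<rho> (ball 0 R) = (LINT x|\<rho>. indicator (ball 0 R) x)"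
      using sets.sets_into_space[OF B] by (simp add: Int_absorb2)
    also have "\<dots> \<le> (LINT x|\<rho>. f R x)"
      using f01 by (intro integral_mono R.integrable_const_bound[where B=1]) (auto simp: f_def indicator_def)
    finally have "1 / 2 < (LINT x|\<rho>. f R x)" using R by simp
    then have "\<forall>\<^sub>F t in at_top. (LINT \<omega>|M. f R (Z t \<omega>)) > 1 / 2"
      by (intro order_tendstoD(1)[OF limit_law_tendsto[OF Z cont, where B=1]]) (use f01 in auto)
    then show ?thesis using R by blast
  qed
  obtain R where R: "R > 0" "\<forall>\<^sub>F t in at_top. (LINT \<omega>|M. f R (Y t \<omega>)) > 1 / 2" using big[OF lim] by blast
  obtain R' where R': "R' > 0" "\<forall>\<^sub>F t in at_top. (LINT \<omega>|M. f R' (Y t \<omega> + b t)) > 1 / 2" using big[OF lim'] by blast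
  have "\<forall>\<^sub>F t in at_top. norm (b t) \<le> R + R' + 2"
    using R(2) R'(2) eventually_gt_at_top[of 0]
  proof eventually_elim
    case (elim t)
    note [measurable] = Y[OF elim(3)]
    have int: "integrable M (\<lambda>\<omega>. f R (Y t \<omega>))" "integrable M (\<lambda>\<omega>. f R' (Y t \<omega> + b t))"
      using f01 by (auto intro!: M.integrable_const_bound[where B=1])
    \<comment> \<open>Two expectations above 1 / 2 force the sum above 1 somewhere; as neither term
      exceeds 1, both are then positive.\<close>
    have "\<exists>\<omega>. f R (Y t \<omega>) + f R' (Y t \<omega> + b t) > 1"
    proof (rule ccontr)
      assume "\<not> ?thesis"
      then have "(LINT \<omega>|M. f R (Y t \<omega>) + f R' (Y t \<omega> + b t)) \<le> (LINT \<omega>|M. 1)"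
        using int by (intro integral_mono) (auto simp: not_less)
      then show False using elim int by (simp add: M.prob_space)
    qed
    then obtain \<omega> where "f R (Y t \<omega>) + f R' (Y t \<omega> + b t) > 1" ..
    then have "f R (Y t \<omega>) > 0" "f R' (Y t \<omega> + b t) > 0" using f01(2)[of R "Y t \<omega>"] f01(2)[of R' "Y t \<omega> + b t"] by linarith+
    then have "norm (Y t \<omega>) \<le> R + 1" "norm (Y t \<omega> + b t) \<le> R' + 1" by (auto simp: f_def)
    then show ?case using norm_triangle_ineq4[of "Y t \<omega> + b t" "Y t \<omega>"] by simp
  qed
  then show thesis using R R' by (intro that[of "R + R' + 2"]) auto
qed

text \<open>The quotient of the characteristic functions at \<open>s e\<^sub>i\<close> makes \<open>exp (\<i> s b\<^sub>i)\<close> converge; as \<open>b\<close>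
  is bounded, \<open>s\<close> can be taken so small that \<open>arcsin\<close> recovers \<open>b\<^sub>i\<close>.\<close>

lemma limit_law_shift_converges:
  fixes Y :: "real \<Rightarrow> 'w \<Rightarrow> real^'d"
  assumes M: "prob_space M" and Y: "\<And>t. t > 0 \<Longrightarrow> Y t \<in> borel_measurable M"
    and lim: "limit_law M Y \<mu>" and lim': "limit_law M (\<lambda>t \<omega>. Y t \<omega> + b t) \<mu>'"
  obtains b0 where "(b \<longlongrightarrow> b0) at_top"
proof -
  interpret \<mu>: prob_space \<mu> using limit_law_prob[OF lim] .
  note [measurable_cong] = limit_law_sets[OF lim]
  obtain B where B: "B > 0" "\<forall>\<^sub>F t in at_top. norm (b t) \<le> B"
    by (rule limit_law_shift_bounded[OF M Y lim lim'])
  have "\<exists>l. ((\<lambda>t. b t $ i) \<longlongrightarrow> l) at_top" for i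
  proof -
    \<comment> \<open>Along \<open>e n\<close> the characteristic function of \<open>\<mu>\<close>
      tends to 1, its value at the origin, so it is nonzero for large \<open>n\<close>, as the
      quotient below requires.\<close>
    define e where "e n = (1 / real (Suc n)) *\<^sub>R (axis i 1 :: real^'d)" for n
    have "(\<lambda>n. char_fun \<mu> (e n)) \<longlonglongrightarrow> (LINT x|\<mu>. iexp ((0 *\<^sub>R axis i 1) \<bullet> x))"
      unfolding char_fun_def e_def
      by (intro integral_dominated_convergence[where w="\<lambda>_. 1"] AE_I2 tendsto_intros lim_1_over_n[THEN LIMSEQ_Suc]) auto
    then have "(\<lambda>n. char_fun \<mu> (e n)) \<longlonglongrightarrow> 1" by (simp add: \<mu>.prob_space)
    then have "\<forall>\<^sub>F n in sequentially. char_fun \<mu> (e n) \<noteq> 0" by (rule tendsto_imp_eventually_ne) simp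
    moreover have "\<forall>\<^sub>F n in sequentially. 1 / real (Suc n) < 1 / B"
      using B by (intro order_tendstoD(2)[OF lim_1_over_n[THEN LIMSEQ_Suc]]) auto
    ultimately have "\<forall>\<^sub>F n in sequentially. char_fun \<mu> (e n) \<noteq> 0 \<and> 1 / real (Suc n) < 1 / B"
      by (rule eventually_conj)
    then obtain n where n: "char_fun \<mu> (e n) \<noteq> 0" "1 / real (Suc n) < 1 / B" by (auto simp: eventually_sequentially)
    define s where "s = 1 / real (Suc n)"
    have s: "s > 0" "s * B < 1" using n(2) B(1) by (auto simp: s_def field_simps)
    have Y': "(\<lambda>\<omega>. Y t \<omega> + b t) \<in> borel_measurable M" if "t > 0" for t
      using Y[OF that] by simp
    have char_Y': "char_fun (distr M borel (\<lambda>\<omega>. Y t \<omega> + b t)) z = iexp (z \<bullet> b t) * char_fun (distr M borel (Y t)) z" if "t > 0" for t z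
    proof -
      have "distr (distr M borel (Y t)) borel ((+) (b t)) = distr M borel (\<lambda>\<omega>. Y t \<omega> + b t)"
        using Y[OF that] by (simp add: distr_distr comp_def add.commute)
      then show ?thesis using char_fun_translate[of "distr M borel (Y t)" "b t" z] by simp
    qed
    have "((\<lambda>t. char_fun (distr M borel (\<lambda>\<omega>. Y t \<omega> + b t)) (e n) / char_fun (distr M borel (Y t)) (e n)) \<longlongrightarrow> char_fun \<mu>' (e n) / char_fun \<mu> (e n)) at_top"
      by (intro tendsto_divide limit_law_char_fun[OF M] Y Y' lim lim' n)
    moreover have "\<forall>\<^sub>F t in at_top. char_fun (distr M borel (Y t)) (e n) \<noteq> 0"
      by (intro tendsto_imp_eventually_ne[OF _ n(1)] limit_law_char_fun M Y lim)
    with eventually_gt_at_top[of 0] have "\<forall>\<^sub>F t in at_top. char_fun (distr M borel (\<lambda>\<omega>. Y t \<omega> + b t)) (e n) / char_fun (distr M borel (Y t)) (e n) = iexp (s * b t $ i)"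
      by eventually_elim (simp add: char_Y' e_def s_def inner_axis' )
    ultimately have "((\<lambda>t. iexp (s * b t $ i)) \<longlongrightarrow> char_fun \<mu>' (e n) / char_fun \<mu> (e n)) at_top"
      by (rule Lim_transform_eventually)
    then have "((\<lambda>t. Im (iexp (s * b t $ i))) \<longlongrightarrow> Im (char_fun \<mu>' (e n) / char_fun \<mu> (e n))) at_top"
      by (rule tendsto_Im)
    then have "((\<lambda>t. sin (s * b t $ i)) \<longlongrightarrow> Im (char_fun \<mu>' (e n) / char_fun \<mu> (e n))) at_top"
      by (simp add: Im_exp)
    then obtain L where L: "((\<lambda>t. sin (s * b t $ i)) \<longlongrightarrow> L) at_top" by blast
    have small: "\<forall>\<^sub>F t in at_top. \<bar>s * b t $ i\<bar> \<le> 1"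
      using B(2)
    proof eventually_elim
      case (elim t)
      have "\<bar>s * b t $ i\<bar> \<le> s * B"
        using s(1) component_le_norm_cart[of "b t" i] elim by (simp add: abs_mult)
      then show ?case using s(2) by simp
    qed
    have pi: "(1::real) < pi / 2" using pi_gt3 by simp
    \<comment> \<open>Keeping the sines below \<open>sin 1\<close> places their limit strictly
      inside the interval from -1 to 1, where \<open>arcsin\<close> is continuous.\<close>
    have sin1: "sin 1 < (1::real)" using sin_monotone_2pi[of 1 "pi / 2"] pi by simp
    have "\<forall>\<^sub>F t in at_top. \<bar>sin (s * b t $ i)\<bar> \<le> sin 1"
      using small
    proof eventually_elim
      case (elim t)
      then show ?case
        using sin_monotone_2pi_le[of "s * b t $ i" 1] sin_monotone_2pi_le[of "- 1" "s * b t $ i"] pi by (simp add: abs_le_iff)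
    qed
    then have "\<bar>L\<bar> \<le> sin 1" by (rule tendsto_upperbound[OF tendsto_rabs[OF L]]) simp
    then have "isCont arcsin L" using sin1 by (intro isCont_arcsin) auto
    then have "((\<lambda>t. arcsin (sin (s * b t $ i))) \<longlongrightarrow> arcsin L) at_top"
      by (rule isCont_tendsto_compose) (rule L)
    then have "((\<lambda>t. arcsin (sin (s * b t $ i)) / s) \<longlongrightarrow> arcsin L / s) at_top"
      using s by (intro tendsto_divide) auto
    moreover have "\<forall>\<^sub>F t in at_top. arcsin (sin (s * b t $ i)) / s = b t $ i"
      using small by eventually_elim (use pi s in \<open>simp add: arcsin_sin abs_le_iff\<close>)
    ultimately have "((\<lambda>t. b t $ i) \<longlongrightarrow> arcsin L / s) at_top" by (rule Lim_transform_eventually)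
    then show ?thesis ..
  qed
  then obtain l where "\<And>i. ((\<lambda>t. b t $ i) \<longlongrightarrow> l i) at_top" by metis
  then have "(b \<longlongrightarrow> (\<chi> i. l i)) at_top" by (intro vec_tendstoI) simp
  then show thesis by (rule that)
qed

text \<open>Nonemptiness matters: with distance 0 to the empty set, the approximating functions
  would be constantly 1.\<close>

lemma closed_indicator_approx:
  fixes \<mu> :: "(real^'d) measure"
  assumes \<mu>: "prob_space \<mu>" "sets \<mu> = sets borel" and A: "closed A" "A \<noteq> {}"
  shows "(\<lambda>n. LINT x|\<mu>. max 0 (1 - real n * infdist x A)) \<longlonglongrightarrow> measure \<mu> A"
proof -
  interpret prob_space \<mu> by fact
  note [measurable_cong] = \<mu>(2)
  have [measurable]: "A \<in> sets borel" using A by simp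
  have [measurable]: "(\<lambda>x. infdist x A) \<in> borel_measurable borel"
    by (intro borel_measurable_continuous_onI continuous_intros)
  have lim: "(\<lambda>n. max 0 (1 - real n * infdist x A)) \<longlonglongrightarrow> indicator A x" for x
  proof (cases "x \<in> A")
    case True
    then show ?thesis by simp
  next
    case False
    then have pos: "infdist x A > 0" using A by (intro infdist_pos_not_in_closed)
    then obtain N :: nat where N: "1 < real N * infdist x A" using reals_Archimedean3[OF pos] by metis
    have "\<forall>\<^sub>F n in sequentially. max 0 (1 - real n * infdist x A) = 0"
      using eventually_ge_at_top[of N]
    proof eventually_elim
      case (elim n)
      then have "real N * infdist x A \<le> real n * infdist x A" using pos by (intro mult_right_mono) auto
      then show ?case using N by auto
    qed
    then show ?thesis using False by (simp add: tendsto_eventually)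
  qed
  have "(\<lambda>n. LINT x|\<mu>. max 0 (1 - real n * infdist x A)) \<longlonglongrightarrow> (LINT x|\<mu>. indicator A x)"
    by (rule integral_dominated_convergence[where w="\<lambda>_. 1"]) (use lim in \<open>auto simp: infdist_nonneg\<close>)
  then show ?thesis using sets_eq_imp_space_eq[OF \<mu>(2)] by simp
qed

text \<open>Slutsky's theorem for a deterministic shift. The cut-offs \<open>f n\<close> have
  Lipschitz constant \<open>n\<close>, so replacing \<open>b t\<close> by \<open>b0\<close> changes
  their expectations by at most \<open>n\<close> times a vanishing distance. They determine the
  measures of closed sets, an intersection-stable generator of the Borel sets.\<close>

lemma limit_law_shift_eq:
  fixes Y :: "real \<Rightarrow> 'w \<Rightarrow> real^'d"
  assumes M: "prob_space M" and Y: "\<And>t. t > 0 \<Longrightarrow> Y t \<in> borel_measurable M"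
    and lim: "limit_law M Y \<mu>" and lim': "limit_law M (\<lambda>t \<omega>. Y t \<omega> + b t) \<mu>'"
    and b: "(b \<longlongrightarrow> b0) at_top"
  shows "\<mu>' = distr \<mu> borel ((+) b0)"
proof -
  interpret M: prob_space M by fact
  define \<rho> where "\<rho> = distr \<mu> borel ((+) b0)"
  have lim0: "limit_law M (\<lambda>t \<omega>. b0 + Y t \<omega>) \<rho>"
    unfolding \<rho>_def by (intro limit_law_continuous_image[OF lim] continuous_intros)
  note pr = limit_law_prob[OF lim'] limit_law_sets[OF lim'] limit_law_prob[OF lim0] limit_law_sets[OF lim0]
  interpret P: prob_space \<mu>' by fact
  have meas_eq: "measure \<mu>' A = measure \<rho> A" if A: "closed A" "A \<noteq> {}" for A
  proof (rule LIMSEQ_unique[OF closed_indicator_approx[OF pr(1,2) A]])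
    define f where "f n x = max 0 (1 - real n * infdist x A)" for n and x :: "real^'d"
    have cont: "continuous_on UNIV (f n)" for n unfolding f_def by (intro continuous_intros)
    have [measurable]: "f n \<in> borel_measurable borel" for n by (rule borel_measurable_continuous_onI[OF cont])
    have f01: "\<bar>f n x\<bar> \<le> 1" for n x by (auto simp: f_def infdist_nonneg)
    have lip: "\<bar>f n x - f n y\<bar> \<le> real n * dist x y" for n x y
    proof -
      have "\<bar>f n x - f n y\<bar> \<le> \<bar>real n * infdist x A - real n * infdist y A\<bar>" unfolding f_def by linarith
      also have "\<dots> = real n * \<bar>infdist x A - infdist y A\<bar>" by (simp add: abs_mult right_diff_distrib[symmetric])
      also have "\<dots> \<le> real n * dist x y" by (intro mult_left_mono infdist_triangle_abs) auto
      finally show ?thesis .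
    qed
    have "(LINT x|\<mu>'. f n x) = (LINT x|\<rho>. f n x)" for n
    proof -
      have "((\<lambda>t. (LINT \<omega>|M. f n (Y t \<omega> + b t)) - (LINT \<omega>|M. f n (b0 + Y t \<omega>))) \<longlongrightarrow> 0) at_top"
      proof (rule Lim_null_comparison)
        show "\<forall>\<^sub>F t in at_top. norm ((LINT \<omega>|M. f n (Y t \<omega> + b t)) - (LINT \<omega>|M. f n (b0 + Y t \<omega>))) \<le> real n * dist (b t) b0"
          using eventually_gt_at_top[of 0]
        proof eventually_elim
          case (elim t)
          note [measurable] = Y[OF elim]
          have int: "integrable M (\<lambda>\<omega>. f n (Y t \<omega> + b t))" "integrable M (\<lambda>\<omega>. f n (b0 + Y t \<omega>))"
            using f01 by (auto intro!: M.integrable_const_bound[where B=1])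
          have le: "\<bar>f n (Y t \<omega> + b t) - f n (b0 + Y t \<omega>)\<bar> \<le> real n * dist (b t) b0" for \<omega>
            using lip[of n "Y t \<omega> + b t" "b0 + Y t \<omega>"] by (simp add: dist_norm)
          have "norm ((LINT \<omega>|M. f n (Y t \<omega> + b t)) - (LINT \<omega>|M. f n (b0 + Y t \<omega>))) = \<bar>LINT \<omega>|M. f n (Y t \<omega> + b t) - f n (b0 + Y t \<omega>)\<bar>"
            using int by simp
          also have "\<dots> \<le> (LINT \<omega>|M. real n * dist (b t) b0)"
            by (rule order_trans[OF integral_abs_bound], rule integral_mono) (use le int in auto)
          finally show ?case by (simp add: M.prob_space)
        qed
        have "((\<lambda>t. real n * dist (b t) b0) \<longlongrightarrow> real n * dist b0 b0) at_top" by (intro tendsto_intros b)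
        then show "((\<lambda>t. real n * dist (b t) b0) \<longlongrightarrow> 0) at_top" by simp
      qed
      moreover have "((\<lambda>t. (LINT \<omega>|M. f n (Y t \<omega> + b t)) - (LINT \<omega>|M. f n (b0 + Y t \<omega>))) \<longlongrightarrow> (LINT x|\<mu>'. f n x) - (LINT x|\<rho>. f n x)) at_top"
        by (intro tendsto_diff limit_law_tendsto[OF lim' cont, where B=1] limit_law_tendsto[OF lim0 cont, where B=1] f01)
      ultimately show ?thesis using tendsto_unique[OF trivial_limit_at_top_linorder] by fastforce
    qed
    then show "(\<lambda>n. LINT x|\<mu>'. max 0 (1 - real n * infdist x A)) \<longlonglongrightarrow> measure \<rho> A"
      using closed_indicator_approx[OF pr(3,4) A] by (simp add: f_def)
  qed
  have "\<mu>' = \<rho>"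
  proof (rule measure_eqI_generator_eq[where E="Collect closed" and \<Omega>=UNIV and A="\<lambda>_. UNIV"])
    show "Int_stable (Collect closed :: (real^'d) set set)" by (auto simp: Int_stable_def)
    show "emeasure \<mu>' A = emeasure \<rho> A" if "A \<in> Collect closed" for A
    proof (cases "A = {}")
      case False
      then show ?thesis
        using meas_eq[of A] that by (simp add: P.emeasure_eq_measure finite_measure.emeasure_eq_measure[OF prob_space.finite_measure[OF pr(3)]])
    qed simp
    show "sets \<mu>' = sigma_sets UNIV (Collect closed)" "sets \<rho> = sigma_sets UNIV (Collect closed)"
      using pr(2,4) by (simp_all add: borel_eq_closed)
    show "emeasure \<mu>' UNIV \<noteq> \<infinity>" by (simp add: P.emeasure_eq_measure)
  qed auto
  then show ?thesis by (simp add: \<rho>_def)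
qed

section \<open>Matrix exponential and pathwise integration\<close>

definition mat_pow :: "real^'d^'d \<Rightarrow> nat \<Rightarrow> real^'d^'d" where
  "mat_pow A n = ((**) A ^^ n) (mat 1)"

lemma mat_pow_0 [simp]: "mat_pow A 0 = mat 1"
  and mat_pow_Suc: "mat_pow A (Suc n) = A ** mat_pow A n"
  by (simp_all add: mat_pow_def)

lemma mat_pow_Suc_right: "mat_pow A (Suc n) = mat_pow A n ** A"
  by (induction n) (simp_all add: mat_pow_Suc matrix_mul_assoc)

lemma mat_pow_scaleR: "mat_pow (s *\<^sub>R A) n = s ^ n *\<^sub>R mat_pow A n"
proof (induction n)
  case (Suc n)
  then show ?case
    by (simp add: mat_pow_Suc vec_eq_iff matrix_matrix_mult_def sum_distrib_left mult_ac)
qed simp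

text \<open>The sum of the absolute values of all entries dominates each row sum, so every
  multiplication costs at most one such factor. This crude geometric bound suffices against the
  factorials.\<close>

lemma mat_pow_entry_bound:
  fixes A :: "real^'d^'d"
  shows "\<bar>mat_pow A n $ i $ j\<bar> \<le> (\<Sum>i\<in>UNIV. \<Sum>j\<in>UNIV. \<bar>A $ i $ j\<bar>) ^ n"
proof (induction n arbitrary: i j)
  case 0
  show ?case by (simp add: mat_def)
next
  case (Suc n)
  let ?C = "\<Sum>i\<in>UNIV. \<Sum>j\<in>UNIV. \<bar>A $ i $ j\<bar>"
  have "\<bar>mat_pow A (Suc n) $ i $ j\<bar> \<le> (\<Sum>k\<in>UNIV. \<bar>A $ i $ k * mat_pow A n $ k $ j\<bar>)"
    by (simp add: mat_pow_Suc matrix_matrix_mult_def sum_abs)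
  also have "\<dots> \<le> (\<Sum>k\<in>UNIV. \<bar>A $ i $ k\<bar> * ?C ^ n)"
    unfolding abs_mult by (intro sum_mono mult_left_mono Suc) auto
  also have "\<dots> = (\<Sum>k\<in>UNIV. \<bar>A $ i $ k\<bar>) * ?C ^ n" by (simp add: sum_distrib_right)
  also have "\<dots> \<le> ?C * ?C ^ n"
    by (intro mult_right_mono member_le_sum zero_le_power sum_nonneg) auto
  finally show ?case by simp
qed

lemma mat_exp_entry_summable:
  fixes A :: "real^'d^'d"
  shows "summable (\<lambda>n. mat_pow A n $ i $ j / fact n * s ^ n)"
proof (rule summable_comparison_test')
  let ?C = "\<Sum>i\<in>UNIV. \<Sum>j\<in>UNIV. \<bar>A $ i $ j\<bar>"
  show "summable (\<lambda>n. inverse (fact n) * (?C * \<bar>s\<bar>) ^ n)" by (rule summable_exp)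
  fix n
  have "norm (mat_pow A n $ i $ j / fact n * s ^ n) = \<bar>mat_pow A n $ i $ j\<bar> * (inverse (fact n) * \<bar>s\<bar> ^ n)"
    by (simp add: abs_mult power_abs divide_inverse)
  also have "\<dots> \<le> ?C ^ n * (inverse (fact n) * \<bar>s\<bar> ^ n)"
    by (intro mult_right_mono mat_pow_entry_bound) auto
  finally show "norm (mat_pow A n $ i $ j / fact n * s ^ n) \<le> inverse (fact n) * (?C * \<bar>s\<bar>) ^ n"
    by (simp add: power_mult_distrib mult_ac)
qed

text \<open>Matrix convergence is entrywise, and each entry is an everywhere convergent scalar power
  series in \<open>s\<close>. Calculus for the exponential is thereby reduced to termwise
  differentiation of such series.\<close>

lemma mat_exp_entry:
  fixes A :: "real^'d^'d"
  shows "mat_exp (s *\<^sub>R A) $ i $ j = (\<Sum>n. mat_pow A n $ i $ j / fact n * s ^ n)"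
proof -
  define E :: "real^'d^'d" where "E = (\<chi> i j. \<Sum>n. mat_pow A n $ i $ j / fact n * s ^ n)"
  have "(\<lambda>n. (1 / fact n) *\<^sub>R mat_pow (s *\<^sub>R A) n) sums E"
    unfolding sums_def
  proof (intro vec_tendstoI)
    fix i j
    have "(\<lambda>N. \<Sum>n<N. mat_pow A n $ i $ j / fact n * s ^ n) \<longlonglongrightarrow> (\<Sum>n. mat_pow A n $ i $ j / fact n * s ^ n)"
      by (intro summable_LIMSEQ mat_exp_entry_summable)
    then show "(\<lambda>N. (\<Sum>n<N. (1 / fact n) *\<^sub>R mat_pow (s *\<^sub>R A) n) $ i $ j) \<longlonglongrightarrow> E $ i $ j"
      by (simp add: E_def mat_pow_scaleR mult_ac)
  qed
  then have "mat_exp (s *\<^sub>R A) = E"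
    unfolding mat_exp_def mat_pow_def by (rule sums_unique[symmetric])
  then show ?thesis by (simp add: E_def)
qed

lemma mat_exp_zero: "mat_exp (0 :: real^'d^'d) = mat 1"
proof -
  have "mat_exp (0 *\<^sub>R (0 :: real^'d^'d)) $ i $ j = mat 1 $ i $ j" for i j
    unfolding mat_exp_entry using powser_zero[of "\<lambda>n. mat_pow (0 :: real^'d^'d) n $ i $ j / fact n"] by simp
  then show ?thesis by (simp add: vec_eq_iff)
qed

text \<open>Termwise differentiation shifts the powers by one. Splitting off the extra factor on the
  right places \<open>A\<close> next to the vector on which the exponential acts, as partial
  summation needs.\<close>

lemma mat_exp_entry_deriv:
  fixes A :: "real^'d^'d"
  shows "((\<lambda>s. mat_exp (s *\<^sub>R A) $ i $ j) has_field_derivative (mat_exp (s *\<^sub>R A) ** A) $ i $ j) (at s)"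
proof -
  let ?c = "\<lambda>i j n. mat_pow A n $ i $ j / fact n"
  have "((\<lambda>s. \<Sum>n. ?c i j n * s ^ n) has_field_derivative (\<Sum>n. diffs (?c i j) n * s ^ n)) (at s)"
    by (rule termdiffs_strong_converges_everywhere) (rule mat_exp_entry_summable)
  moreover have "(\<Sum>n. diffs (?c i j) n * s ^ n) = (mat_exp (s *\<^sub>R A) ** A) $ i $ j"
  proof -
    have "diffs (?c i j) n * s ^ n = (\<Sum>k\<in>UNIV. ?c i k n * s ^ n * A $ k $ j)" for n
    proof -
      have "real (Suc n) * (x / fact (Suc n)) = x / fact n" for x :: real
        by (simp only: fact_Suc times_divide_eq_right) (simp del: of_nat_Suc)
      then have "diffs (?c i j) n = (\<Sum>k\<in>UNIV. mat_pow A n $ i $ k * A $ k $ j) / fact n"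
        unfolding diffs_def by (simp only: mat_pow_Suc_right matrix_matrix_mult_def vec_lambda_beta)
      then show ?thesis by (simp add: sum_divide_distrib sum_distrib_left mult_ac)
    qed
    then have "(\<Sum>n. diffs (?c i j) n * s ^ n) = (\<Sum>n. \<Sum>k\<in>UNIV. ?c i k n * s ^ n * A $ k $ j)" by simp
    also have "\<dots> = (\<Sum>k\<in>UNIV. \<Sum>n. ?c i k n * s ^ n * A $ k $ j)"
      by (intro suminf_sum summable_mult2 mat_exp_entry_summable)
    also have "\<dots> = (\<Sum>k\<in>UNIV. (\<Sum>n. ?c i k n * s ^ n) * A $ k $ j)"
      by (intro sum.cong refl suminf_mult2[symmetric] mat_exp_entry_summable)
    also have "\<dots> = (mat_exp (s *\<^sub>R A) ** A) $ i $ j"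
      by (simp add: matrix_matrix_mult_def mat_exp_entry)
    finally show ?thesis .
  qed
  ultimately show ?thesis by (simp add: mat_exp_entry)
qed

lemma mat_exp_entry_deriv_shift:
  fixes Q :: "real^'d^'d"
  shows "((\<lambda>s. mat_exp (- (t - s) *\<^sub>R Q) $ i $ j) has_field_derivative (mat_exp (- (t - s) *\<^sub>R Q) ** Q) $ i $ j) (at s within S)"
proof -
  have "((\<lambda>s. - (t - s)) has_field_derivative 1) (at s within S)"
    by (auto intro!: derivative_eq_intros)
  from DERIV_chain2[OF mat_exp_entry_deriv this] show ?thesis by simp
qed

lemma mat_exp_vector_derivative:
  fixes Q :: "real^'d^'d"
  shows "((\<lambda>s. mat_exp (- (t - s) *\<^sub>R Q) *v y) has_vector_derivative (mat_exp (- (t - s) *\<^sub>R Q) *v (Q *v y))) (at s within S)"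
  unfolding has_vector_derivative_def
proof (subst has_derivative_componentwise_within, rule ballI)
  fix b :: "real^'d" assume "b \<in> Basis"
  then obtain i where b: "b = axis i 1" by (auto simp: Basis_vec_def)
  have "((\<lambda>s. \<Sum>j\<in>UNIV. mat_exp (- (t - s) *\<^sub>R Q) $ i $ j * y $ j) has_field_derivative
    (\<Sum>j\<in>UNIV. (mat_exp (- (t - s) *\<^sub>R Q) ** Q) $ i $ j * y $ j)) (at s within S)"
    by (intro DERIV_sum DERIV_cmult_right mat_exp_entry_deriv_shift)
  moreover have "(mat_exp (- (t - s) *\<^sub>R Q) *v y) \<bullet> b = (\<Sum>j\<in>UNIV. mat_exp (- (t - s) *\<^sub>R Q) $ i $ j * y $ j)" for s
    by (simp add: b inner_axis matrix_vector_mult_def)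
  moreover have "(\<Sum>j\<in>UNIV. (mat_exp (- (t - s) *\<^sub>R Q) ** Q) $ i $ j * y $ j) = (mat_exp (- (t - s) *\<^sub>R Q) *v (Q *v y)) \<bullet> b"
    unfolding matrix_vector_mul_assoc by (simp add: b inner_axis matrix_vector_mult_def)
  ultimately show "((\<lambda>s. (mat_exp (- (t - s) *\<^sub>R Q) *v y) \<bullet> b) has_derivative
    (\<lambda>x. (x *\<^sub>R (mat_exp (- (t - s) *\<^sub>R Q) *v (Q *v y))) \<bullet> b)) (at s within S)"
    by (simp only: has_field_derivative_def inner_scaleR_left mult_commute_abs)
qed

lemma mat_exp_continuous:
  fixes Q :: "real^'d^'d"
  shows "isCont (\<lambda>s. mat_exp (- (t - s) *\<^sub>R Q)) s"
proof -
  have "isCont (\<lambda>s. mat_exp (- (t - s) *\<^sub>R Q) $ i $ j) s" for i j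
    by (rule DERIV_isCont[OF mat_exp_entry_deriv_shift])
  then show ?thesis unfolding isCont_def by (intro vec_tendstoI)
qed

lemma tendsto_matrix_vector_mult:
  fixes A :: "'i \<Rightarrow> real^'d^'d" and x :: "'i \<Rightarrow> real^'d"
  assumes "(A \<longlongrightarrow> A0) F" "(x \<longlongrightarrow> x0) F"
  shows "((\<lambda>n. A n *v x n) \<longlongrightarrow> A0 *v x0) F"
  unfolding matrix_vector_mult_def
  by (intro vec_tendstoI) (simp, intro tendsto_intros tendsto_vec_nth assms)

lemma norm_matrix_vector_mult_le:
  fixes A :: "real^'d^'d"
  shows "norm (A *v x) \<le> real CARD('d) * norm A * norm x"
proof -
  have "\<bar>(A *v x) $ i\<bar> \<le> norm A * norm x" for i
  proof -
    have "(A *v x) $ i = A $ i \<bullet> x" by (simp add: matrix_vector_mult_def inner_vec_def)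
    then have "\<bar>(A *v x) $ i\<bar> \<le> norm (A $ i) * norm x" by (simp add: Cauchy_Schwarz_ineq2)
    also have "\<dots> \<le> norm A * norm x" by (intro mult_right_mono Finite_Cartesian_Product.norm_nth_le) auto
    finally show ?thesis .
  qed
  then have "(\<Sum>i\<in>UNIV. \<bar>(A *v x) $ i\<bar>) \<le> (\<Sum>i\<in>(UNIV::'d set). norm A * norm x)" by (intro sum_mono)
  then show ?thesis using norm_le_l1_cart[of "A *v x"] by (simp add: mult.assoc)
qed

section \<open>Cadlag paths and Riemann-Stieltjes sums\<close>

text \<open>One-sided limits bound the path near each time, and Bolzano's bisection principle glues
  the local bounds together.\<close>

lemma cadlag_bounded:
  fixes x :: "real \<Rightarrow> real^'d"
  assumes x: "cadlag x" and T: "0 \<le> T"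
  shows "\<exists>B. \<forall>s\<in>{0..T}. norm (x s) \<le> B"
proof -
  \<comment> \<open>Bisection also tests intervals that reach below 0, where the path is
    meaningless; the maximum with 0 discards that portion.\<close>
  define P where "P a b \<longleftrightarrow> (\<exists>B. \<forall>s\<in>{max 0 a..b}. norm (x s) \<le> B)" for a b
  have "P 0 T"
    using T
  proof (induction rule: Bolzano)
    case (trans a b c)
    then obtain B B' where "\<forall>s\<in>{max 0 a..b}. norm (x s) \<le> B" "\<forall>s\<in>{max 0 b..c}. norm (x s) \<le> B'"
      unfolding P_def by blast
    then have "norm (x s) \<le> max B B'" if "s \<in> {max 0 a..c}" for s
      using that by (cases "s \<le> b") (auto simp: le_max_iff_disj)
    then show ?case unfolding P_def by blast
  next
    case (local s)
    have "(x \<longlongrightarrow> x s) (at_right s)" using x local unfolding cadlag_def by auto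
    then have "\<forall>\<^sub>F u in at_right s. dist (x u) (x s) < 1" by (rule tendstoD) simp
    then obtain d where d: "d > 0" "\<And>u. s < u \<Longrightarrow> u < s + d \<Longrightarrow> dist (x u) (x s) < 1"
    proof -
      assume *: "\<And>d. d > 0 \<Longrightarrow> (\<And>u. s < u \<Longrightarrow> u < s + d \<Longrightarrow> dist (x u) (x s) < 1) \<Longrightarrow> thesis"
      obtain b where "b > s" "\<And>u. s < u \<Longrightarrow> u < b \<Longrightarrow> dist (x u) (x s) < 1"
        using \<open>\<forall>\<^sub>F u in at_right s. dist (x u) (x s) < 1\<close>
        unfolding eventually_at_right[OF less_add_one] by auto
      then show thesis using *[of "b - s"] by auto
    qed
    obtain d' y where d': "d' > 0" "\<And>u. 0 \<le> u \<Longrightarrow> s - d' < u \<Longrightarrow> u < s \<Longrightarrow> dist (x u) y < 1"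
    proof (cases "s = 0")
      case True
      \<comment> \<open>No admissible time precedes 0, so the condition on the left is void and any
        radius will do.\<close>
      then show ?thesis using that[of 1] by force
    next
      case False
      then obtain y where "(x \<longlongrightarrow> y) (at_left s)" using x local unfolding cadlag_def by force
      then have "\<forall>\<^sub>F u in at_left s. dist (x u) y < 1" by (rule tendstoD) simp
      then obtain b where "b < s" "\<And>u. b < u \<Longrightarrow> u < s \<Longrightarrow> dist (x u) y < 1"
        unfolding eventually_at_left[of "s - 1" s, simplified] by auto
      then show ?thesis using that[of "s - b" y] by auto
    qed
    show ?case
    proof (intro exI[of _ "min d d'"] conjI allI impI)
      fix a b assume ab: "a \<le> s \<and> s \<le> b \<and> b - a < min d d'"
      have "norm (x u) \<le> norm (x s) + norm y + 1" if u: "u \<in> {max 0 a..b}" for u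
      proof -
        consider "u = s" | "s < u" | "u < s" by linarith
        then show ?thesis
        proof cases
          case 2
          then have "dist (x u) (x s) < 1" using d(2)[of u] u ab by auto
          then show ?thesis using norm_triangle_ineq2[of "x u" "x s"] norm_ge_zero[of y] unfolding dist_norm by linarith
        next
          case 3
          then have "dist (x u) y < 1" using d'(2)[of u] u ab by auto
          then show ?thesis using norm_triangle_ineq2[of "x u" y] norm_ge_zero[of "x s"] unfolding dist_norm by linarith
        qed simp
      qed
      then show "P a b" unfolding P_def by blast
    qed (use d d' in auto)
  qed
  then show ?thesis by (simp add: P_def)
qed

text \<open>The integrator is sampled at the right endpoints of the grid cells, which approach \<open>s\<close> strictly
  from above: right continuity then gives convergence at every point, so the left limits and the set
  of jumps never enter.\<close>

definition grid_left :: "real \<Rightarrow> nat \<Rightarrow> real \<Rightarrow> real" where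
  "grid_left t n s = t * real (nat \<lfloor>real n * s / t\<rfloor>) / real n"

definition grid_right :: "real \<Rightarrow> nat \<Rightarrow> real \<Rightarrow> real" where
  "grid_right t n s = t * real (Suc (nat \<lfloor>real n * s / t\<rfloor>)) / real n"

lemma grid_piece:
  assumes "t > 0" "n > 0" "t * real k / real n \<le> s" "s < t * real (Suc k) / real n"
  shows "grid_left t n s = t * real k / real n" "grid_right t n s = t * real (Suc k) / real n"
proof -
  have "real k \<le> real n * s / t" "real n * s / t < real k + 1"
    using assms by (auto simp: field_simps)
  then have "\<lfloor>real n * s / t\<rfloor> = int k" by (intro floor_unique) auto
  then show "grid_left t n s = t * real k / real n" "grid_right t n s = t * real (Suc k) / real n"
    by (simp_all add: grid_left_def grid_right_def)
qed

lemma grid_bounds: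
  assumes "t > 0" "n > 0" "0 \<le> s"
  shows "0 \<le> grid_left t n s" "s - t / real n \<le> grid_left t n s" "grid_left t n s \<le> s"
    "s < grid_right t n s" "grid_right t n s \<le> s + t / real n"
proof -
  define q where "q = real n * s / t"
  have q: "q \<ge> 0" "s = t * q / real n" using assms by (auto simp: q_def)
  have fl: "real (nat \<lfloor>q\<rfloor>) \<le> q" "q < real (nat \<lfloor>q\<rfloor>) + 1" using q by linarith+
  have tn: "t / real n > 0" using assms by simp
  have L: "grid_left t n s = t / real n * real (nat \<lfloor>q\<rfloor>)" by (simp add: grid_left_def q_def)
  have R: "grid_right t n s = t / real n * (real (nat \<lfloor>q\<rfloor>) + 1)" by (simp add: grid_right_def q_def)
  have s: "s = t / real n * q" using q by simp
  have "t / real n * real (nat \<lfloor>q\<rfloor>) \<le> t / real n * q" using fl tn by (intro mult_left_mono) auto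
  moreover have "t / real n * q < t / real n * (real (nat \<lfloor>q\<rfloor>) + 1)" using fl tn by (intro mult_strict_left_mono) auto
  moreover have "t / real n * (real (nat \<lfloor>q\<rfloor>) + 1) = t / real n * real (nat \<lfloor>q\<rfloor>) + t / real n" by (simp add: distrib_left)
  moreover have "0 \<le> t / real n * real (nat \<lfloor>q\<rfloor>)" using tn by (intro mult_nonneg_nonneg) auto
  ultimately show "0 \<le> grid_left t n s" "s - t / real n \<le> grid_left t n s" "grid_left t n s \<le> s"
    "s < grid_right t n s" "grid_right t n s \<le> s + t / real n"
    unfolding L R using s by linarith+
qed

lemma grid_left_tendsto:
  assumes "t > 0" "0 \<le> s"
  shows "(\<lambda>n. grid_left t (Suc n) s) \<longlonglongrightarrow> s"
proof (rule tendsto_sandwich)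
  show "(\<lambda>n. s - t / real (Suc n)) \<longlonglongrightarrow> s"
    using tendsto_diff[OF tendsto_const[of s] LIMSEQ_Suc[OF lim_const_over_n[of t]]] by simp
  show "(\<lambda>n. s) \<longlonglongrightarrow> s" by simp
qed (use grid_bounds[OF assms(1) _ assms(2)] in \<open>auto intro!: always_eventually simp del: of_nat_Suc\<close>)

lemma grid_right_tendsto:
  assumes "t > 0" "0 \<le> s"
  shows "filterlim (\<lambda>n. grid_right t (Suc n) s) (at_right s) sequentially"
  unfolding filterlim_at
proof
  show "\<forall>\<^sub>F n in sequentially. grid_right t (Suc n) s \<in> {s<..} \<and> grid_right t (Suc n) s \<noteq> s"
    using grid_bounds(4)[OF assms(1) _ assms(2)] by (intro always_eventually) (auto simp: less_imp_neq[THEN not_sym])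
  show "(\<lambda>n. grid_right t (Suc n) s) \<longlonglongrightarrow> s"
  proof (rule tendsto_sandwich)
    show "(\<lambda>n. s) \<longlonglongrightarrow> s" by simp
    show "(\<lambda>n. s + t / real (Suc n)) \<longlonglongrightarrow> s"
      using tendsto_add[OF tendsto_const[of s] LIMSEQ_Suc[OF lim_const_over_n[of t]]] by simp
  qed (use grid_bounds(4,5)[OF assms(1) _ assms(2)] in \<open>auto intro!: always_eventually intro: less_imp_le simp del: of_nat_Suc\<close>)
qed

text \<open>Agreement on half-open cells is enough: the right endpoint is a single point and does
  not affect the integral over the cell.\<close>

lemma has_integral_grid:
  fixes f :: "real \<Rightarrow> 'a::banach"
  assumes t: "t > 0" and n: "n > 0"
    and g: "\<And>k. k < n \<Longrightarrow> (g k has_integral I k) {t * real k / real n..t * real (Suc k) / real n}"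
    and fg: "\<And>k s. k < n \<Longrightarrow> t * real k / real n \<le> s \<Longrightarrow> s < t * real (Suc k) / real n \<Longrightarrow> f s = g k s"
  shows "(f has_integral (\<Sum>k<n. I k)) {0..t}"
proof -
  have "m \<le> n \<Longrightarrow> (f has_integral (\<Sum>k<m. I k)) {0..t * real m / real n}" for m
  proof (induction m)
    case (Suc m)
    have "(f has_integral I m) {t * real m / real n..t * real (Suc m) / real n}"
      by (rule has_integral_spike_finite[of "{t * real (Suc m) / real n}", OF _ _ g])
        (use Suc.prems in \<open>auto intro!: fg\<close>)
    moreover have "t * real m / real n \<le> t * real (Suc m) / real n"
      using t n by (intro divide_right_mono mult_left_mono) auto
    moreover have "0 \<le> t * real m / real n" using t n by simp
    ultimately show ?case
      using Suc by (simp del: of_nat_Suc add: has_integral_combine)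
  qed (simp add: has_integral_refl)
  from this[of n] show ?thesis using n by simp
qed

text \<open>The step functions sampled at \<open>grid_right\<close> converge pointwise to the path.
  They look beyond \<open>t\<close> by at most one cell, hence the bound on an interval of length
  \<open>2 * t\<close>.\<close>

lemma right_continuous_integrable:
  fixes x :: "real \<Rightarrow> real^'d"
  assumes t: "t > 0" and right: "\<And>s. s \<ge> 0 \<Longrightarrow> (x \<longlongrightarrow> x s) (at_right s)"
    and B: "\<And>s. s \<in> {0..2 * t} \<Longrightarrow> norm (x s) \<le> B"
  shows "x integrable_on {0..t}"
proof (rule dominated_convergence(1)[where f="\<lambda>n s. x (grid_right t (Suc n) s)" and h="\<lambda>_. B"])
  fix n
  have "((\<lambda>s. x (grid_right t (Suc n) s)) has_integral (\<Sum>k<Suc n. (t * real (Suc k) / real (Suc n) - t * real k / real (Suc n)) *\<^sub>R x (t * real (Suc k) / real (Suc n)))) {0..t}"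
  proof (rule has_integral_grid[OF t])
    fix k
    have "t * real k / real (Suc n) \<le> t * real (Suc k) / real (Suc n)"
      using t by (intro divide_right_mono mult_left_mono) auto
    then show "((\<lambda>s. x (t * real (Suc k) / real (Suc n))) has_integral (t * real (Suc k) / real (Suc n) - t * real k / real (Suc n)) *\<^sub>R x (t * real (Suc k) / real (Suc n)))
        {t * real k / real (Suc n)..t * real (Suc k) / real (Suc n)}"
      using has_integral_const_real[of "x (t * real (Suc k) / real (Suc n))"] by (metis content_real)
  qed (simp_all add: grid_piece(2)[OF t] del: of_nat_Suc)
  then show "(\<lambda>s. x (grid_right t (Suc n) s)) integrable_on {0..t}" by blast
next
  fix n s assume s: "s \<in> {0..t}"
  have "t / real (Suc n) \<le> t" using t by (simp add: field_simps)
  then have "grid_right t (Suc n) s \<in> {0..2 * t}"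
    using grid_bounds(4,5)[OF t, of "Suc n" s] s by auto
  then show "norm (x (grid_right t (Suc n) s)) \<le> B" by (rule B)
next
  fix s assume s: "s \<in> {0..t}"
  show "(\<lambda>n. x (grid_right t (Suc n) s)) \<longlonglongrightarrow> x s"
    using filterlim_compose[OF right grid_right_tendsto[OF t]] s by simp
qed auto

text \<open>Abel summation with the increments of \<open>F\<close> multiplied by the later value of
  \<open>y\<close>; this is where the right endpoints of the cells come from.\<close>

lemma sum_by_parts:
  fixes F :: "nat \<Rightarrow> real^'d^'d" and y :: "nat \<Rightarrow> real^'d"
  shows "(\<Sum>k<n. F k *v (y (Suc k) - y k)) = F n *v y n - F 0 *v y 0 - (\<Sum>k<n. F (Suc k) *v y (Suc k) - F k *v y (Suc k))"
  by (induction n) (simp_all add: matrix_vector_mult_diff_distrib)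


lemma mat_exp_bounded:
  fixes Q :: "real^'d^'d"
  shows "\<exists>C\<ge>0. \<forall>s\<in>{0..t}. \<forall>y. norm (mat_exp (- (t - s) *\<^sub>R Q) *v y) \<le> C * norm y"
proof -
  have "compact ((\<lambda>s. mat_exp (- (t - s) *\<^sub>R Q)) ` {0..t})"
    by (intro compact_continuous_image continuous_at_imp_continuous_on ballI mat_exp_continuous compact_Icc)
  then have "bounded ((\<lambda>s. mat_exp (- (t - s) *\<^sub>R Q)) ` {0..t})" by (rule compact_imp_bounded)
  then obtain C where "\<forall>s\<in>{0..t}. norm (mat_exp (- (t - s) *\<^sub>R Q)) \<le> C"
    unfolding bounded_iff by fast
  then have C: "norm (mat_exp (- (t - s) *\<^sub>R Q)) \<le> C" if "s \<in> {0..t}" for s using that by blast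
  show ?thesis
  proof (intro exI[of _ "real CARD('d) * max 0 C"] conjI ballI allI)
    fix s and y :: "real^'d" assume "s \<in> {0..t}"
    then have "real CARD('d) * norm (mat_exp (- (t - s) *\<^sub>R Q)) * norm y \<le> real CARD('d) * max 0 C * norm y"
      using C[of s] by (intro mult_right_mono mult_left_mono) auto
    then show "norm (mat_exp (- (t - s) *\<^sub>R Q) *v y) \<le> real CARD('d) * max 0 C * norm y"
      using norm_matrix_vector_mult_le order_trans by blast
  qed simp
qed

text \<open>The sums are exactly the integrals of the step functions obtained by freezing the
  exponential at \<open>grid_left\<close>.\<close>

lemma drift_sums_tendsto:
  fixes Q :: "real^'d^'d"
  assumes t: "t > 0"
  shows "(\<lambda>n. \<Sum>k<Suc n. mat_exp (- (t - t * real k / real (Suc n)) *\<^sub>R Q) *v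
      ((t * real (Suc k) / real (Suc n)) *\<^sub>R a - (t * real k / real (Suc n)) *\<^sub>R a))
    \<longlonglongrightarrow> integral {0..t} (\<lambda>s. mat_exp (- (t - s) *\<^sub>R Q) *v a)"
proof -
  define F where "F s = mat_exp (- (t - s) *\<^sub>R Q)" for s
  obtain C where C: "C \<ge> 0" "\<And>s y. s \<in> {0..t} \<Longrightarrow> norm (F s *v y) \<le> C * norm y"
    using mat_exp_bounded[of t Q] unfolding F_def by blast
  let ?S = "\<lambda>n. \<Sum>k<Suc n. F (t * real k / real (Suc n)) *v ((t * real (Suc k) / real (Suc n)) *\<^sub>R a - (t * real k / real (Suc n)) *\<^sub>R a)"
  have int: "((\<lambda>s. F (grid_left t (Suc n) s) *v a) has_integral ?S n) {0..t}" for n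
  proof (rule has_integral_grid[OF t])
    fix k
    have le: "t * real k / real (Suc n) \<le> t * real (Suc k) / real (Suc n)"
      using t by (intro divide_right_mono mult_left_mono) auto
    have "F (t * real k / real (Suc n)) *v ((t * real (Suc k) / real (Suc n)) *\<^sub>R a - (t * real k / real (Suc n)) *\<^sub>R a)
        = (t * real (Suc k) / real (Suc n) - t * real k / real (Suc n)) *\<^sub>R (F (t * real k / real (Suc n)) *v a)"
      by (simp only: scaleR_diff_left[symmetric] matrix_vector_mult_scaleR)
    then show "((\<lambda>s. F (t * real k / real (Suc n)) *v a) has_integral F (t * real k / real (Suc n)) *v ((t * real (Suc k) / real (Suc n)) *\<^sub>R a - (t * real k / real (Suc n)) *\<^sub>R a))
        {t * real k / real (Suc n)..t * real (Suc k) / real (Suc n)}"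
      using has_integral_const_real[of "F (t * real k / real (Suc n)) *v a"] le by (metis content_real)
  qed (simp_all add: grid_piece(1)[OF t] del: of_nat_Suc)
  have "(\<lambda>n. integral {0..t} (\<lambda>s. F (grid_left t (Suc n) s) *v a)) \<longlonglongrightarrow> integral {0..t} (\<lambda>s. F s *v a)"
  proof (rule dominated_convergence(2)[where h="\<lambda>_. C * norm a"])
    show "(\<lambda>s. F (grid_left t (Suc n) s) *v a) integrable_on {0..t}" for n using int by blast
    show "norm (F (grid_left t (Suc n) s) *v a) \<le> C * norm a" if "s \<in> {0..t}" for n s
      using grid_bounds(1,3)[OF t, of "Suc n" s] that by (intro C) auto
    show "(\<lambda>n. F (grid_left t (Suc n) s) *v a) \<longlonglongrightarrow> F s *v a" if "s \<in> {0..t}" for s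
      using that unfolding F_def
      by (intro tendsto_matrix_vector_mult isCont_tendsto_compose[OF mat_exp_continuous] grid_left_tendsto t) auto
  qed auto
  then show ?thesis unfolding integral_unique[OF int] unfolding F_def .
qed

text \<open>Variation of constants along one path. On each cell the equation expresses the increment
  of \<open>z\<close> by that of \<open>x\<close> plus an integral of Q x. Abel summation of the
  former gives the boundary terms and increments of the exponential, and these are integrals of the
  exponential times Q. The two Q terms cancel in the limit.\<close>

lemma noise_sums_tendsto:
  fixes Q :: "real^'d^'d" and x z :: "real \<Rightarrow> real^'d"
  assumes t: "t > 0" and x: "cadlag x"
    and eq: "\<And>s. s \<ge> 0 \<Longrightarrow> x s = b - integral {0..s} (\<lambda>u. Q *v x u) + z s"
  shows "(\<lambda>n. \<Sum>k<Suc n. mat_exp (- (t - t * real k / real (Suc n)) *\<^sub>R Q) *v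
      (z (t * real (Suc k) / real (Suc n)) - z (t * real k / real (Suc n))))
    \<longlonglongrightarrow> x t - mat_exp (- t *\<^sub>R Q) *v x 0"
proof -
  define F where "F s = mat_exp (- (t - s) *\<^sub>R Q)" for s
  obtain C where C: "C \<ge> 0" "\<And>s y. s \<in> {0..t} \<Longrightarrow> norm (F s *v y) \<le> C * norm y"
    using mat_exp_bounded[of t Q] unfolding F_def by blast
  have "\<exists>B. \<forall>s\<in>{0..2 * t}. norm (x s) \<le> B" using t by (intro cadlag_bounded[OF x]) simp
  then obtain B where B: "\<And>s. s \<in> {0..2 * t} \<Longrightarrow> norm (x s) \<le> B" by blast
  have right: "(x \<longlongrightarrow> x s) (at_right s)" if "s \<ge> 0" for s using x that by (auto simp: cadlag_def)
  have Qbl: "bounded_linear ((*v) Q)" by simp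
  define B' where "B' = real CARD('d) * norm Q * B"
  have QB: "norm (Q *v x s) \<le> B'" if "s \<in> {0..2 * t}" for s
    unfolding B'_def using norm_matrix_vector_mult_le[of Q "x s"] B[OF that]
    by (meson mult_left_mono mult_nonneg_nonneg norm_ge_zero of_nat_0_le_iff order_trans)
  have Qx_int: "(\<lambda>u. Q *v x u) integrable_on {0..t}"
    using integrable_linear[OF right_continuous_integrable[OF t right B] Qbl] by (simp add: comp_def)
  define p where "p n k = t * real k / real (Suc n)" for n k :: nat
  define R where "R n s = F (grid_left t (Suc n) s) *v (Q *v x s) - F s *v (Q *v x (grid_right t (Suc n) s))" for n s
  let ?S = "\<lambda>n. \<Sum>k<Suc n. F (p n k) *v (z (p n (Suc k)) - z (p n k))"
  have p0: "p n 0 = 0" "p n (Suc n) = t" for n by (simp_all add: p_def)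
  have p_mono: "p n k \<le> p n (Suc k)" "0 \<le> p n k" for n k
    unfolding p_def using t by (auto intro!: divide_right_mono mult_left_mono)
  have p_le: "p n k \<le> t" if "k \<le> Suc n" for n k
    using that t by (simp add: p_def divide_le_eq)
  have R_int: "(R n has_integral (?S n - (x t - F 0 *v x 0))) {0..t}" for n
  proof -
    define I where "I k = F (p n k) *v integral {p n k..p n (Suc k)} (\<lambda>u. Q *v x u)
        - (F (p n (Suc k)) *v x (p n (Suc k)) - F (p n k) *v x (p n (Suc k)))" for k
    have "(R n has_integral (\<Sum>k<Suc n. I k)) {0..t}"
    proof (rule has_integral_grid[OF t])
      fix k assume k: "k < Suc n"
      have "(\<lambda>u. Q *v x u) integrable_on {p n k..p n (Suc k)}"
        by (rule integrable_on_subinterval[OF Qx_int]) (use p_mono p_le[of "Suc k" n] k in auto)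
      then have "((\<lambda>s. F (p n k) *v (Q *v x s)) has_integral F (p n k) *v integral {p n k..p n (Suc k)} (\<lambda>u. Q *v x u)) {p n k..p n (Suc k)}"
        using has_integral_linear[OF integrable_integral, of "\<lambda>u. Q *v x u" _ "(*v) (F (p n k))"] by (simp add: comp_def)
      moreover have "((\<lambda>s. F s *v (Q *v x (p n (Suc k)))) has_integral F (p n (Suc k)) *v x (p n (Suc k)) - F (p n k) *v x (p n (Suc k))) {p n k..p n (Suc k)}"
        unfolding F_def by (rule fundamental_theorem_of_calculus[OF p_mono(1) mat_exp_vector_derivative])
      ultimately have "((\<lambda>s. F (p n k) *v (Q *v x s) - F s *v (Q *v x (p n (Suc k)))) has_integral I k) {p n k..p n (Suc k)}"
        unfolding I_def by (rule has_integral_diff)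
      then show "((\<lambda>s. F (p n k) *v (Q *v x s) - F s *v (Q *v x (p n (Suc k)))) has_integral I k) {t * real k / real (Suc n)..t * real (Suc k) / real (Suc n)}"
        by (simp only: p_def)
    qed (simp_all add: R_def p_def grid_piece[OF t] del: of_nat_Suc)
    moreover have "(\<Sum>k<Suc n. I k) = ?S n - (x t - F 0 *v x 0)"
    proof -
      have dz: "z (p n (Suc k)) - z (p n k) = x (p n (Suc k)) - x (p n k) + integral {p n k..p n (Suc k)} (\<lambda>u. Q *v x u)" if k: "k < Suc n" for k
      proof -
        have "(\<lambda>u. Q *v x u) integrable_on {0..p n (Suc k)}"
          by (rule integrable_on_subinterval[OF Qx_int]) (use p_mono p_le[of "Suc k" n] k in auto)
        then have "integral {0..p n k} (\<lambda>u. Q *v x u) + integral {p n k..p n (Suc k)} (\<lambda>u. Q *v x u) = integral {0..p n (Suc k)} (\<lambda>u. Q *v x u)"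
          using p_mono by (intro Henstock_Kurzweil_Integration.integral_combine) auto
        moreover have "z s = x s - b + integral {0..s} (\<lambda>u. Q *v x u)" if "s \<ge> 0" for s
          by (subst eq[OF that]) simp
        ultimately show ?thesis using p_mono(2) by (simp flip: \<open>_ + _ = integral {0..p n (Suc k)} _\<close>)
      qed
      have "?S n = (\<Sum>k<Suc n. F (p n k) *v (x (p n (Suc k)) - x (p n k))) + (\<Sum>k<Suc n. F (p n k) *v integral {p n k..p n (Suc k)} (\<lambda>u. Q *v x u))"
        unfolding sum.distrib[symmetric] by (intro sum.cong refl) (simp add: dz matrix_vector_right_distrib)
      also have "(\<Sum>k<Suc n. F (p n k) *v (x (p n (Suc k)) - x (p n k))) =
          F t *v x t - F 0 *v x 0 - (\<Sum>k<Suc n. F (p n (Suc k)) *v x (p n (Suc k)) - F (p n k) *v x (p n (Suc k)))"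
        using sum_by_parts[of "\<lambda>k. F (p n k)" "\<lambda>k. x (p n k)" "Suc n"] unfolding p0 .
      also have "F t *v x t = x t" by (simp add: F_def mat_exp_zero)
      finally show ?thesis unfolding I_def sum_subtractf by simp
    qed
    ultimately show ?thesis by simp
  qed
  have "(\<lambda>n. integral {0..t} (R n)) \<longlonglongrightarrow> integral {0..t} (\<lambda>s. 0 :: real^'d)"
  proof (rule dominated_convergence(2)[where h="\<lambda>_. C * B' + C * B'"])
    show "R n integrable_on {0..t}" for n using R_int by blast
    show "norm (R n s) \<le> C * B' + C * B'" if s: "s \<in> {0..t}" for n s
    proof -
      have "t / real (Suc n) \<le> t" using t by (simp add: field_simps)
      then have "grid_right t (Suc n) s \<in> {0..2 * t}" "grid_left t (Suc n) s \<in> {0..t}"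
        using grid_bounds[OF t, of "Suc n" s] s by auto
      then have "norm (F (grid_left t (Suc n) s) *v (Q *v x s)) \<le> C * B'" "norm (F s *v (Q *v x (grid_right t (Suc n) s))) \<le> C * B'"
        using s t QB[of s] QB[of "grid_right t (Suc n) s"] C(1)
        by (auto intro!: order_trans[OF C(2)] mult_left_mono)
      then show ?thesis unfolding R_def using norm_triangle_ineq4 order_trans add_mono by meson
    qed
    show "(\<lambda>n. R n s) \<longlonglongrightarrow> 0" if s: "s \<in> {0..t}" for s
    proof -
      have "(\<lambda>n. x (grid_right t (Suc n) s)) \<longlonglongrightarrow> x s"
        using filterlim_compose[OF right grid_right_tendsto[OF t]] s by simp
      then have "(\<lambda>n. R n s) \<longlonglongrightarrow> F s *v (Q *v x s) - F s *v (Q *v x s)"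
        using s unfolding R_def F_def
        by (intro tendsto_diff tendsto_matrix_vector_mult isCont_tendsto_compose[OF mat_exp_continuous] grid_left_tendsto t tendsto_const) auto
      then show ?thesis by simp
    qed
  qed auto
  then have "(\<lambda>n. ?S n - (x t - F 0 *v x 0)) \<longlonglongrightarrow> 0" unfolding integral_unique[OF R_int] by simp
  then have "?S \<longlonglongrightarrow> x t - F 0 *v x 0" by (rule LIM_zero_cancel)
  then show ?thesis by (simp add: F_def p_def)
qed

section \<open>Profile cut-off\<close>

text \<open>The Riemann sums of the driftless integrator are those of the noise, divided by sqrt
  \<epsilon>, minus those of the drift. Both converge, and convergence of the former is drawn from
  the solution path.\<close>

lemma I_nat_pathwise:
  fixes Q :: "real^'d^'d"
  assumes t: "t > 0" and e: "\<epsilon> > 0" and x: "cadlag x" and \<xi>0: "\<xi> 0 \<omega> = 0"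
    and eq: "\<And>s. s \<ge> 0 \<Longrightarrow> x s = x0 - integral {0..s} (\<lambda>u. Q *v x u) + sqrt \<epsilon> *\<^sub>R \<xi> s \<omega>"
  shows "I_nat Q a \<xi> t \<omega> = (1 / sqrt \<epsilon>) *\<^sub>R (x t - mat_exp (- t *\<^sub>R Q) *v x0)
    - integral {0..t} (\<lambda>s. mat_exp (- (t - s) *\<^sub>R Q) *v a)"
proof -
  have x0: "x 0 = x0" using eq[of 0] \<xi>0 by simp
  define F where "F n k = mat_exp (- (t - t * real k / real (Suc n)) *\<^sub>R Q)" for n k :: nat
  define p where "p n k = t * real k / real (Suc n)" for n k :: nat
  have "(\<lambda>n. (1 / sqrt \<epsilon>) *\<^sub>R (\<Sum>k<Suc n. F n k *v (sqrt \<epsilon> *\<^sub>R \<xi> (p n (Suc k)) \<omega> - sqrt \<epsilon> *\<^sub>R \<xi> (p n k) \<omega>))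
      - (\<Sum>k<Suc n. F n k *v (p n (Suc k) *\<^sub>R a - p n k *\<^sub>R a)))
    \<longlonglongrightarrow> (1 / sqrt \<epsilon>) *\<^sub>R (x t - mat_exp (- t *\<^sub>R Q) *v x 0) - integral {0..t} (\<lambda>s. mat_exp (- (t - s) *\<^sub>R Q) *v a)"
    unfolding F_def p_def
    by (intro tendsto_diff tendsto_scaleR tendsto_const drift_sums_tendsto t
      noise_sums_tendsto[where z="\<lambda>s. sqrt \<epsilon> *\<^sub>R \<xi> s \<omega>" and b=x0] x eq)
  moreover have "(1 / sqrt \<epsilon>) *\<^sub>R (\<Sum>k<Suc n. F n k *v (sqrt \<epsilon> *\<^sub>R \<xi> (p n (Suc k)) \<omega> - sqrt \<epsilon> *\<^sub>R \<xi> (p n k) \<omega>))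
      - (\<Sum>k<Suc n. F n k *v (p n (Suc k) *\<^sub>R a - p n k *\<^sub>R a))
    = (\<Sum>k<Suc n. F n k *v (driftless a \<xi> (p n (Suc k)) \<omega> - driftless a \<xi> (p n k) \<omega>))" for n
    unfolding scaleR_sum_right sum_subtractf[symmetric]
  proof (intro sum.cong refl)
    fix k
    have "(1 / sqrt \<epsilon>) *\<^sub>R (F n k *v (sqrt \<epsilon> *\<^sub>R \<xi> (p n (Suc k)) \<omega> - sqrt \<epsilon> *\<^sub>R \<xi> (p n k) \<omega>))
        = F n k *v (\<xi> (p n (Suc k)) \<omega> - \<xi> (p n k) \<omega>)"
      using e by (simp add: scaleR_diff_right[symmetric] matrix_vector_mult_scaleR)
    then show "(1 / sqrt \<epsilon>) *\<^sub>R (F n k *v (sqrt \<epsilon> *\<^sub>R \<xi> (p n (Suc k)) \<omega> - sqrt \<epsilon> *\<^sub>R \<xi> (p n k) \<omega>))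
        - F n k *v (p n (Suc k) *\<^sub>R a - p n k *\<^sub>R a) = F n k *v (driftless a \<xi> (p n (Suc k)) \<omega> - driftless a \<xi> (p n k) \<omega>)"
      by (simp add: driftless_def matrix_vector_mult_diff_distrib)
  qed
  ultimately have "(\<lambda>n. \<Sum>k<Suc n. F n k *v (driftless a \<xi> (p n (Suc k)) \<omega> - driftless a \<xi> (p n k) \<omega>))
    \<longlonglongrightarrow> (1 / sqrt \<epsilon>) *\<^sub>R (x t - mat_exp (- t *\<^sub>R Q) *v x0) - integral {0..t} (\<lambda>s. mat_exp (- (t - s) *\<^sub>R Q) *v a)"
    by (simp only: x0)
  \<comment> \<open>The sums were indexed by \<open>Suc n\<close> to keep the mesh meaningful; the
    shift by one returns to the sequence in the definition of the integral.\<close>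
  then have "(\<lambda>n. \<Sum>k<n. mat_exp (- (t - t * real k / real n) *\<^sub>R Q) *v
      (driftless a \<xi> (t * real (Suc k) / real n) \<omega> - driftless a \<xi> (t * real k / real n) \<omega>))
    \<longlonglongrightarrow> (1 / sqrt \<epsilon>) *\<^sub>R (x t - mat_exp (- t *\<^sub>R Q) *v x0) - integral {0..t} (\<lambda>s. mat_exp (- (t - s) *\<^sub>R Q) *v a)"
    unfolding F_def p_def by (rule LIMSEQ_imp_Suc)
  then show ?thesis unfolding I_nat_def stoch_integral_def by (rule limI)
qed

lemma measurable_matrix_vector_mult [measurable]:
  fixes A :: "real^'d^'d"
  assumes "f \<in> borel_measurable M"
  shows "(\<lambda>\<omega>. A *v f \<omega>) \<in> borel_measurable M"
  by (rule borel_measurable_continuous_on[OF linear_continuous_on assms]) simp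

text \<open>The function \<open>lim\<close> of a sequence of measurable maps is measurable whether
  or not the sequence converges, so no exceptional set has to be treated.\<close>

lemma I_nat_measurable:
  assumes "\<And>s. s \<ge> 0 \<Longrightarrow> \<xi> s \<in> borel_measurable M" and t: "t \<ge> 0"
  shows "I_nat Q a \<xi> t \<in> borel_measurable M"
proof -
  have [measurable]: "driftless a \<xi> (t * real k / real n) \<in> borel_measurable M" for k n
    unfolding driftless_def[abs_def] using t assms(1)[of "t * real k / real n"] by simp
  have "(\<lambda>\<omega>. lim (\<lambda>n. \<Sum>k<n. mat_exp (- (t - t * real k / real n) *\<^sub>R Q) *v
      (driftless a \<xi> (t * real (Suc k) / real n) \<omega> - driftless a \<xi> (t * real k / real n) \<omega>))) \<in> borel_measurable M"
    by (intro borel_measurable_lim_metric borel_measurable_sum measurable_matrix_vector_mult borel_measurable_diff) measurable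
  then show ?thesis unfolding I_nat_def stoch_integral_def[abs_def] .
qed

lemma limit_law_cong_AE:
  fixes Y Y' :: "real \<Rightarrow> 'w \<Rightarrow> real^'d"
  assumes lim: "limit_law M Y \<mu>"
    and Y: "\<And>t. t > 0 \<Longrightarrow> Y t \<in> borel_measurable M" "\<And>t. t > 0 \<Longrightarrow> Y' t \<in> borel_measurable M"
    and eq: "\<And>t. t > 0 \<Longrightarrow> AE \<omega> in M. Y t \<omega> = Y' t \<omega>"
  shows "limit_law M Y' \<mu>"
  unfolding limit_law_def
proof (intro conjI allI impI limit_law_prob[OF lim] limit_law_sets[OF lim])
  fix f :: "real^'d \<Rightarrow> real" assume f: "continuous_on UNIV f" "bounded (range f)"
  have [measurable]: "f \<in> borel_measurable borel" using f(1) by (rule borel_measurable_continuous_onI)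
  have "((\<lambda>t. LINT \<omega>|M. f (Y t \<omega>)) \<longlongrightarrow> (LINT x|\<mu>. f x)) at_top"
    using lim f unfolding limit_law_def by blast
  moreover have "\<forall>\<^sub>F t in at_top. (LINT \<omega>|M. f (Y t \<omega>)) = (LINT \<omega>|M. f (Y' t \<omega>))"
    using eventually_gt_at_top[of 0]
  proof eventually_elim
    case (elim t)
    note [measurable] = Y[OF elim]
    show ?case using eq[OF elim] by (intro integral_cong_AE) auto
  qed
  ultimately show "((\<lambda>t. LINT \<omega>|M. f (Y' t \<omega>)) \<longlongrightarrow> (LINT x|\<mu>. f x)) at_top"
    by (rule Lim_transform_eventually)
qed

section \<open>Asymptotic scales of the cut-off\<close>

lemma norm_complex_vec: "norm (complex_vec x) = norm x"
  by (simp add: norm_vec_def complex_vec_def)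

text \<open>Only norms are compared, by the reverse triangle inequality. Positivity of
  \<open>r\<close> is read off at time 0, where the oscillating sum is the plain sum of the
  \<open>v k\<close>; this is nonzero by independence, injectivity turning the sum over indices into
  one over the set of vectors.\<close>

lemma asymptotic_data_norm:
  assumes data: "asymptotic_data Q x0 \<gamma> l m \<theta> v"
    and const: "\<And>t. t \<ge> 0 \<Longrightarrow> norm (\<Sum>k = 1..m. iexp (\<theta> k * t) *s v k) = r"
  shows "((\<lambda>t. exp (\<gamma> * t) / t ^ (l - 1) * norm (mat_exp (- t *\<^sub>R Q) *v x0)) \<longlongrightarrow> r) at_top"
    and "r > 0"
proof -
  let ?w = "\<lambda>t. (exp (\<gamma> * t) / t ^ (l - 1)) *\<^sub>R (mat_exp (- t *\<^sub>R Q) *v x0)"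
  let ?s = "\<lambda>t. \<Sum>k = 1..m. iexp (t * \<theta> k) *s v k"
  have m: "m \<ge> 1" and inj: "inj_on v {1..m}" and ind: "vec.independent (v ` {1..m})"
    and lim: "((\<lambda>t. norm (complex_vec (?w t) - ?s t)) \<longlongrightarrow> 0) at_top"
    using data unfolding asymptotic_data_def by auto
  have "((\<lambda>t. norm (?w t) - r) \<longlongrightarrow> 0) at_top"
  proof (rule Lim_null_comparison[OF _ lim])
    show "\<forall>\<^sub>F t in at_top. norm (norm (?w t) - r) \<le> norm (complex_vec (?w t) - ?s t)"
      using eventually_ge_at_top[of 0]
    proof eventually_elim
      case (elim t)
      have "norm (?s t) = r" using const[OF elim] by (simp add: mult.commute)
      then show ?case
        using norm_triangle_ineq3[of "complex_vec (?w t)" "?s t"] by (simp add: norm_complex_vec)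
    qed
  qed
  then have "((\<lambda>t. norm (?w t)) \<longlongrightarrow> r) at_top" by (rule LIM_zero_cancel)
  moreover have "\<forall>\<^sub>F t in at_top. norm (?w t) = exp (\<gamma> * t) / t ^ (l - 1) * norm (mat_exp (- t *\<^sub>R Q) *v x0)"
    using eventually_gt_at_top[of 0] by eventually_elim simp
  ultimately show "((\<lambda>t. exp (\<gamma> * t) / t ^ (l - 1) * norm (mat_exp (- t *\<^sub>R Q) *v x0)) \<longlongrightarrow> r) at_top"
    by (rule Lim_transform_eventually)
  have "(\<Sum>k = 1..m. v k) \<noteq> 0"
  proof
    assume "(\<Sum>k = 1..m. v k) = 0"
    then have "(\<Sum>x\<in>v ` {1..m}. 1 *s x) = 0" by (subst sum.reindex[OF inj]) simp
    then have "(1::complex) = 0"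
      using vec.independentD[OF ind _ subset_refl, of "\<lambda>_. 1" "v 1"] m by auto
    then show False by simp
  qed
  then have "norm (\<Sum>k = 1..m. v k) > 0" by (simp only: zero_less_norm_iff not_False_eq_True)
  moreover have "norm (\<Sum>k = 1..m. v k) = r" using const[of 0] by simp
  ultimately show "r > 0" by linarith
qed

text \<open>With L = ln (1 / \<epsilon>), the exponential of - \<gamma> T is exactly sqrt \<epsilon>
  times 1 / L ^ n times exp (- c (1 + \<gamma> h)). The powers of T and L then leave (T / L) ^ n,
  whose limit is 1 / (2 \<gamma>) ^ n.\<close>

lemma cutoff_scale:
  fixes \<gamma> c :: real and h :: "real \<Rightarrow> real" and n :: nat
  assumes \<gamma>: "\<gamma> > 0" and h: "(h \<longlongrightarrow> 0) (at_right 0)"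
  defines "T \<equiv> \<lambda>\<epsilon>. 1 / (2 * \<gamma>) * ln (1 / \<epsilon>) + real n / \<gamma> * ln (ln (1 / \<epsilon>)) + c * (1 / \<gamma> + h \<epsilon>)"
  shows "filterlim T at_top (at_right 0)"
    and "((\<lambda>\<epsilon>. T \<epsilon> ^ n * exp (- (\<gamma> * T \<epsilon>)) / sqrt \<epsilon>) \<longlongrightarrow> exp (- c) / (2 * \<gamma>) ^ n) (at_right 0)"
proof -
  define L where "L \<epsilon> = ln (1 / \<epsilon>)" for \<epsilon> :: real
  have L: "filterlim L at_top (at_right 0)" unfolding L_def by real_asymp
  have L_pos: "\<forall>\<^sub>F \<epsilon> in at_right 0. L \<epsilon> > 0" using L by (rule filterlim_at_top_dense[THEN iffD1, rule_format])
  have lnL: "((\<lambda>\<epsilon>. ln (L \<epsilon>) / L \<epsilon>) \<longlongrightarrow> 0) (at_right 0)"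
    by (rule filterlim_compose[OF _ L]) real_asymp
  have invL: "((\<lambda>\<epsilon>. 1 / L \<epsilon>) \<longlongrightarrow> 0) (at_right 0)"
    by (rule filterlim_compose[OF _ L]) real_asymp
  \<comment> \<open>Relative to \<open>L\<close>, the iterated logarithm and the window are
    negligible; only the leading term of \<open>T\<close> remains.\<close>
  have "((\<lambda>\<epsilon>. 1 / (2 * \<gamma>) + real n / \<gamma> * (ln (L \<epsilon>) / L \<epsilon>) + c * (1 / \<gamma> + h \<epsilon>) * (1 / L \<epsilon>))
      \<longlongrightarrow> 1 / (2 * \<gamma>) + real n / \<gamma> * 0 + c * (1 / \<gamma> + 0) * 0) (at_right 0)"
    by (intro tendsto_intros lnL invL h)
  moreover have "\<forall>\<^sub>F \<epsilon> in at_right 0. 1 / (2 * \<gamma>) + real n / \<gamma> * (ln (L \<epsilon>) / L \<epsilon>) + c * (1 / \<gamma> + h \<epsilon>) * (1 / L \<epsilon>) = T \<epsilon> / L \<epsilon>"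
    using L_pos by eventually_elim (simp add: T_def L_def[symmetric] add_divide_distrib)
  ultimately have "((\<lambda>\<epsilon>. T \<epsilon> / L \<epsilon>) \<longlongrightarrow> 1 / (2 * \<gamma>) + real n / \<gamma> * 0 + c * (1 / \<gamma> + 0) * 0) (at_right 0)"
    by (rule Lim_transform_eventually)
  then have TL: "((\<lambda>\<epsilon>. T \<epsilon> / L \<epsilon>) \<longlongrightarrow> 1 / (2 * \<gamma>)) (at_right 0)" by simp
  have "filterlim (\<lambda>\<epsilon>. T \<epsilon> / L \<epsilon> * L \<epsilon>) at_top (at_right 0)"
    using \<gamma> by (intro filterlim_tendsto_pos_mult_at_top[OF TL _ L]) simp
  then show "filterlim T at_top (at_right 0)"
    by (rule filterlim_cong[OF refl refl, THEN iffD1, rotated]) (use L_pos in eventually_elim, simp)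
  have "((\<lambda>\<epsilon>. (T \<epsilon> / L \<epsilon>) ^ n * exp (- (c * (1 + \<gamma> * h \<epsilon>)))) \<longlongrightarrow> (1 / (2 * \<gamma>)) ^ n * exp (- (c * (1 + \<gamma> * 0)))) (at_right 0)"
    by (intro tendsto_intros TL h)
  moreover have "\<forall>\<^sub>F \<epsilon> in at_right 0. (T \<epsilon> / L \<epsilon>) ^ n * exp (- (c * (1 + \<gamma> * h \<epsilon>))) = T \<epsilon> ^ n * exp (- (\<gamma> * T \<epsilon>)) / sqrt \<epsilon>"
    using L_pos eventually_at_right_less[of 0]
  proof eventually_elim
    case (elim \<epsilon>)
    have "- (\<gamma> * T \<epsilon>) = - (L \<epsilon> / 2) + - (real n * ln (L \<epsilon>)) + - (c * (1 + \<gamma> * h \<epsilon>))"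
      using \<gamma> by (simp add: T_def L_def field_simps)
    then have "exp (- (\<gamma> * T \<epsilon>)) = exp (- (L \<epsilon> / 2)) * exp (- (real n * ln (L \<epsilon>))) * exp (- (c * (1 + \<gamma> * h \<epsilon>)))"
      by (simp only: exp_add)
    moreover have "exp (- (L \<epsilon> / 2)) = sqrt \<epsilon>"
    proof -
      have "exp (- (L \<epsilon> / 2)) = exp (ln (sqrt \<epsilon>))" using elim by (simp add: L_def ln_div ln_sqrt)
      then show ?thesis using elim by simp
    qed
    moreover have "exp (- (real n * ln (L \<epsilon>))) = 1 / L \<epsilon> ^ n"
      using elim by (simp add: exp_minus exp_of_nat_mult divide_inverse)
    ultimately show ?case using elim by (simp add: power_divide)
  qed
  ultimately have "((\<lambda>\<epsilon>. T \<epsilon> ^ n * exp (- (\<gamma> * T \<epsilon>)) / sqrt \<epsilon>) \<longlongrightarrow> (1 / (2 * \<gamma>)) ^ n * exp (- (c * (1 + \<gamma> * 0)))) (at_right 0)"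
    by (rule Lim_transform_eventually)
  then show "((\<lambda>\<epsilon>. T \<epsilon> ^ n * exp (- (\<gamma> * T \<epsilon>)) / sqrt \<epsilon>) \<longlongrightarrow> exp (- c) / (2 * \<gamma>) ^ n) (at_right 0)"
    by (simp add: power_divide)
qed

theorem corollary2p4:
  fixes M :: "'w measure"
    and Q :: "real^'d^'d" and x0 a :: "real^'d"
    and S :: "real^'d^'d" and \<nu> :: "(real^'d) measure"
    and \<xi> :: "real \<Rightarrow> 'w \<Rightarrow> real^'d"
    and X :: "real \<Rightarrow> real \<Rightarrow> 'w \<Rightarrow> real^'d"
    and X_inf :: "real \<Rightarrow> (real^'d) measure" and I_inf :: "(real^'d) measure"
    and \<gamma> :: real and l m :: nat and \<theta> :: "nat \<Rightarrow> real" and v :: "nat \<Rightarrow> complex^'d"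
    and h :: "real \<Rightarrow> real"
  assumes Q: "Q \<in> Mplus" and x0: "x0 \<noteq> 0"
    and data: "asymptotic_data Q x0 \<gamma> l m \<theta> v"
    and levy: "levy_process M a S \<nu> \<xi>"
    and log_moment: "integrable M (\<lambda>\<omega>. ln (max 1 (norm (\<xi> 1 \<omega>))))"
    and X: "\<And>\<epsilon>. \<epsilon> > 0 \<Longrightarrow> OU_solution M Q x0 \<xi> \<epsilon> (X \<epsilon>)"
    and X_inf: "\<And>\<epsilon>. \<epsilon> > 0 \<Longrightarrow> limit_law M (X \<epsilon>) (X_inf \<epsilon>)"
    and I_inf: "limit_law M (I_nat Q a \<xi>) I_inf"
    and H: "condition_H (\<lambda>t. distr M borel (I_nat Q a \<xi> t))"
    and invariance: "\<And>u1 u2 :: real^'d. norm u1 = norm u2 \<Longrightarrow>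
           d_TV (distr I_inf borel (\<lambda>x. u1 + x)) I_inf = d_TV (distr I_inf borel (\<lambda>x. u2 + x)) I_inf"
    and h: "(h \<longlongrightarrow> 0) (at_right 0)"
    and const: "\<exists>r. \<forall>t\<ge>0. norm (\<Sum>k = 1..m. iexp (\<theta> k * t) *s v k) = r"
  shows "profile_cutoff
           (\<lambda>\<epsilon> t. d_TV (distr M borel (X \<epsilon> t)) (X_inf \<epsilon>))
           (\<lambda>\<epsilon>. 1 / (2 * \<gamma>) * ln (1 / \<epsilon>) + real (l - 1) / \<gamma> * ln (ln (1 / \<epsilon>)))
           (\<lambda>\<epsilon>. 1 / \<gamma> + h \<epsilon>)"
proof -
  interpret M: prob_space M using levy by (simp add: levy_process_def)
  note pM = M.prob_space_axioms
  have \<gamma>: "\<gamma> > 0" and l: "l \<ge> 1" using data by (auto simp: asymptotic_data_def)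
  have \<xi>_meas: "\<xi> t \<in> borel_measurable M" if "t \<ge> 0" for t using levy that by (simp add: levy_process_def)
  have \<xi>_0: "AE \<omega> in M. \<xi> 0 \<omega> = 0" using levy by (simp add: levy_process_def)
  obtain r where r: "\<And>t. t \<ge> 0 \<Longrightarrow> norm (\<Sum>k = 1..m. iexp (\<theta> k * t) *s v k) = r" using const by auto
  note V_lim = asymptotic_data_norm(1)[OF data r] and r_pos = asymptotic_data_norm(2)[OF data r]
  define U where "U t = mat_exp (- t *\<^sub>R Q) *v x0" for t
  define b where "b t = integral {0..t} (\<lambda>s. mat_exp (- (t - s) *\<^sub>R Q) *v a)" for t
  define J where "J = I_nat Q a \<xi>"
  have J_meas: "J t \<in> borel_measurable M" if "t > 0" for t
    unfolding J_def using that by (intro I_nat_measurable \<xi>_meas) auto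
  have X_meas: "X \<epsilon> t \<in> borel_measurable M" if "\<epsilon> > 0" "t > 0" for \<epsilon> t
    using X[OF that(1)] that(2) by (simp add: OU_solution_def)
  have X_eq: "AE \<omega> in M. X \<epsilon> t \<omega> = sqrt \<epsilon> *\<^sub>R J t \<omega> + (U t + sqrt \<epsilon> *\<^sub>R b t)" if e: "\<epsilon> > 0" and t: "t > 0" for \<epsilon> t
  proof -
    have cl: "AE \<omega> in M. cadlag (\<lambda>t. X \<epsilon> t \<omega>)"
      and ou: "AE \<omega> in M. \<forall>t\<ge>0. X \<epsilon> t \<omega> = x0 - integral {0..t} (\<lambda>s. Q *v X \<epsilon> s \<omega>) + sqrt \<epsilon> *\<^sub>R \<xi> t \<omega>"
      using X[OF e] by (auto simp: OU_solution_def)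
    show ?thesis
      using cl ou \<xi>_0
    proof eventually_elim
      case (elim \<omega>)
      have "J t \<omega> = (1 / sqrt \<epsilon>) *\<^sub>R (X \<epsilon> t \<omega> - U t) - b t"
        unfolding J_def U_def b_def
        by (rule I_nat_pathwise[OF t e, where x="\<lambda>t. X \<epsilon> t \<omega>"]) (use elim in auto)
      then show ?case using e by (simp add: scaleR_diff_right)
    qed
  qed
  have V_lim': "((\<lambda>t. exp (\<gamma> * t) / t ^ (l - 1) * norm (U t)) \<longlongrightarrow> r) at_top"
    using V_lim by (simp add: U_def)
  \<comment> \<open>Decay of the deterministic part is read off the asymptotic data: the normalised
    norm converges and its normalisation tends to infinity.\<close>
  have U_lim: "(U \<longlongrightarrow> 0) at_top"
  proof (rule tendsto_norm_zero_cancel)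
    have "((\<lambda>t. t ^ (l - 1) / exp (\<gamma> * t)) \<longlongrightarrow> 0) at_top" using \<gamma> by real_asymp
    from tendsto_mult[OF this V_lim']
    have "((\<lambda>t. t ^ (l - 1) / exp (\<gamma> * t) * (exp (\<gamma> * t) / t ^ (l - 1) * norm (U t))) \<longlongrightarrow> 0) at_top" by simp
    moreover have "\<forall>\<^sub>F t in at_top. t ^ (l - 1) / exp (\<gamma> * t) * (exp (\<gamma> * t) / t ^ (l - 1) * norm (U t)) = norm (U t)"
      using eventually_gt_at_top[of 0] by eventually_elim simp
    ultimately show "((\<lambda>t. norm (U t)) \<longlongrightarrow> 0) at_top" by (rule Lim_transform_eventually)
  qed
  have J_lim: "limit_law M J I_inf" using I_inf by (simp add: J_def)
  note prI = limit_law_prob[OF J_lim] limit_law_sets[OF J_lim]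
  note [measurable_cong] = prI(2)
  have scaled_lim: "limit_law M (\<lambda>t \<omega>. sqrt \<epsilon> *\<^sub>R J t \<omega>) (distr I_inf borel (\<lambda>x. sqrt \<epsilon> *\<^sub>R x))" for \<epsilon>
    by (rule limit_law_continuous_image[OF J_lim]) (intro continuous_intros)
  have scaled_meas: "(\<lambda>\<omega>. sqrt \<epsilon> *\<^sub>R J t \<omega>) \<in> borel_measurable M" if "t > 0" for t \<epsilon>
    using J_meas[OF that] by simp
  have shift_lim: "limit_law M (\<lambda>t \<omega>. sqrt \<epsilon> *\<^sub>R J t \<omega> + (U t + sqrt \<epsilon> *\<^sub>R b t)) (X_inf \<epsilon>)" if e: "\<epsilon> > 0" for \<epsilon>
    by (rule limit_law_cong_AE[OF X_inf[OF e] X_meas[OF e] _ X_eq[OF e]]) (use scaled_meas in auto)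
  \<comment> \<open>Since \<open>b\<close> does not involve \<epsilon>, the single noise level
    \<epsilon> = 1 decides its convergence. The two limit laws give a limit for U + b, from which
    the vanishing \<open>U\<close> is subtracted.\<close>
  obtain b0 where b_lim: "(b \<longlongrightarrow> b0) at_top"
  proof -
    obtain k where "((\<lambda>t. U t + sqrt 1 *\<^sub>R b t) \<longlongrightarrow> k) at_top"
      by (rule limit_law_shift_converges[OF pM scaled_meas scaled_lim shift_lim[of 1]]) auto
    from tendsto_diff[OF this U_lim] have "(b \<longlongrightarrow> k) at_top" by simp
    then show thesis by (rule that)
  qed
  have X_inf_eq: "X_inf \<epsilon> = distr I_inf borel (\<lambda>x. sqrt \<epsilon> *\<^sub>R (b0 + x))" if e: "\<epsilon> > 0" for \<epsilon>
  proof -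
    have "((\<lambda>t. U t + sqrt \<epsilon> *\<^sub>R b t) \<longlongrightarrow> 0 + sqrt \<epsilon> *\<^sub>R b0) at_top"
      by (intro tendsto_intros U_lim b_lim)
    then have "X_inf \<epsilon> = distr (distr I_inf borel (\<lambda>x. sqrt \<epsilon> *\<^sub>R x)) borel ((+) (0 + sqrt \<epsilon> *\<^sub>R b0))"
      by (intro limit_law_shift_eq[OF pM scaled_meas scaled_lim shift_lim[OF e]])
    then show ?thesis by (subst (asm) distr_distr) (simp_all add: comp_def scaleR_add_right)
  qed
  define g where "g u = d_TV (distr I_inf borel ((+) u)) I_inf" for u
  define \<mu> where "\<mu> t = distr M borel (J t)" for t
  have \<mu>_prob: "prob_space (\<mu> t)" "sets (\<mu> t) = sets borel" if "t > 0" for t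
    unfolding \<mu>_def using J_meas[OF that] by (auto intro: M.prob_space_distr)
  have H': "condition_H \<mu>" using H unfolding \<mu>_def[abs_def] J_def .
  have conv: "((\<lambda>t. char_fun (\<mu> t) z) \<longlongrightarrow> char_fun I_inf z) at_top" for z
    unfolding \<mu>_def by (rule limit_law_char_fun[OF pM J_meas J_lim])
  have \<mu>_sets: "sets (\<mu> t) = sets borel" for t by (simp add: \<mu>_def)
  have \<mu>_lim: "((\<lambda>t. d_TV (\<mu> t) I_inf) \<longlongrightarrow> 0) at_top"
    by (rule condition_H_d_TV[OF H' \<mu>_prob(1) \<mu>_sets prI conv])
  have int_I: "integrable lborel (char_fun I_inf)"
    by (rule condition_H_integrable_limit[OF H' \<mu>_prob(1) \<mu>_sets prI conv])
  have g_cont: "isCont g u" for u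
    unfolding g_def by (rule d_TV_translate_continuous[OF prI int_I])
  have g_inf: "(g \<longlongrightarrow> 1) at_infinity"
    unfolding g_def by (rule d_TV_translate_at_infinity[OF prI])
  have g_zero: "g 0 = 0"
  proof -
    have "(+) 0 = (\<lambda>x::real^'d. x)" by auto
    then have "g 0 = d_TV I_inf I_inf" by (simp add: g_def distr_id2[OF prI(2)[symmetric]])
    moreover have "d_TV I_inf I_inf \<le> 0" by (rule d_TV_leI) simp
    ultimately show ?thesis using d_TV_nonneg[OF prI(1) prI(1)] by simp
  qed
  \<comment> \<open>Chosen so that \<open>X\<close> at time \<open>t\<close> is the image of
    \<open>\<delta> \<epsilon> t + J t\<close> under the same affine map that sends
    \<open>I_inf\<close> to \<open>X_inf\<close>.\<close>
  define \<delta> where "\<delta> \<epsilon> t = (1 / sqrt \<epsilon>) *\<^sub>R U t + (b t - b0)" for \<epsilon> t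
  \<comment> \<open>The error on the right is free of \<epsilon>, so it vanishes along any choice of
    times tending to infinity.\<close>
  have dist_bound: "\<bar>d_TV (distr M borel (X \<epsilon> t)) (X_inf \<epsilon>) - g (\<delta> \<epsilon> t)\<bar> \<le> d_TV (\<mu> t) I_inf" if e: "\<epsilon> > 0" and t: "t > 0" for \<epsilon> t
  proof -
    note [measurable] = J_meas[OF t] X_meas[OF e t]
    let ?f = "\<lambda>x. sqrt \<epsilon> *\<^sub>R (b0 + x)"
    let ?u = "\<delta> \<epsilon> t"
    have \<nu>: "prob_space (distr (\<mu> t) borel ((+) ?u))" "prob_space (distr I_inf borel ((+) ?u))"
      using \<mu>_prob(1)[OF t] prI(1) by (auto intro!: prob_space.prob_space_distr simp: \<mu>_def)
    have "sqrt \<epsilon> *\<^sub>R J t \<omega> + (U t + sqrt \<epsilon> *\<^sub>R b t) = ?f (?u + J t \<omega>)" for \<omega>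
      using e by (simp add: \<delta>_def scaleR_add_right scaleR_diff_right)
    then have "distr M borel (X \<epsilon> t) = distr M borel (\<lambda>\<omega>. ?f (?u + J t \<omega>))"
      using X_eq[OF e t] by (intro distr_cong_AE) auto
    also have "\<dots> = distr (distr (\<mu> t) borel ((+) ?u)) borel ?f"
      by (simp add: \<mu>_def distr_distr comp_def)
    finally have "d_TV (distr M borel (X \<epsilon> t)) (X_inf \<epsilon>) = d_TV (distr (distr (\<mu> t) borel ((+) ?u)) borel ?f) (distr I_inf borel ?f)"
      by (simp add: X_inf_eq[OF e])
    also have "\<dots> = d_TV (distr (\<mu> t) borel ((+) ?u)) I_inf"
      by (rule d_TV_distr_eq[OF \<nu>(1) _ prI, where g="\<lambda>x. (1 / sqrt \<epsilon>) *\<^sub>R x - b0"]) (use e in auto)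
    finally have D: "d_TV (distr M borel (X \<epsilon> t)) (X_inf \<epsilon>) = d_TV (distr (\<mu> t) borel ((+) ?u)) I_inf" .
    have "d_TV (distr (\<mu> t) borel ((+) ?u)) (distr I_inf borel ((+) ?u)) \<le> d_TV (\<mu> t) I_inf"
      by (rule d_TV_distr_le[OF \<mu>_prob[OF t] prI]) simp
    then show ?thesis
      unfolding D g_def
      using d_TV_triangle[OF \<nu>(1,2) prI(1)] d_TV_triangle[OF \<nu>(2,1) prI(1)]
        d_TV_commute[of "distr (\<mu> t) borel ((+) ?u)" "distr I_inf borel ((+) ?u)"] by linarith
  qed
  let ?t = "\<lambda>\<epsilon>. 1 / (2 * \<gamma>) * ln (1 / \<epsilon>) + real (l - 1) / \<gamma> * ln (ln (1 / \<epsilon>))"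
  let ?w = "\<lambda>\<epsilon>. 1 / \<gamma> + h \<epsilon>"
  \<comment> \<open>Any unit vector serves as the reference direction; the coordinate index is
    arbitrary.\<close>
  define u :: "real^'d" where "u = axis undefined 1"
  have u: "norm u = 1" by (simp add: u_def)
  define \<rho> where "\<rho> c = exp (- c) / (2 * \<gamma>) ^ (l - 1) * r" for c
  have \<rho>: "\<rho> c > 0" for c using \<gamma> r_pos by (simp add: \<rho>_def)
  have g_norm: "g w = g (norm w *\<^sub>R u)" for w
    unfolding g_def using invariance[of w "norm w *\<^sub>R u"] u by simp
  have t_lim: "filterlim ?t at_top (at_right 0)"
    using cutoff_scale(1)[OF \<gamma> h, of "l - 1" 0] by simp
  have lim: "((\<lambda>\<epsilon>. d_TV (distr M borel (X \<epsilon> (?t \<epsilon> + c * ?w \<epsilon>))) (X_inf \<epsilon>)) \<longlongrightarrow> g (\<rho> c *\<^sub>R u)) (at_right 0)" for c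
  proof -
    define T where "T \<epsilon> = ?t \<epsilon> + c * ?w \<epsilon>" for \<epsilon>
    have T_lim: "filterlim T at_top (at_right 0)"
      and T_scale: "((\<lambda>\<epsilon>. T \<epsilon> ^ (l - 1) * exp (- (\<gamma> * T \<epsilon>)) / sqrt \<epsilon>) \<longlongrightarrow> exp (- c) / (2 * \<gamma>) ^ (l - 1)) (at_right 0)"
      unfolding T_def using cutoff_scale[OF \<gamma> h, of "l - 1" c] by auto
    have T_pos: "\<forall>\<^sub>F \<epsilon> in at_right 0. T \<epsilon> > 0" using T_lim by (rule filterlim_at_top_dense[THEN iffD1, rule_format])
    have e_pos: "\<forall>\<^sub>F \<epsilon> in at_right (0::real). \<epsilon> > 0" by (rule eventually_at_right_less)
    have "((\<lambda>\<epsilon>. T \<epsilon> ^ (l - 1) * exp (- (\<gamma> * T \<epsilon>)) / sqrt \<epsilon> * (exp (\<gamma> * T \<epsilon>) / T \<epsilon> ^ (l - 1) * norm (U (T \<epsilon>)))) \<longlongrightarrow> \<rho> c) (at_right 0)"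
      unfolding \<rho>_def by (intro tendsto_mult T_scale filterlim_compose[OF V_lim' T_lim])
    moreover have "\<forall>\<^sub>F \<epsilon> in at_right 0. T \<epsilon> ^ (l - 1) * exp (- (\<gamma> * T \<epsilon>)) / sqrt \<epsilon> * (exp (\<gamma> * T \<epsilon>) / T \<epsilon> ^ (l - 1) * norm (U (T \<epsilon>)))
        = norm ((1 / sqrt \<epsilon>) *\<^sub>R U (T \<epsilon>))"
      using T_pos e_pos by eventually_elim (simp add: exp_minus)
    ultimately have U_norm: "((\<lambda>\<epsilon>. norm ((1 / sqrt \<epsilon>) *\<^sub>R U (T \<epsilon>))) \<longlongrightarrow> \<rho> c) (at_right 0)"
      by (rule Lim_transform_eventually)
    have bT: "((\<lambda>\<epsilon>. norm (b (T \<epsilon>) - b0)) \<longlongrightarrow> 0) (at_right 0)"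
      using tendsto_norm_zero[OF LIM_zero[OF filterlim_compose[OF b_lim T_lim]]] .
    \<comment> \<open>The drift correction is not divided by sqrt \<epsilon>, so it disappears as
      \<open>b\<close> approaches \<open>b0\<close>, and the norm of the shift follows that of the
      deterministic part.\<close>
    have "((\<lambda>\<epsilon>. norm (\<delta> \<epsilon> (T \<epsilon>)) - norm ((1 / sqrt \<epsilon>) *\<^sub>R U (T \<epsilon>))) \<longlongrightarrow> 0) (at_right 0)"
    proof (rule Lim_null_comparison[OF always_eventually bT], rule allI)
      show "norm (norm (\<delta> \<epsilon> (T \<epsilon>)) - norm ((1 / sqrt \<epsilon>) *\<^sub>R U (T \<epsilon>))) \<le> norm (b (T \<epsilon>) - b0)" for \<epsilon>
        using norm_triangle_ineq3[of "\<delta> \<epsilon> (T \<epsilon>)" "(1 / sqrt \<epsilon>) *\<^sub>R U (T \<epsilon>)"] unfolding \<delta>_def by simp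
    qed
    from tendsto_add[OF this U_norm] have "((\<lambda>\<epsilon>. norm (\<delta> \<epsilon> (T \<epsilon>))) \<longlongrightarrow> \<rho> c) (at_right 0)" by simp
    then have "((\<lambda>\<epsilon>. g (norm (\<delta> \<epsilon> (T \<epsilon>)) *\<^sub>R u)) \<longlongrightarrow> g (\<rho> c *\<^sub>R u)) (at_right 0)"
      by (intro isCont_tendsto_compose[OF g_cont] tendsto_scaleR tendsto_const)
    then have g_lim: "((\<lambda>\<epsilon>. g (\<delta> \<epsilon> (T \<epsilon>))) \<longlongrightarrow> g (\<rho> c *\<^sub>R u)) (at_right 0)" by (simp flip: g_norm)
    have "((\<lambda>\<epsilon>. d_TV (distr M borel (X \<epsilon> (T \<epsilon>))) (X_inf \<epsilon>) - g (\<delta> \<epsilon> (T \<epsilon>))) \<longlongrightarrow> 0) (at_right 0)"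
    proof (rule Lim_null_comparison[OF _ filterlim_compose[OF \<mu>_lim T_lim]])
      show "\<forall>\<^sub>F \<epsilon> in at_right 0. norm (d_TV (distr M borel (X \<epsilon> (T \<epsilon>))) (X_inf \<epsilon>) - g (\<delta> \<epsilon> (T \<epsilon>))) \<le> d_TV (\<mu> (T \<epsilon>)) I_inf"
        using T_pos e_pos by eventually_elim (simp add: dist_bound)
    qed
    from tendsto_add[OF this g_lim] show ?thesis by (simp add: T_def)
  qed
  show ?thesis
    unfolding profile_cutoff_def
  proof (intro conjI exI[of _ "\<lambda>c. g (\<rho> c *\<^sub>R u)"] allI)
    show "filterlim ?t at_top (at_right 0)" by (rule t_lim)
    have "((\<lambda>\<epsilon>. ?w \<epsilon> / ?t \<epsilon>) \<longlongrightarrow> 0) (at_right 0)"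
      by (rule tendsto_divide_0[OF tendsto_add[OF tendsto_const h] filterlim_at_top_imp_at_infinity[OF t_lim]])
    then show "?w \<in> o[at_right 0](?t)"
    proof (rule smalloI_tendsto)
      show "\<forall>\<^sub>F \<epsilon> in at_right 0. ?t \<epsilon> \<noteq> 0"
        using t_lim[THEN filterlim_at_top_dense[THEN iffD1, rule_format], of 0] by eventually_elim simp
    qed
    show "((\<lambda>\<epsilon>. d_TV (distr M borel (X \<epsilon> (?t \<epsilon> + c * ?w \<epsilon>))) (X_inf \<epsilon>)) \<longlongrightarrow> g (\<rho> c *\<^sub>R u)) (at_right 0)" for c
      by (rule lim)
    \<comment> \<open>The limiting norm is C exp (- c): it escapes to infinity at the left end and
      shrinks to 0 at the right end, so the ends of the profile are the behaviour of
      \<open>g\<close> at infinity and at 0.\<close>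
    define C where "C = r / (2 * \<gamma>) ^ (l - 1)"
    have C: "C > 0" using \<gamma> r_pos by (simp add: C_def)
    have \<rho>_eq: "\<rho> = (\<lambda>c. C * exp (- c))" by (auto simp: \<rho>_def C_def)
    have "filterlim \<rho> at_top at_bot" unfolding \<rho>_eq using C by real_asymp
    moreover have "(\<lambda>c. norm (\<rho> c *\<^sub>R u)) = \<rho>" using u \<rho> by (auto simp: abs_of_pos)
    ultimately have "filterlim (\<lambda>c. \<rho> c *\<^sub>R u) at_infinity at_bot"
      by (intro filterlim_at_infinity_conv_norm_at_top[THEN iffD2]) simp
    then show "((\<lambda>c. g (\<rho> c *\<^sub>R u)) \<longlongrightarrow> 1) at_bot"
      by (rule filterlim_compose[OF g_inf])
    have "(\<rho> \<longlongrightarrow> 0) at_top" unfolding \<rho>_eq by real_asymp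
    then have "((\<lambda>c. g (\<rho> c *\<^sub>R u)) \<longlongrightarrow> g (0 *\<^sub>R u)) at_top"
      by (intro isCont_tendsto_compose[OF g_cont] tendsto_scaleR tendsto_const)
    then show "((\<lambda>c. g (\<rho> c *\<^sub>R u)) \<longlongrightarrow> 0) at_top" by (simp add: g_zero)
  qed
qed

end
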